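(* Let $0<q<1$, let $f\in C_+(\partial^\infty\Omega)$ and let $\mu,\nu\in\mathcal M_+(\Omega)$. If $u$ is a bounded solution of the Dirichlet problem $$-\Delta u=\mu u^q+\nu \ \text{ in }\Omega,\qquad u>0\ \text{ in }\Omega,\qquad u=f\ \text{ on }\partial^\infty\Omega,$$ then, with $c_1:=(1-q)^{\frac1{1-q}}$ and $$c_2:=\max\Bigl\{1,\bigl(\|G_\Omega[\mu]\|_\infty+\|G_\Omega[\nu]\|_\infty+\|f\|_\infty\bigr)^{\frac1{1-q}}\Bigr\}<+\infty,$$ the following estimates hold. (i) Lower estimate: $u(x)\ge c_1\,G_\Omega[\mu](x)^{\frac1{1-q}}+G_\Omega[\nu](x)+H_f(x)$ for all $x\in\Omega$. (ii) Upper estimate: $u(x)\le c_2^{\,q}\,G_\Omega[\mu](x)+G_\Omega[\nu](x)+H_f(x)$ for all $x\in\Omega$. (iii) Uniform estimate: $\|u\|_\infty\le c_2$.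
   Context: $\Omega$ is a domain in $\mathbb R^n$ ($n\ge 2$) possessing the Green function $G_\Omega$ for the Dirichlet Laplacian $-\Delta$. $\partial^\infty\Omega$ and $\overline{\Omega}^\infty$ are the boundary and closure of $\Omega$ in the one-point compactification $\mathbb R^n\cup\{\infty\}$. $\Omega$ is assumed regular for the Dirichlet problem for the Laplace equation (every point of $\partial^\infty\Omega$ is regular), so that $G_\Omega(\cdot,y)$ vanishes continuously on $\partial^\infty\Omega$ for each $y\in\Omega$. $\mathcal M_+(\Omega)$ is the set of nonnegative Radon measures on $\Omega$; $C_+(\partial^\infty\Omega)$ is the set of nonnegative continuous functions on $\partial^\infty\Omega$. $\|\psi\|_\infty$ is the supremum norm of $\psi$ on its domain of definition. For $\mu\in\mathcal M_+(\Omega)$ and measurable $\psi\ge 0$, $G_\Omega[\psi\,d\mu](x):=\int_\Omega G_\Omega(x,y)\psi(y)\,d\mu(y)$ and $G_\Omega[\mu]:=G_\Omega[1\,d\mu]$. $H_f$ is the Perron–Wiener–Brelot solution of $\Delta h=0$ in $\Omega$, $h=f$ on $\partial^\infty\Omega$. A solution of the Dirichlet problem is understood in the integral sense: a positive function $u$ in $\Omega$ satisfying $u(x)=G_\Omega[u^q\,d\mu](x)+G_\Omega[\nu](x)+H_f(x)$ for all $x\in\Omega$. *)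

theory Defs
  imports "HOL-Analysis.Analysis"
begin

section \<open>Harmonic and superharmonic functions\<close>

text \<open>\<open>h\<close> is of class \<open>C\<^sup>2\<close> on the open set \<open>\<Omega>\<close> (with derivatives \<open>D\<close>, \<open>D2\<close>), and the
  trace of its Hessian vanishes there.\<close>

definition harmonic_on :: "'a::euclidean_space set \<Rightarrow> ('a \<Rightarrow> real) \<Rightarrow> bool" where
  "harmonic_on \<Omega> h \<longleftrightarrow>
     (\<exists>(D :: 'a \<Rightarrow> ('a \<Rightarrow>\<^sub>L real)) (D2 :: 'a \<Rightarrow> ('a \<Rightarrow>\<^sub>L ('a \<Rightarrow>\<^sub>L real))).
        (\<forall>x\<in>\<Omega>. (h has_derivative blinfun_apply (D x)) (at x)) \<and>
        (\<forall>x\<in>\<Omega>. (D has_derivative blinfun_apply (D2 x)) (at x)) \<and>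
        continuous_on \<Omega> D2 \<and>
        (\<forall>x\<in>\<Omega>. (\<Sum>b\<in>Basis. blinfun_apply (blinfun_apply (D2 x) b) b) = 0))"

text \<open>The volume mean of an extended real function over a ball, as the integral of the positive
  part minus the integral of the negative part. It is only used where the latter is finite.\<close>

definition ball_mean :: "('a::euclidean_space \<Rightarrow> ereal) \<Rightarrow> 'a \<Rightarrow> real \<Rightarrow> ereal" where
  "ball_mean s x r =
     (enn2ereal (\<integral>\<^sup>+ y\<in>ball x r. e2ennreal (s y) \<partial>lborel)
       - enn2ereal (\<integral>\<^sup>+ y\<in>ball x r. e2ennreal (- s y) \<partial>lborel))
     / ereal (measure lborel (ball x r))"

text \<open>Superharmonicity on an open set: lower semicontinuous, with values in \<open>(-\<infinity>, \<infinity>]\<close>, not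
  identically \<open>\<infinity>\<close> on any component, and with the local super-mean-value property. By the usual
  minimum principle argument this local property is equivalent to the super-mean-value
  inequality for all closed balls (or spheres bounding balls) contained in \<open>\<Omega>\<close>.\<close>

definition superharmonic_on :: "'a::euclidean_space set \<Rightarrow> ('a \<Rightarrow> ereal) \<Rightarrow> bool" where
  "superharmonic_on \<Omega> s \<longleftrightarrow>
     (\<forall>a. open {x\<in>\<Omega>. a < s x}) \<and>
     (\<forall>x\<in>\<Omega>. s x \<noteq> -\<infinity>) \<and>
     (\<forall>C\<in>components \<Omega>. \<exists>x\<in>C. s x \<noteq> \<infinity>) \<and>
     (\<forall>x\<in>\<Omega>. \<exists>R>0. cball x R \<subseteq> \<Omega> \<and> (\<forall>r. 0 < r \<and> r \<le> R \<longrightarrow> ball_mean s x r \<le> s x))"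

section \<open>The Green function of the Dirichlet Laplacian\<close>

text \<open>The fundamental solution of \<open>-\<Delta>\<close>, i.e. \<open>-\<Delta> \<Phi> = \<delta>\<^sub>0\<close>; the unit sphere of an
  \<open>n\<close>-dimensional space has surface area \<open>n * unit_ball_vol n\<close>.\<close>

definition fundamental_solution :: "'a::euclidean_space \<Rightarrow> ereal" where
  "fundamental_solution x =
     (if x = 0 then \<infinity>
      else if DIM('a) = 2 then ereal (- ln (norm x) / (2 * pi))
      else ereal (1 / ((real DIM('a) - 2) * (real DIM('a) * unit_ball_vol (real DIM('a)))
                        * norm x ^ (DIM('a) - 2))))"

text \<open>\<open>G\<close> is the Green function of \<open>\<Omega>\<close>, with pole in the second argument: it is nonnegative, has
  the form fundamental solution plus harmonic function, and is the smallest nonnegative function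
  of the form fundamental solution plus superharmonic function. These conditions determine
  \<open>G\<close> on \<open>\<Omega> \<times> \<Omega>\<close>; its values elsewhere are irrelevant.\<close>

definition is_green_function :: "'a::euclidean_space set \<Rightarrow> ('a \<Rightarrow> 'a \<Rightarrow> ereal) \<Rightarrow> bool" where
  "is_green_function \<Omega> G \<longleftrightarrow>
     (\<forall>y\<in>\<Omega>.
        (\<exists>h. harmonic_on \<Omega> h \<and>
             (\<forall>x\<in>\<Omega>. G x y = fundamental_solution (x - y) + ereal (h x))) \<and>
        (\<forall>x\<in>\<Omega>. 0 \<le> G x y) \<and>
        (\<forall>w. superharmonic_on \<Omega> w \<and> (\<forall>x\<in>\<Omega>. 0 \<le> fundamental_solution (x - y) + w x)
              \<longrightarrow> (\<forall>x\<in>\<Omega>. G x y \<le> fundamental_solution (x - y) + w x)))"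

section \<open>Boundary in the one-point compactification and Dirichlet problem\<close>

text \<open>The one-point compactification lives on \<open>'a option\<close>, \<open>None\<close> being the point at infinity.\<close>

definition boundary_inf :: "'a::euclidean_space set \<Rightarrow> 'a option set" where
  "boundary_inf \<Omega> = Alexandroff_compactification euclidean frontier_of (Some ` \<Omega>)"

definition continuous_boundary_inf :: "'a::euclidean_space set \<Rightarrow> ('a option \<Rightarrow> real) \<Rightarrow> bool" where
  "continuous_boundary_inf \<Omega> f \<longleftrightarrow>
     continuous_map (subtopology (Alexandroff_compactification euclidean) (boundary_inf \<Omega>)) euclideanreal f"

text \<open>The filter \<open>x \<rightarrow> \<zeta>\<close>, \<open>x \<in> \<Omega>\<close>, for a boundary point \<open>\<zeta>\<close> (possibly infinity).\<close>

definition approach :: "'a::euclidean_space set \<Rightarrow> 'a option \<Rightarrow> 'a filter" where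
  "approach \<Omega> \<zeta> = filtercomap Some (atin_within (Alexandroff_compactification euclidean) \<zeta> (Some ` \<Omega>))"

text \<open>The Perron--Wiener--Brelot method.\<close>

definition perron_upper_class ::
    "'a::euclidean_space set \<Rightarrow> ('a option \<Rightarrow> real) \<Rightarrow> ('a \<Rightarrow> ereal) set" where
  "perron_upper_class \<Omega> f =
     {s. superharmonic_on \<Omega> s \<and> (\<exists>m::real. \<forall>x\<in>\<Omega>. ereal m \<le> s x) \<and>
         (\<forall>\<zeta>\<in>boundary_inf \<Omega>. ereal (f \<zeta>) \<le> Liminf (approach \<Omega> \<zeta>) s)}"

definition perron_upper ::
    "'a::euclidean_space set \<Rightarrow> ('a option \<Rightarrow> real) \<Rightarrow> 'a \<Rightarrow> ereal" where
  "perron_upper \<Omega> f x = (INF s\<in>perron_upper_class \<Omega> f. s x)"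

definition perron_lower ::
    "'a::euclidean_space set \<Rightarrow> ('a option \<Rightarrow> real) \<Rightarrow> 'a \<Rightarrow> ereal" where
  "perron_lower \<Omega> f x = - perron_upper \<Omega> (\<lambda>\<zeta>. - f \<zeta>) x"

definition pwb_solution ::
    "'a::euclidean_space set \<Rightarrow> ('a option \<Rightarrow> real) \<Rightarrow> 'a \<Rightarrow> real" where
  "pwb_solution \<Omega> f x = real_of_ereal (perron_upper \<Omega> f x)"

definition resolutive :: "'a::euclidean_space set \<Rightarrow> ('a option \<Rightarrow> real) \<Rightarrow> bool" where
  "resolutive \<Omega> f \<longleftrightarrow>
     (\<forall>x\<in>\<Omega>. perron_upper \<Omega> f x = perron_lower \<Omega> f x \<and> \<bar>perron_upper \<Omega> f x\<bar> \<noteq> \<infinity>) \<and>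
     harmonic_on \<Omega> (pwb_solution \<Omega> f)"

definition regular_boundary_point :: "'a::euclidean_space set \<Rightarrow> 'a option \<Rightarrow> bool" where
  "regular_boundary_point \<Omega> \<zeta> \<longleftrightarrow>
     (\<forall>f. continuous_boundary_inf \<Omega> f \<longrightarrow>
          resolutive \<Omega> f \<and> (pwb_solution \<Omega> f \<longlongrightarrow> f \<zeta>) (approach \<Omega> \<zeta>))"

definition regular_domain :: "'a::euclidean_space set \<Rightarrow> bool" where
  "regular_domain \<Omega> \<longleftrightarrow> (\<forall>\<zeta>\<in>boundary_inf \<Omega>. regular_boundary_point \<Omega> \<zeta>)"

section \<open>Measures, potentials and solutions\<close>

text \<open>On an open subset of a Euclidean space every Borel measure that is finite on compact sets is
  a Radon measure. The measure space of \<open>\<mu>\<close> is \<open>\<Omega>\<close> itself.\<close>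

definition radon_measure_on :: "'a::euclidean_space set \<Rightarrow> 'a measure \<Rightarrow> bool" where
  "radon_measure_on \<Omega> \<mu> \<longleftrightarrow>
     sets \<mu> = sets (restrict_space borel \<Omega>) \<and> (\<forall>K. compact K \<and> K \<subseteq> \<Omega> \<longrightarrow> emeasure \<mu> K < \<infinity>)"

text \<open>\<open>potential G \<mu> \<psi>\<close> is \<open>G[\<psi> d\<mu>]\<close>, for nonnegative \<open>\<psi>\<close>.\<close>

definition potential ::
    "('a \<Rightarrow> 'a \<Rightarrow> ereal) \<Rightarrow> 'a measure \<Rightarrow> ('a \<Rightarrow> real) \<Rightarrow> 'a \<Rightarrow> ereal" where
  "potential G \<mu> \<psi> x = enn2ereal (\<integral>\<^sup>+ y. e2ennreal (G x y) * ennreal (\<psi> y) \<partial>\<mu>)"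

definition is_solution ::
    "'a::euclidean_space set \<Rightarrow> ('a \<Rightarrow> 'a \<Rightarrow> ereal) \<Rightarrow> real \<Rightarrow> 'a measure \<Rightarrow> 'a measure \<Rightarrow>
      ('a option \<Rightarrow> real) \<Rightarrow> ('a \<Rightarrow> real) \<Rightarrow> bool" where
  "is_solution \<Omega> G q \<mu> \<nu> f u \<longleftrightarrow>
     u \<in> borel_measurable (restrict_space borel \<Omega>) \<and>
     (\<forall>x\<in>\<Omega>. 0 < u x) \<and>
     (\<forall>x\<in>\<Omega>. ereal (u x) =
        potential G \<mu> (\<lambda>y. u y powr q) x + potential G \<nu> (\<lambda>_. 1) x + ereal (pwb_solution \<Omega> f x))"

definition sup_norm :: "'b set \<Rightarrow> ('b \<Rightarrow> ereal) \<Rightarrow> ereal" where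
  "sup_norm A g = (SUP x\<in>A. \<bar>g x\<bar>)"

text \<open>Powers of elements of \<open>[0, \<infinity>]\<close> with positive exponent.\<close>

definition epowr :: "ereal \<Rightarrow> real \<Rightarrow> ereal" where
  "epowr a p = (if a = \<infinity> then \<infinity> else ereal (real_of_ereal a powr p))"

end

theory Submission
  imports Defs
begin

text \<open>
  Write \<open>s = 1 / (1 - q)\<close> and \<open>p = G[\<mu>]\<close>. By the maximum principle for Green potentials, the part of \<open>\<mu>\<close>
  carried by \<open>{p \<le> t}\<close> has a potential bounded by \<open>t\<close> on all of \<open>\<Omega>\<close>; a layer cake integration turns this
  into \<open>p powr s \<le> s * G[p powr (s - 1) \<mu>]\<close>. Hence a bound \<open>u \<ge> c * p powr s\<close> improves itself to
  \<open>G[u powr q \<mu>] \<ge> (1 - q) * c powr q * p powr s\<close>, and iterating drives \<open>c\<close> to the fixed point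
  \<open>c1 = (1 - q) powr s\<close>. This is the lower estimate; it also bounds \<open>G[\<mu>]\<close>. The other two estimates follow
  by inserting \<open>u \<le> sup u\<close> into the integral equation.

  The maximum principle rests only on the minimality of the Green function: if the potential is continuous
  and exceeds \<open>t\<close> somewhere, then subtracting from \<open>G(\<cdot>, y0)\<close> a small multiple of the excess gives a smaller
  competitor. Continuity is arranged by an Egorov argument, which exhausts \<open>\<mu>\<close> by restrictions with
  continuous potentials.
\<close>

text \<open>The exponent is forced by \<open>s * q = s - 1\<close>: raising
  \<open>c * p powr s\<close> to the power \<open>q\<close> gives
  \<open>c powr q * p powr (s - 1)\<close>, the integrand of the layer cake inequality, whose factor
  \<open>s\<close> is undone by \<open>1 / s = 1 - q\<close>. The iteration needs a positive
  constant to start from, but nothing bounds \<open>u\<close> away from 0 on \<Omega>. It therefore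
  runs on subsets \<open>E\<close> of compact sets on which \<open>u \<ge> a > 0\<close>. The
  starting constant depends on \<open>a\<close> and on a bound for the potential of
  \<open>E\<close>; the limit does not, so the estimate passes to an exhaustion of \<Omega>.

  The Green function is accessible only through its definition, in the first variable and with the
  pole fixed. Minimality is phrased with ball means, so harmonic functions must first be shown to
  have the mean value property. Joint continuity in point and pole, and domination by one pole off a
  compact set, are then deduced by exhibiting competitors; positivity comes from the minimum
  principle on the punctured domain.\<close>

section \<open>The mean value property of harmonic functions\<close>

text \<open>Extended by zero (through the nearest point projection), \<open>F\<close> is Lipschitz with compact support. Its
  difference quotients have integral zero by translation invariance and converge dominatedly.\<close>

lemma integral_directional_derivative_ball:
  fixes F :: "'a::euclidean_space \<Rightarrow> real" and F' :: "'a \<Rightarrow> 'a \<Rightarrow> real"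
  assumes deriv: "\<And>z. norm z \<le> 1 \<Longrightarrow> (F has_derivative F' z) (at z)"
    and cont: "continuous_on (cball 0 1) (\<lambda>z. F' z e)"
    and bound: "\<And>z v. norm z \<le> 1 \<Longrightarrow> \<bar>F' z v\<bar> \<le> L * norm v"
    and vanish: "\<And>z. norm z = 1 \<Longrightarrow> F z = 0"
    and e: "norm e = 1"
  shows "(LINT z:cball 0 1|lborel. F' z e) = 0"
proof -
  define H where "H z = F (closest_point (cball 0 1) z)" for z
  have H_in: "H z = F z" if "norm z \<le> 1" for z
    using that by (simp add: H_def closest_point_self)
  have H_out: "H z = 0" if "norm z \<ge> 1" for z
  proof (cases "norm z = 1")
    case True
    then show ?thesis by (simp add: H_in vanish)
  next
    case False
    then have "closest_point (cball 0 1) z \<in> rel_frontier (cball (0::'a) 1)"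
      using that by (intro closest_point_in_rel_frontier)
        (auto simp: affine_hull_nonempty_interior rel_interior_interior)
    then show ?thesis by (auto simp: H_def vanish rel_frontier_frontier affine_hull_nonempty_interior)
  qed
  have L0: "L \<ge> 0" using bound[of 0 e] e by simp
  have Lip0: "\<bar>F z - F w\<bar> \<le> L * norm (z - w)" if "norm z \<le> 1" "norm w \<le> 1" for z w
  proof -
    have "norm (F z - F w) \<le> L * norm (z - w)"
    proof (rule differentiable_bound[where S="cball 0 1" and f'=F'])
      show "onorm (F' x) \<le> L" if "x \<in> cball 0 1" for x
        using that bound[of x] L0 by (intro onorm_bound) auto
    qed (use that deriv in \<open>auto intro: has_derivative_at_withinI\<close>)
    then show ?thesis by simp
  qed
  \<comment> \<open>The projection is 1-Lipschitz, so the constant \<open>L\<close> carries over to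
    the whole space without distinguishing cases across the sphere.\<close>
  have Lip: "\<bar>H z - H w\<bar> \<le> L * norm (z - w)" for z w
  proof -
    have "closest_point (cball (0::'a) 1) z \<in> cball 0 1" for z
      by (rule closest_point_in_set) auto
    then have "\<bar>H z - H w\<bar> \<le> L * norm (closest_point (cball 0 1) z - closest_point (cball 0 1) w)"
      unfolding H_def by (intro Lip0) auto
    also have "\<dots> \<le> L * norm (z - w)"
      using closest_point_lipschitz[of "cball (0::'a) 1" z w] L0
      by (intro mult_left_mono) (auto simp: dist_norm)
    finally show ?thesis .
  qed
  have contH: "continuous_on UNIV H"
  proof -
    have "L-lipschitz_on UNIV H"
      using Lip L0 by (intro lipschitz_onI) (auto simp: dist_norm)
    then show ?thesis by (rule lipschitz_on_continuous_on)
  qed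
  have [measurable]: "H \<in> borel_measurable borel"
    using contH by (rule borel_measurable_continuous_onI)
  \<comment> \<open>Steps of length at most 1 keep the difference quotients supported in
    \<open>cball 0 2\<close>, where the constant \<open>L\<close> dominates them.\<close>
  define t where "t n = inverse (real (Suc n))" for n
  have t: "t n > 0" "t n \<le> 1" for n
    by (auto simp: t_def inverse_le_1_iff)
  define g where "g n z = (H (z + t n *\<^sub>R e) - H z) / t n" for n z
  have [measurable]: "g n \<in> borel_measurable borel" for n
    unfolding g_def by measurable
  have g_bound: "norm (g n z) \<le> L * indicator (cball 0 2) z" for n z
  proof (cases "z \<in> cball 0 2")
    case True
    have "\<bar>H (z + t n *\<^sub>R e) - H z\<bar> \<le> L * t n"
      using Lip[of "z + t n *\<^sub>R e" z] e t(1)[of n] by simp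
    then show ?thesis using True t(1)[of n] by (simp add: g_def field_simps)
  next
    case False
    then have "norm z > 2" by simp
    moreover have "norm (t n *\<^sub>R e) \<le> 1" using t[of n] e by simp
    moreover have "norm z \<le> norm (z + t n *\<^sub>R e) + norm (t n *\<^sub>R e)"
      using norm_triangle_ineq4[of "z + t n *\<^sub>R e" "t n *\<^sub>R e"] by simp
    ultimately have "H (z + t n *\<^sub>R e) = 0" "H z = 0"
      by (auto intro!: H_out)
    then show ?thesis using L0 by (simp add: g_def)
  qed
  have intH: "integrable lborel H"
  proof -
    have "integrable lborel (\<lambda>x. indicator (cball 0 1) x *\<^sub>R H x)"
      using contH by (intro borel_integrable_compact) (auto intro: continuous_on_subset)
    moreover have "(\<lambda>x. indicator (cball 0 1) x *\<^sub>R H x) = H"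
      using H_out by (auto simp: indicator_def fun_eq_iff)
    ultimately show ?thesis by (simp only:)
  qed
  have shift: "integrable lborel (\<lambda>z. H (z + t n *\<^sub>R e))"
    "(\<integral>z. H (z + t n *\<^sub>R e) \<partial>lborel) = (\<integral>z. H z \<partial>lborel)" for n
  proof -
    have eq: "lborel = distr lborel borel ((+) (t n *\<^sub>R e))"
      by (rule lborel_distr_plus[symmetric])
    show "integrable lborel (\<lambda>z. H (z + t n *\<^sub>R e))"
      using intH by (subst (asm) eq) (simp add: integrable_distr_eq add.commute)
    show "(\<integral>z. H (z + t n *\<^sub>R e) \<partial>lborel) = (\<integral>z. H z \<partial>lborel)"
      by (subst (2) eq) (simp add: integral_distr add.commute)
  qed
  have int_g: "(\<integral>z. g n z \<partial>lborel) = 0" for n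
    using intH shift[of n] by (simp add: g_def)
  define f where "f z = indicator (cball 0 1) z *\<^sub>R F' z e" for z
  have [measurable]: "f \<in> borel_measurable borel"
    using cont borel_measurable_continuous_on_indicator[of "cball 0 1" "\<lambda>z. F' z e"]
    unfolding f_def by simp
  have "(\<lambda>n. \<integral>z. g n z \<partial>lborel) \<longlonglongrightarrow> (\<integral>z. f z \<partial>lborel)"
  proof (rule integral_dominated_convergence[where w="\<lambda>z. L * indicator (cball 0 2) z"])
    \<comment> \<open>Across the unit sphere \<open>H\<close> may have a kink. The sphere is a null
      set, and off it \<open>H\<close> agrees locally with \<open>F\<close> or with 0.\<close>
    show "AE z in lborel. (\<lambda>n. g n z) \<longlonglongrightarrow> f z"
    proof (rule AE_I')
      show "sphere 0 1 \<in> null_sets (lborel :: 'a measure)"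
        using negligible_sphere[of "0::'a" 1]
        by (simp add: negligible_iff_null_sets null_sets_completion_iff)
      show "{z \<in> space lborel. \<not> (\<lambda>n. g n z) \<longlonglongrightarrow> f z} \<subseteq> sphere 0 (1::real)"
      proof
        fix z :: 'a
        assume "z \<in> {z \<in> space lborel. \<not> (\<lambda>n. g n z) \<longlonglongrightarrow> f z}"
        then have no: "\<not> (\<lambda>n. g n z) \<longlonglongrightarrow> f z" by simp
        have lim: "(\<lambda>n. z + t n *\<^sub>R e) \<longlonglongrightarrow> z + 0 *\<^sub>R e"
          unfolding t_def by (intro tendsto_intros LIMSEQ_inverse_real_of_nat)
        show "z \<in> sphere 0 1"
        proof (rule ccontr)
          assume "z \<notin> sphere 0 1"
          then consider "norm z < 1" | "norm z > 1" by fastforce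
          then show False
          proof cases
            case 1
            have "((\<lambda>s. F (z + s *\<^sub>R e)) has_derivative (\<lambda>s. F' z (s *\<^sub>R e))) (at 0)"
              by (rule has_derivative_compose[where g=F and f="\<lambda>s. z + s *\<^sub>R e" and x=0 and s=UNIV, simplified])
                (auto intro!: derivative_eq_intros deriv less_imp_le[OF 1])
            moreover have "F' z (s *\<^sub>R e) = s * F' z e" for s
              using deriv[of z] 1 linear_scale[of "F' z" s e]
              by (auto dest: has_derivative_linear)
            ultimately have "((\<lambda>s. F (z + s *\<^sub>R e)) has_real_derivative F' z e) (at 0)"
              by (simp add: has_field_derivative_def mult_commute_abs)
            then have "(\<lambda>s. (F (z + s *\<^sub>R e) - F z) / s) \<midarrow>0\<rightarrow> F' z e"
              by (simp add: DERIV_def)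
            moreover have "filterlim t (at 0) sequentially"
              unfolding t_def filterlim_at
              using LIMSEQ_inverse_real_of_nat by simp
            ultimately have "(\<lambda>n. (F (z + t n *\<^sub>R e) - F z) / t n) \<longlonglongrightarrow> F' z e"
              by (rule filterlim_compose)
            moreover have "eventually (\<lambda>n. norm (z + t n *\<^sub>R e) < 1) sequentially"
              using tendsto_norm[OF lim] 1 by (intro order_tendstoD(2)) auto
            then have "eventually (\<lambda>n. (F (z + t n *\<^sub>R e) - F z) / t n = g n z) sequentially"
              by eventually_elim (use 1 in \<open>simp add: g_def H_in\<close>)
            ultimately have "(\<lambda>n. g n z) \<longlonglongrightarrow> F' z e"
              by (rule Lim_transform_eventually)
            then show False using no 1 by (simp add: f_def)
          next
            case 2
            have "eventually (\<lambda>n. norm (z + t n *\<^sub>R e) > 1) sequentially"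
              using tendsto_norm[OF lim] 2 by (intro order_tendstoD(1)) auto
            then have "eventually (\<lambda>n. 0 = g n z) sequentially"
              by eventually_elim (use 2 in \<open>simp add: g_def H_out\<close>)
            then have "(\<lambda>n. g n z) \<longlonglongrightarrow> 0"
              by (rule Lim_transform_eventually[OF tendsto_const])
            then show False using no 2 by (simp add: f_def)
          qed
        qed
      qed
    qed
    show "integrable lborel (\<lambda>z. L * indicator (cball 0 2) z)"
      using borel_integrable_compact[of "cball 0 2" "\<lambda>_. L"] by (simp add: mult.commute)
  qed (use g_bound in auto)
  then have "(\<integral>z. f z \<partial>lborel) = 0"
    by (simp add: int_g LIMSEQ_const_iff)
  then show ?thesis by (simp add: f_def set_lebesgue_integral_def)
qed

text \<open>The divergence of \<open>(1 - norm z ^ 2) * gradient h\<close> is \<open>- 2 * D (x + t *\<^sub>R z) z\<close>, as \<open>h\<close> is harmonic.\<close>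

lemma integral_radial_derivative_ball:
  fixes h :: "'a::euclidean_space \<Rightarrow> real"
  assumes h1: "\<And>y. y \<in> cball x r \<Longrightarrow> (h has_derivative blinfun_apply (D y)) (at y)"
    and h2: "\<And>y. y \<in> cball x r \<Longrightarrow> (D has_derivative blinfun_apply (D2 y)) (at y)"
    and cont: "continuous_on (cball x r) D2"
    and trace: "\<And>y. y \<in> cball x r \<Longrightarrow> (\<Sum>b\<in>Basis. blinfun_apply (blinfun_apply (D2 y) b) b) = 0"
    and t: "0 \<le> t" "t \<le> r"
  shows "(LINT z:cball 0 1|lborel. D (x + t *\<^sub>R z) z) = 0"
proof -
  have inb: "x + t *\<^sub>R z \<in> cball x r" if "norm z \<le> 1" for z
  proof -
    have "t * norm z \<le> r * 1" using t that by (intro mult_mono) auto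
    then show ?thesis using t by (simp add: dist_norm)
  qed
  have contD: "continuous_on (cball x r) D"
    by (intro continuous_at_imp_continuous_on ballI has_derivative_continuous[OF h2])
  have c1: "continuous_on (cball 0 1) (\<lambda>z. D (x + t *\<^sub>R z))"
    by (rule continuous_on_compose2[OF contD]) (auto intro!: continuous_intros simp del: mem_cball simp: inb)
  have c2: "continuous_on (cball 0 1) (\<lambda>z. D2 (x + t *\<^sub>R z))"
    by (rule continuous_on_compose2[OF cont]) (auto intro!: continuous_intros simp del: mem_cball simp: inb)
  have "bounded ((\<lambda>z. D (x + t *\<^sub>R z)) ` cball 0 1)" "bounded ((\<lambda>z. D2 (x + t *\<^sub>R z)) ` cball 0 1)"
    by (intro compact_imp_bounded compact_continuous_image c1 c2 compact_cball)+
  then obtain B1 B2 where B1: "\<And>z. norm z \<le> 1 \<Longrightarrow> norm (D (x + t *\<^sub>R z)) \<le> B1"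
    and B2: "\<And>z. norm z \<le> 1 \<Longrightarrow> norm (D2 (x + t *\<^sub>R z)) \<le> B2"
    unfolding bounded_iff by fastforce
  \<comment> \<open>The product rule applied to
    \<open>(1 - z \<bullet> z) * D (x + t *\<^sub>R z) e\<close>. The first factor makes this
    component of the vector field vanish on the unit sphere, as the preceding lemma demands.\<close>
  define F' where "F' e z v = - (2 * (z \<bullet> v)) * D (x + t *\<^sub>R z) e
      + (1 - z \<bullet> z) * D2 (x + t *\<^sub>R z) (t *\<^sub>R v) e" for e z v
  have 1: "(LINT z:cball 0 1|lborel. F' e z e) = 0" if "e \<in> Basis" for e
  proof (rule integral_directional_derivative_ball[where F'="F' e" and e=e and L="2 * B1 + B2 * t"
        and F="\<lambda>z. (1 - z \<bullet> z) * D (x + t *\<^sub>R z) e"])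
    show "((\<lambda>z. (1 - z \<bullet> z) * D (x + t *\<^sub>R z) e) has_derivative F' e z) (at z)" if "norm z \<le> 1" for z
    proof -
      have "((\<lambda>z. D (x + t *\<^sub>R z)) has_derivative (\<lambda>v. D2 (x + t *\<^sub>R z) (t *\<^sub>R v))) (at z)"
        by (rule has_derivative_compose[where g=D and f="\<lambda>z. x + t *\<^sub>R z" and s=UNIV, simplified])
          (auto intro!: derivative_eq_intros h2 inb that)
      then have D: "((\<lambda>z. D (x + t *\<^sub>R z) e) has_derivative (\<lambda>v. D2 (x + t *\<^sub>R z) (t *\<^sub>R v) e)) (at z)"
        by (auto intro!: derivative_eq_intros)
      have N: "((\<lambda>z. 1 - z \<bullet> z) has_derivative (\<lambda>v. - (2 * (z \<bullet> v)))) (at z)"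
        by (auto intro!: derivative_eq_intros simp: inner_commute)
      have "((\<lambda>z. (1 - z \<bullet> z) * D (x + t *\<^sub>R z) e) has_derivative
        (\<lambda>v. (1 - z \<bullet> z) * D2 (x + t *\<^sub>R z) (t *\<^sub>R v) e + - (2 * (z \<bullet> v)) * D (x + t *\<^sub>R z) e)) (at z)"
        by (rule has_derivative_mult[OF N D])
      then show ?thesis
        by (rule has_derivative_eq_rhs) (simp add: F'_def fun_eq_iff)
    qed
    show "continuous_on (cball 0 1) (\<lambda>z. F' e z e)"
      unfolding F'_def by (intro continuous_intros c1 c2)
    show "\<bar>F' e z v\<bar> \<le> (2 * B1 + B2 * t) * norm v" if "norm z \<le> 1" for z v
    proof -
      have e: "norm e = 1" using \<open>e \<in> Basis\<close> by simp
      have "\<bar>z \<bullet> v\<bar> \<le> 1 * norm v"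
        using Cauchy_Schwarz_ineq2[of z v] mult_right_mono[OF that, of "norm v"] by simp
      moreover have "\<bar>D (x + t *\<^sub>R z) e\<bar> \<le> B1"
        using norm_blinfun[of "D (x + t *\<^sub>R z)" e] B1[OF that] e by simp
      ultimately have "\<bar>z \<bullet> v\<bar> * \<bar>D (x + t *\<^sub>R z) e\<bar> \<le> norm v * B1"
        by (intro mult_mono) auto
      moreover have "\<bar>D2 (x + t *\<^sub>R z) (t *\<^sub>R v) e\<bar> \<le> B2 * t * norm v"
      proof -
        have "\<bar>D2 (x + t *\<^sub>R z) (t *\<^sub>R v) e\<bar> \<le> norm (D2 (x + t *\<^sub>R z) (t *\<^sub>R v)) * 1"
          using norm_blinfun[of "D2 (x + t *\<^sub>R z) (t *\<^sub>R v)" e] e by simp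
        also have "\<dots> \<le> norm (D2 (x + t *\<^sub>R z)) * norm (t *\<^sub>R v)"
          by (simp only: mult_1_right) (rule norm_blinfun)
        also have "\<dots> \<le> B2 * norm (t *\<^sub>R v)"
          by (intro mult_right_mono B2 that) auto
        finally show ?thesis using t by (simp add: mult.assoc)
      qed
      moreover have "\<bar>1 - z \<bullet> z\<bar> \<le> 1"
        using that by (auto simp: dot_square_norm abs_le_iff power_le_one)
      ultimately have "\<bar>1 - z \<bullet> z\<bar> * \<bar>D2 (x + t *\<^sub>R z) (t *\<^sub>R v) e\<bar> \<le> 1 * (B2 * t * norm v)"
        by (intro mult_mono) auto
      moreover have "\<bar>F' e z v\<bar> \<le> 2 * (\<bar>z \<bullet> v\<bar> * \<bar>D (x + t *\<^sub>R z) e\<bar>) + \<bar>1 - z \<bullet> z\<bar> * \<bar>D2 (x + t *\<^sub>R z) (t *\<^sub>R v) e\<bar>"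
        unfolding F'_def by (rule order_trans[OF abs_triangle_ineq]) (simp add: abs_mult)
      ultimately show ?thesis
        using \<open>\<bar>z \<bullet> v\<bar> * \<bar>D (x + t *\<^sub>R z) e\<bar> \<le> norm v * B1\<close> by (simp add: algebra_simps)
    qed
    show "(1 - z \<bullet> z) * D (x + t *\<^sub>R z) e = 0" if "norm z = 1" for z
      using that by (simp add: dot_square_norm)
  qed (use that in simp)
  have "(\<Sum>e\<in>Basis. F' e z e) = -2 * D (x + t *\<^sub>R z) z" if "norm z \<le> 1" for z
  proof -
    have "(\<Sum>e\<in>Basis. D2 (x + t *\<^sub>R z) (t *\<^sub>R e) e) = t * (\<Sum>e\<in>Basis. D2 (x + t *\<^sub>R z) e e)"
      by (simp add: blinfun.scaleR_right blinfun.scaleR_left sum_distrib_left)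
    then have t0: "(\<Sum>e\<in>Basis. D2 (x + t *\<^sub>R z) (t *\<^sub>R e) e) = 0"
      using trace[OF inb[OF that]] by simp
    have "D (x + t *\<^sub>R z) z = D (x + t *\<^sub>R z) (\<Sum>e\<in>Basis. (z \<bullet> e) *\<^sub>R e)"
      by (simp add: euclidean_representation)
    also have "\<dots> = (\<Sum>e\<in>Basis. (z \<bullet> e) * D (x + t *\<^sub>R z) e)"
      by (simp add: blinfun.sum_right blinfun.scaleR_right)
    finally show ?thesis using t0
      by (simp add: F'_def sum_subtractf sum_distrib_left[symmetric] mult.assoc)
  qed
  then have "(LINT z:cball 0 1|lborel. -2 * D (x + t *\<^sub>R z) z) = (LINT z:cball 0 1|lborel. (\<Sum>e\<in>Basis. F' e z e))"
    by (intro set_lebesgue_integral_cong) auto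
  also have "\<dots> = (\<Sum>e\<in>Basis. LINT z:cball 0 1|lborel. F' e z e)"
    unfolding set_lebesgue_integral_def scaleR_sum_right
  proof (rule Bochner_Integration.integral_sum)
    show "integrable lborel (\<lambda>z. indicator (cball 0 1) z *\<^sub>R F' e z e)" for e
      unfolding F'_def by (intro borel_integrable_compact continuous_intros c1 c2 compact_cball)
  qed
  also have "\<dots> = 0" by (simp add: 1)
  finally show ?thesis by (simp only: set_integral_mult_right)
qed

section \<open>Rescaling of balls and the mean value equality\<close>

lemma set_integral_ball_cball:
  fixes f :: "'a::euclidean_space \<Rightarrow> real"
  assumes "continuous_on (cball x r) f"
  shows "(LINT y:ball x r|lborel. f y) = (LINT y:cball x r|lborel. f y)"
  unfolding set_lebesgue_integral_def
proof (rule integral_cong_AE)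
  show "(\<lambda>y. indicator (ball x r) y *\<^sub>R f y) \<in> borel_measurable lborel"
    using borel_measurable_continuous_on_indicator[of "ball x r" f] continuous_on_subset[OF assms ball_subset_cball]
    by simp
  show "(\<lambda>y. indicator (cball x r) y *\<^sub>R f y) \<in> borel_measurable lborel"
    using borel_measurable_continuous_on_indicator[of "cball x r" f] assms by simp
  have "sphere x r \<in> null_sets lborel"
    using negligible_sphere[of x r]
    by (simp add: negligible_iff_null_sets null_sets_completion_iff)
  then show "AE y in lborel. indicator (ball x r) y *\<^sub>R f y = indicator (cball x r) y *\<^sub>R f y"
    by (rule AE_I') (auto simp: indicator_def)
qed

lemma set_integral_cball_scale:
  fixes f :: "'a::euclidean_space \<Rightarrow> real"
  assumes "continuous_on (cball x r) f" "0 < r"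
  shows "(LINT y:cball x r|lborel. f y) = r ^ DIM('a) * (LINT z:cball 0 1|lborel. f (x + r *\<^sub>R z))"
proof -
  define g where "g y = indicator (cball x r) y *\<^sub>R f y" for y
  have [measurable]: "g \<in> borel_measurable borel"
    unfolding g_def using borel_measurable_continuous_on_indicator[of "cball x r" f] assms by simp
  have "(LINT y:cball x r|lborel. f y) = (\<integral>y. g y \<partial>lborel)"
    by (simp add: set_lebesgue_integral_def g_def)
  also have "\<dots> = (\<integral>y. g y \<partial>density (distr lborel borel (\<lambda>z. x + r *\<^sub>R z)) (\<lambda>_. \<bar>r\<bar>^DIM('a)))"
    using lborel_affine[of r x] assms by simp
  also have "\<dots> = r ^ DIM('a) * (\<integral>z. g (x + r *\<^sub>R z) \<partial>lborel)"
    using assms by (subst integral_density) (auto simp: integral_distr)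
  also have "(\<integral>z. g (x + r *\<^sub>R z) \<partial>lborel) =
      (\<integral>z. indicator (cball x r) (x + r *\<^sub>R z) *\<^sub>R f (x + r *\<^sub>R z) \<partial>lborel)"
    by (simp add: g_def)
  also have "(\<lambda>z. indicator (cball x r) (x + r *\<^sub>R z) *\<^sub>R f (x + r *\<^sub>R z))
      = (\<lambda>z. indicator (cball 0 1) z *\<^sub>R f (x + r *\<^sub>R z))"
    using assms(2) by (auto simp: indicator_def dist_norm mult_le_cancel_left1)
  finally show ?thesis by (simp add: set_lebesgue_integral_def)
qed

lemma harmonic_on_continuous_on: "harmonic_on \<Omega> h \<Longrightarrow> continuous_on \<Omega> h"
  unfolding harmonic_on_def
  by (meson has_derivative_continuous continuous_at_imp_continuous_on)

text \<open>On the unit ball, \<open>h (x + r *\<^sub>R z) - h x\<close> is the integral over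
  \<open>t\<close> in \<open>{0..r}\<close> of the radial derivative
  \<open>D (x + t *\<^sub>R z) z\<close>. Exchanging the integrals leaves, for each
  \<open>t\<close>, an integral over the ball that vanishes by
  \<open>integral_radial_derivative_ball\<close>.\<close>

lemma harmonic_on_mean_value:
  fixes h :: "'a::euclidean_space \<Rightarrow> real"
  assumes "harmonic_on \<Omega> h" "cball x r \<subseteq> \<Omega>" "0 < r"
  shows "(LINT y:ball x r|lborel. h y) = measure lborel (ball x r) * h x"
proof -
  obtain D D2 where H: "\<forall>x\<in>\<Omega>. (h has_derivative blinfun_apply (D x)) (at x)"
    "\<forall>x\<in>\<Omega>. (D has_derivative blinfun_apply (D2 x)) (at x)" "continuous_on \<Omega> D2"
    "\<forall>x\<in>\<Omega>. (\<Sum>b\<in>Basis. blinfun_apply (blinfun_apply (D2 x) b) b) = 0"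
    using assms(1) unfolding harmonic_on_def by blast
  have h1: "(h has_derivative blinfun_apply (D y)) (at y)"
    and h2: "(D has_derivative blinfun_apply (D2 y)) (at y)"
    and trace: "(\<Sum>b\<in>Basis. blinfun_apply (blinfun_apply (D2 y) b) b) = 0"
    if "y \<in> cball x r" for y
    using H assms(2) that by (auto simp del: mem_cball)
  have cont: "continuous_on (cball x r) D2"
    using H(3) assms(2) by (rule continuous_on_subset)
  have conth: "continuous_on (cball x r) h"
    using harmonic_on_continuous_on[OF assms(1)] assms(2) by (rule continuous_on_subset)
  have contD: "continuous_on (cball x r) D"
    by (intro continuous_at_imp_continuous_on ballI has_derivative_continuous[OF h2])
  have inb: "x + t *\<^sub>R z \<in> cball x r" if "norm z \<le> 1" "0 \<le> t" "t \<le> r" for z t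
  proof -
    have "t * norm z \<le> r * 1" using that by (intro mult_mono) auto
    then show ?thesis using that by (simp add: dist_norm)
  qed
  define g where "g z t = indicator (cball 0 1 \<times> {0..r}) (z, t) *\<^sub>R D (x + t *\<^sub>R z) z" for z t
  have "continuous_on (cball 0 1 \<times> {0..r}) (\<lambda>p. D (x + snd p *\<^sub>R fst p) (fst p))"
    by (intro continuous_intros continuous_on_compose2[OF contD]) (use inb in auto)
  then have "integrable lborel (\<lambda>p. indicator (cball 0 1 \<times> {0..r}) p *\<^sub>R D (x + snd p *\<^sub>R fst p) (fst p))"
    by (intro borel_integrable_compact compact_Times) auto
  moreover have "(\<lambda>(z, t). g z t) = (\<lambda>p. indicator (cball 0 1 \<times> {0..r}) p *\<^sub>R D (x + snd p *\<^sub>R fst p) (fst p))"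
    by (simp add: g_def fun_eq_iff)
  ultimately have int_g: "integrable (lborel \<Otimes>\<^sub>M lborel) (\<lambda>(z, t). g z t)"
    by (simp only: lborel_prod)
  have g1: "(\<integral>t. g z t \<partial>lborel) = indicator (cball 0 1) z *\<^sub>R (h (x + r *\<^sub>R z) - h x)" for z
  proof (cases "norm z \<le> 1")
    case True
    have "(\<integral>t. indicator {0..r} t *\<^sub>R D (x + t *\<^sub>R z) z \<partial>lborel) = h (x + r *\<^sub>R z) - h (x + 0 *\<^sub>R z)"
    proof (rule integral_FTC_atLeastAtMost)
      show "continuous_on {0..r} (\<lambda>t. D (x + t *\<^sub>R z) z)"
        by (intro continuous_intros continuous_on_compose2[OF contD]) (use inb[OF True] in auto)
      show "((\<lambda>t. h (x + t *\<^sub>R z)) has_vector_derivative D (x + t *\<^sub>R z) z) (at t within {0..r})"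
        if "0 \<le> t" "t \<le> r" for t
      proof -
        have "((\<lambda>t. h (x + t *\<^sub>R z)) has_derivative (\<lambda>s. D (x + t *\<^sub>R z) (s *\<^sub>R z))) (at t within {0..r})"
          by (rule has_derivative_compose[where g=h])
            (auto intro!: derivative_eq_intros h1 inb True that)
        then show ?thesis
          by (simp add: has_vector_derivative_def blinfun.scaleR_right)
      qed
    qed (use assms in simp)
    then show ?thesis using True by (simp add: g_def indicator_times)
  qed (simp add: g_def indicator_times)
  have g2: "(\<integral>z. g z t \<partial>lborel) = 0" for t
  proof (cases "t \<in> {0..r}")
    case True
    then show ?thesis
      using integral_radial_derivative_ball[OF h1 h2 cont trace, of t]
      by (simp add: g_def indicator_times set_lebesgue_integral_def)
  qed (simp add: g_def indicator_times)
  have c: "continuous_on (cball 0 1) (\<lambda>z. h (x + r *\<^sub>R z))"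
    by (rule continuous_on_compose2[OF conth]) (use inb assms in \<open>auto intro!: continuous_intros simp del: mem_cball\<close>)
  have i: "set_integrable lborel (cball 0 1) (\<lambda>z. h (x + r *\<^sub>R z))" "set_integrable lborel (cball (0::'a) 1) (\<lambda>z. h x)"
    unfolding set_integrable_def by (intro borel_integrable_compact compact_cball c continuous_on_const)+
  have "(LINT z:cball 0 1|lborel. h (x + r *\<^sub>R z) - h x) = (\<integral>z. (\<integral>t. g z t \<partial>lborel) \<partial>lborel)"
    by (simp add: g1 set_lebesgue_integral_def)
  also have "\<dots> = (\<integral>t. (\<integral>z. g z t \<partial>lborel) \<partial>lborel)"
    using lborel_pair.Fubini_integral[OF int_g] by simp
  also have "\<dots> = 0" by (simp add: g2)
  finally have "(LINT z:cball 0 1|lborel. h (x + r *\<^sub>R z)) = (LINT z:cball (0::'a) 1|lborel. h x)"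
    using set_integral_diff(2)[OF i] by simp
  then have "(LINT y:ball x r|lborel. h y) = (LINT y:ball x r|lborel. h x)"
    using assms(3) conth set_integral_cball_scale[of x r h] set_integral_cball_scale[of x r "\<lambda>_. h x"]
    by (simp add: set_integral_ball_cball)
  then show ?thesis by (simp add: set_lebesgue_integral_def measure_def)
qed

section \<open>The local super-mean-value property\<close>

text \<open>Integrability is part of the property because the integral of a non-integrable function
  is 0 by default. Asking only for all sufficiently small radii makes the property local and lets
  several such properties be combined without tracking radii.\<close>

definition supermean_at :: "('a::euclidean_space \<Rightarrow> real) \<Rightarrow> 'a \<Rightarrow> bool" where
  "supermean_at g x \<longleftrightarrow> eventually (\<lambda>r. set_integrable lborel (ball x r) g \<and>
      (LINT y:ball x r|lborel. g y) \<le> measure lborel (ball x r) * g x) (at_right 0)"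

lemma eventually_ball_subset:
  fixes x :: "'a::euclidean_space"
  assumes "eventually P (nhds x)"
  shows "eventually (\<lambda>r. \<forall>y\<in>ball x r. P y) (at_right 0)"
proof -
  obtain d where d: "d > 0" "\<And>y. dist y x < d \<Longrightarrow> P y"
    using assms by (auto simp: eventually_nhds_metric)
  then show ?thesis
    by (auto simp: eventually_at_right_field dist_commute intro!: exI[of _ d])
qed

lemma eventually_cball_subset:
  fixes x :: "'a::euclidean_space"
  assumes "open U" "x \<in> U"
  shows "eventually (\<lambda>r. 0 < r \<and> cball x r \<subseteq> U) (at_right 0)"
proof -
  obtain d where d: "d > 0" "cball x d \<subseteq> U"
    using assms open_contains_cball by blast
  then have "0 < r \<and> cball x r \<subseteq> U" if "0 < r" "r < d" for r
    using that by (auto simp: subset_iff)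
  then show ?thesis
    using d by (auto simp: eventually_at_right_field intro!: exI[of _ d])
qed

lemma set_integrable_ball_continuous:
  fixes g :: "'a::euclidean_space \<Rightarrow> real"
  assumes "continuous_on (cball x r) g"
  shows "set_integrable lborel (ball x r) g"
proof -
  have "set_integrable lborel (cball x r) g"
    unfolding set_integrable_def using assms by (intro borel_integrable_compact compact_cball)
  then show ?thesis by (rule set_integrable_subset) auto
qed

lemma eventually_set_integrable_ball:
  fixes g :: "'a::euclidean_space \<Rightarrow> real"
  assumes "open U" "x \<in> U" "continuous_on U g"
  shows "eventually (\<lambda>r. set_integrable lborel (ball x r) g) (at_right 0)"
  using eventually_cball_subset[OF assms(1,2)]
  by eventually_elim (meson assms(3) continuous_on_subset set_integrable_ball_continuous)

lemma set_integral_ball_const: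
  "(LINT y:ball x r|lborel. c) = measure lborel (ball x r) * (c::real)"
  for x :: "'a::euclidean_space"
  by (simp add: set_lebesgue_integral_def)

lemma supermean_at_harmonic:
  assumes "harmonic_on \<Omega> h" "open \<Omega>" "x \<in> \<Omega>"
  shows "supermean_at h x" "supermean_at (\<lambda>y. - h y) x"
proof -
  have "eventually (\<lambda>r. set_integrable lborel (ball x r) h \<and>
      (LINT y:ball x r|lborel. h y) = measure lborel (ball x r) * h x) (at_right 0)"
    using eventually_cball_subset[OF assms(2,3)]
      eventually_set_integrable_ball[OF assms(2,3) harmonic_on_continuous_on[OF assms(1)]]
    by eventually_elim (use harmonic_on_mean_value[OF assms(1)] in auto)
  then show "supermean_at h x" "supermean_at (\<lambda>y. - h y) x"
    unfolding supermean_at_def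
    by (auto elim!: eventually_mono simp: set_integral_uminus set_integrable_def set_lebesgue_integral_def)
qed

lemma supermean_at_add:
  assumes "supermean_at f x" "supermean_at g x"
  shows "supermean_at (\<lambda>y. f y + g y) x"
  using assms unfolding supermean_at_def
  by eventually_elim (auto simp: set_integral_add distrib_left)

lemma supermean_at_cmult:
  assumes "supermean_at f x" "0 \<le> c"
  shows "supermean_at (\<lambda>y. c * f y) x"
  using assms(1) unfolding supermean_at_def
proof eventually_elim
  case (elim r)
  then have "c * (LINT y:ball x r|lborel. f y) \<le> c * (measure lborel (ball x r) * f x)"
    using assms(2) by (intro mult_left_mono) auto
  with elim show ?case by (simp add: mult.left_commute)
qed

lemma supermean_at_min:
  assumes "supermean_at f x" "supermean_at g x"
  shows "supermean_at (\<lambda>y. min (f y) (g y)) x"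
  using assms unfolding supermean_at_def
proof eventually_elim
  case (elim r)
  then have "integrable lborel (\<lambda>y. min (indicator (ball x r) y *\<^sub>R f y) (indicator (ball x r) y *\<^sub>R g y))"
    unfolding set_integrable_def by (intro integrable_min) auto
  moreover have "(\<lambda>y. min (indicator (ball x r) y *\<^sub>R f y) (indicator (ball x r) y *\<^sub>R g y))
      = (\<lambda>y. indicator (ball x r) y *\<^sub>R min (f y) (g y))"
    by (auto simp: indicator_def fun_eq_iff)
  ultimately have i: "set_integrable lborel (ball x r) (\<lambda>y. min (f y) (g y))"
    unfolding set_integrable_def by (simp only:)
  have "(LINT y:ball x r|lborel. min (f y) (g y)) \<le> (LINT y:ball x r|lborel. f y)"
    "(LINT y:ball x r|lborel. min (f y) (g y)) \<le> (LINT y:ball x r|lborel. g y)"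
    using elim i by (auto intro!: set_integral_mono)
  then have "(LINT y:ball x r|lborel. min (f y) (g y)) \<le> measure lborel (ball x r) * min (f x) (g x)"
    using elim by (auto simp: min_def)
  with i show ?case by simp
qed

text \<open>Only small balls matter, so a function patched together from several pieces can be
  tested piece by piece.\<close>

lemma supermean_at_cong:
  assumes "supermean_at f x" "eventually (\<lambda>y. f y = g y) (nhds x)"
  shows "supermean_at g x"
proof -
  have *: "f x = g x" using assms(2) by (rule eventually_nhds_x_imp_x)
  show ?thesis
    using assms(1) eventually_ball_subset[OF assms(2)] unfolding supermean_at_def
  proof eventually_elim
    case (elim r)
    have "(LINT y:ball x r|lborel. f y) = (LINT y:ball x r|lborel. g y)"
      using elim by (intro set_lebesgue_integral_cong) auto
    moreover have "set_integrable lborel (ball x r) f \<longleftrightarrow> set_integrable lborel (ball x r) g"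
      using elim by (intro set_integrable_cong) auto
    ultimately show ?case using elim * by simp
  qed
qed

text \<open>A mean cannot exceed a maximum. This settles the points where a function cut off from
  above attains the cut-off value, without any knowledge of the uncut function nearby.\<close>

lemma supermean_at_local_max:
  assumes "open U" "x \<in> U" "continuous_on U g" "\<And>y. y \<in> U \<Longrightarrow> g y \<le> g x"
  shows "supermean_at g x"
  unfolding supermean_at_def
  using eventually_set_integrable_ball[OF assms(1-3)] eventually_cball_subset[OF assms(1,2)]
proof eventually_elim
  case (elim r)
  then have "ball x r \<subseteq> U" by auto
  have "(LINT y:ball x r|lborel. g y) \<le> (LINT y:ball x r|lborel. g x)"
    using elim \<open>ball x r \<subseteq> U\<close>
    by (intro set_integral_mono assms(4)) (auto intro: set_integrable_ball_continuous)
  then show ?case using elim by (simp add: set_integral_ball_const)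
qed

lemma supermean_at_const: "supermean_at (\<lambda>_. c) x"
  by (rule supermean_at_local_max[of UNIV]) auto

lemma ball_mean_real:
  assumes "set_integrable lborel (ball x r) g" "0 < r"
  shows "ball_mean (\<lambda>y. ereal (g y)) x r = ereal ((LINT y:ball x r|lborel. g y) / measure lborel (ball x r))"
proof -
  define f where "f y = indicator (ball x r) y *\<^sub>R g y" for y
  have f: "integrable lborel f" using assms by (simp add: f_def[abs_def] set_integrable_def)
  have 1: "(\<integral>\<^sup>+ y\<in>ball x r. e2ennreal (ereal (g y)) \<partial>lborel) = (\<integral>\<^sup>+ y. ennreal (f y) \<partial>lborel)"
    by (intro nn_integral_cong) (auto simp: f_def indicator_def e2ennreal_ereal)
  have 2: "(\<integral>\<^sup>+ y\<in>ball x r. e2ennreal (- ereal (g y)) \<partial>lborel) = (\<integral>\<^sup>+ y. ennreal (- f y) \<partial>lborel)"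
    by (intro nn_integral_cong) (auto simp: f_def indicator_def e2ennreal_ereal)
  have fin: "(\<integral>\<^sup>+ y. ennreal (f y) \<partial>lborel) < \<infinity>" "(\<integral>\<^sup>+ y. ennreal (- f y) \<partial>lborel) < \<infinity>"
    using f by (auto simp: real_integrable_def top.not_eq_extremum)
  have "(LINT y:ball x r|lborel. g y) = integral\<^sup>L lborel f"
    unfolding set_lebesgue_integral_def f_def[abs_def] ..
  also have "\<dots> = enn2real (\<integral>\<^sup>+ y. ennreal (f y) \<partial>lborel) - enn2real (\<integral>\<^sup>+ y. ennreal (- f y) \<partial>lborel)"
    by (rule real_lebesgue_integral_def[OF f])
  finally have "(LINT y:ball x r|lborel. g y) = enn2real (\<integral>\<^sup>+ y. ennreal (f y) \<partial>lborel) - enn2real (\<integral>\<^sup>+ y. ennreal (- f y) \<partial>lborel)" .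
  moreover have e: "enn2ereal a = ereal (enn2real a)" if "a < \<infinity>" for a
    using that by (cases a) auto
  ultimately show ?thesis
    unfolding ball_mean_def 1 2 e[OF fin(1)] e[OF fin(2)] using content_ball_pos[OF assms(2), of x]
    by (simp only: ereal_minus(1) ereal_divide) simp
qed

lemma superharmonic_on_real:
  fixes g :: "'a::euclidean_space \<Rightarrow> real"
  assumes "open \<Omega>" "continuous_on \<Omega> g" "\<And>x. x \<in> \<Omega> \<Longrightarrow> supermean_at g x"
  shows "superharmonic_on \<Omega> (\<lambda>x. ereal (g x))"
  unfolding superharmonic_on_def
proof (intro conjI allI ballI)
  fix a
  show "open {x \<in> \<Omega>. a < ereal (g x)}"
  proof (cases a)
    case (real b)
    have "open (\<Omega> \<inter> g -` {b<..})"
      using assms by (intro continuous_open_preimage) auto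
    then show ?thesis by (simp add: real vimage_def Int_def)
  qed (use assms in auto)
  fix x assume "x \<in> \<Omega>"
  show "\<exists>R>0. cball x R \<subseteq> \<Omega> \<and> (\<forall>r. 0 < r \<and> r \<le> R \<longrightarrow> ball_mean (\<lambda>x. ereal (g x)) x r \<le> ereal (g x))"
  proof -
    have "eventually (\<lambda>r. cball x r \<subseteq> \<Omega> \<and> ball_mean (\<lambda>x. ereal (g x)) x r \<le> ereal (g x)) (at_right 0)"
      using eventually_cball_subset[OF assms(1) \<open>x \<in> \<Omega>\<close>] assms(3)[OF \<open>x \<in> \<Omega>\<close>]
      unfolding supermean_at_def
    proof eventually_elim
      case (elim r)
      then have "measure lborel (ball x r) > 0" by (simp add: content_ball_pos)
      then show ?case using elim by (simp add: ball_mean_real field_simps)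
    qed
    then obtain b where "b > 0" "\<And>r. 0 < r \<Longrightarrow> r < b \<Longrightarrow> cball x r \<subseteq> \<Omega> \<and> ball_mean (\<lambda>x. ereal (g x)) x r \<le> ereal (g x)"
      unfolding eventually_at_right_field by auto
    \<comment> \<open>Halving turns the strict bound \<open>r < b\<close> into the bound
      \<open>r \<le> R\<close> that superharmonicity asks for.\<close>
    then show ?thesis by (intro exI[of _ "b/2"]) auto
  qed
next
  fix C assume "C \<in> components \<Omega>"
  then show "\<exists>x\<in>C. ereal (g x) \<noteq> \<infinity>"
    using in_components_nonempty by fastforce
qed auto

text \<open>The set \<open>S\<close> where the minimum is attained is closed by continuity. It is
  open because the nonnegative function \<open>g - g x0\<close> has mean at most 0 over small balls
  about a point of \<open>S\<close> and so vanishes on them.\<close>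

lemma supermean_min_principle:
  fixes g :: "'a::euclidean_space \<Rightarrow> real"
  assumes "open U" "connected U" "continuous_on U g" "\<And>x. x \<in> U \<Longrightarrow> supermean_at g x"
    and x0: "x0 \<in> U" "\<And>x. x \<in> U \<Longrightarrow> g x0 \<le> g x"
    and x: "x \<in> U"
  shows "g x = g x0"
proof -
  define S where "S = {x \<in> U. g x = g x0}"
  have "closedin (top_of_set U) S"
    unfolding S_def using assms(3) by (intro continuous_closedin_preimage_constant)
  moreover have "open S"
    unfolding open_contains_ball
  proof
    fix z assume "z \<in> S"
    then have z: "z \<in> U" "g z = g x0" by (auto simp: S_def)
    have "eventually (\<lambda>r. 0 < r \<and> ball z r \<subseteq> S) (at_right 0)"
      using assms(4)[OF z(1)] eventually_cball_subset[OF assms(1) z(1)] unfolding supermean_at_def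
    proof eventually_elim
      case (elim r)
      have "ball z r \<subseteq> U" using elim by (auto simp: subset_iff)
      \<comment> \<open>The part of the ball where \<open>g\<close> exceeds its minimum: it is open
        and turns out to be a null set, hence empty.\<close>
      define V where "V = ball z r \<inter> (ball z r \<inter> g -` {g x0<..})"
      have "open V"
        unfolding V_def using continuous_on_subset[OF assms(3) \<open>ball z r \<subseteq> U\<close>]
        by (intro open_Int continuous_open_preimage) auto
      define f where "f y = indicator (ball z r) y *\<^sub>R (g y - g x0)" for y
      have c: "set_integrable lborel (ball z r) (\<lambda>_. g x0)"
        by (intro set_integrable_ball_continuous) auto
      have "integrable lborel f"
        using set_integral_diff(1)[OF _ c] elim by (simp add: f_def[abs_def] set_integrable_def)
      have fpos: "f y \<ge> 0" for y
        using x0(2) \<open>ball z r \<subseteq> U\<close> by (auto simp: f_def indicator_def)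
      have le: "(\<integral>y. f y \<partial>lborel) \<le> 0"
        using set_integral_diff(2)[OF _ c] elim z(2)
        by (simp add: f_def set_lebesgue_integral_def)
      have "0 \<le> (\<integral>y. f y \<partial>lborel)"
        by (rule Bochner_Integration.integral_nonneg) (rule fpos)
      with le have "(\<integral>y. f y \<partial>lborel) = 0" by (rule order_antisym)
      then have "AE y in lborel. f y = 0"
        using integral_nonneg_eq_0_iff_AE[OF \<open>integrable lborel f\<close>] fpos by simp
      moreover have "f y \<noteq> 0" if "y \<in> V" for y
        using that by (auto simp: V_def f_def)
      ultimately have "AE y in lborel. y \<notin> V" by (auto elim!: eventually_mono)
      then have "V \<in> null_sets lborel"
        using \<open>open V\<close> by (subst (asm) AE_iff_null_sets[symmetric]) auto
      then have "V = {}"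
        using open_not_negligible[OF \<open>open V\<close>]
        by (auto simp: negligible_iff_null_sets intro: null_sets_completionI)
      have "ball z r \<subseteq> S"
      proof
        fix y assume "y \<in> ball z r"
        then have "y \<in> U" "\<not> g y > g x0"
          using \<open>ball z r \<subseteq> U\<close> \<open>V = {}\<close> by (auto simp: V_def)
        then show "y \<in> S" using x0(2)[of y] by (auto simp: S_def)
      qed
      with elim show ?case by simp
    qed
    then show "\<exists>e>0. ball z e \<subseteq> S"
      using eventually_happens[of _ "at_right (0::real)"] by auto
  qed
  then have "openin (top_of_set U) S"
    by (rule open_subset[rotated]) (auto simp: S_def)
  ultimately have "S = {} \<or> S = U"
    using assms(2) unfolding connected_clopen by blast
  then show ?thesis using x x0(1) by (auto simp: S_def)
qed

text \<open>If the minimum over the closed ball is attained inside, then \<open>g\<close> is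
  constant on the open ball and, by continuity, takes the same value on the sphere. Either way the
  minimum is a value on the sphere.\<close>

lemma supermean_cball_min:
  fixes g :: "'a::euclidean_space \<Rightarrow> real"
  assumes "0 < r" "continuous_on (cball a r) g" "\<And>x. x \<in> ball a r \<Longrightarrow> supermean_at g x"
    and sph: "\<And>x. dist a x = r \<Longrightarrow> m \<le> g x"
    and x: "x \<in> cball a r"
  shows "m \<le> g x"
proof -
  obtain z where z: "z \<in> cball a r" "\<And>y. y \<in> cball a r \<Longrightarrow> g z \<le> g y"
    using continuous_attains_inf[OF compact_cball _ assms(2)] assms(1) by (auto simp del: mem_cball)
  obtain b where b: "b \<in> sphere a r" using assms(1) vector_choose_dist[of r a] by auto
  have "m \<le> g z"
  proof (cases "dist a z = r")
    case False
    then have "z \<in> ball a r" using z(1) by simp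
    have const: "g y = g z" if "y \<in> ball a r" for y
      using assms z \<open>z \<in> ball a r\<close> that
      by (intro supermean_min_principle[of "ball a r"]) (auto intro: continuous_on_subset)
    have "g y = g z" if "y \<in> cball a r" for y
    proof (rule continuous_constant_on_closure[of "ball a r" g "g z"])
      show "continuous_on (closure (ball a r)) g" using assms by simp
    qed (use that const assms(1) in auto)
    then show ?thesis using sph[of b] b by (metis mem_sphere order_refl mem_cball)
  qed (use sph in auto)
  then show ?thesis using z(2)[OF x] by simp
qed

section \<open>The fundamental solution\<close>

text \<open>The fundamental solution as a real function of the distance to the pole. Its value at
  distance 0 is a meaningless default, so the pole is always treated separately.\<close>

definition radial_profile :: "nat \<Rightarrow> real \<Rightarrow> real" where
  "radial_profile n \<rho> = (if n = 2 then - ln \<rho> / (2 * pi)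
     else 1 / ((real n - 2) * (real n * unit_ball_vol (real n)) * \<rho> ^ (n - 2)))"

lemma fundamental_solution_eq:
  fixes x :: "'a::euclidean_space"
  assumes "x \<noteq> 0"
  shows "fundamental_solution x = ereal (radial_profile DIM('a) (norm x))"
  using assms by (simp add: fundamental_solution_def radial_profile_def)

lemma DERIV_inverse_power:
  assumes "(r::real) \<noteq> 0"
  shows "((\<lambda>r. inverse (r ^ m)) has_real_derivative - (real m * inverse (r ^ (m + 1)))) (at r)"
proof (cases m)
  case (Suc k)
  have "((\<lambda>r. inverse r ^ Suc k) has_real_derivative - (real (Suc k) * inverse (r ^ (Suc k + 1)))) (at r)"
    by (rule DERIV_cong[OF DERIV_power[OF DERIV_inverse[OF assms]]]) (simp add: power_inverse)
  then show ?thesis using Suc by (simp add: power_inverse)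
qed simp

text \<open>The derivative is minus the reciprocal area of the sphere of radius \<rho>, in the plane
  as in higher dimensions. Monotonicity, the Lipschitz bound and harmonicity follow from this one
  formula, without distinguishing dimensions.\<close>

lemma radial_profile_deriv:
  assumes "2 \<le> n" "0 < \<rho>"
  shows "(radial_profile n has_real_derivative - (1 / (real n * unit_ball_vol (real n) * \<rho> ^ (n - 1)))) (at \<rho>)"
proof (cases "n = 2")
  case True
  then have "radial_profile n = (\<lambda>\<rho>. - ln \<rho> / (2 * pi))"
    by (simp add: radial_profile_def fun_eq_iff)
  moreover have "((\<lambda>\<rho>. - ln \<rho> / (2 * pi)) has_real_derivative - (1 / (2 * pi * \<rho>))) (at \<rho>)"
    using assms by (auto intro!: derivative_eq_intros simp: field_simps)
  ultimately show ?thesis using True by (simp add: unit_ball_vol_2)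
next
  case False
  define k where "k = n - 3"
  have n: "n = k + 3" using False assms by (simp add: k_def)
  define c where "c = real n * unit_ball_vol (real n)"
  have c: "c > 0" using n by (auto simp: c_def)
  have "radial_profile n = (\<lambda>\<rho>. 1 / ((real k + 1) * c * \<rho> ^ (k + 1)))"
    using False by (auto simp: radial_profile_def fun_eq_iff n c_def)
  moreover have "((\<lambda>\<rho>. 1 / ((real k + 1) * c * \<rho> ^ (k + 1))) has_real_derivative - (1 / (c * \<rho> ^ (k + 2)))) (at \<rho>)"
  proof (rule DERIV_cong)
    have "(\<lambda>\<rho>. 1 / ((real k + 1) * c * \<rho> ^ (k + 1))) = (\<lambda>\<rho>. 1 / ((real k + 1) * c) * inverse (\<rho> ^ (k + 1)))"
      by (simp add: fun_eq_iff divide_inverse)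
    then show "((\<lambda>\<rho>. 1 / ((real k + 1) * c * \<rho> ^ (k + 1))) has_real_derivative
        1 / ((real k + 1) * c) * - (real (k + 1) * inverse (\<rho> ^ (k + 1 + 1)))) (at \<rho>)"
      using assms by (simp only:) (intro DERIV_cmult DERIV_inverse_power, simp)
    have "1 / (a * c) * - (a * inverse R) = - (1 / (c * R))" if "a \<noteq> 0" for a R :: real
      using that by (simp add: divide_inverse)
    from this[of "real (k + 1)" "\<rho> ^ (k + 2)"]
    show "1 / ((real k + 1) * c) * - (real (k + 1) * inverse (\<rho> ^ (k + 1 + 1))) = - (1 / (c * \<rho> ^ (k + 2)))"
      by (simp add: add.commute)
  qed
  ultimately show ?thesis by (simp add: c_def n)
qed

lemma radial_profile_antimono:
  assumes "2 \<le> n" "0 < a" "a \<le> b"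
  shows "radial_profile n b \<le> radial_profile n a"
proof (rule DERIV_nonpos_imp_nonincreasing[OF assms(3)])
  fix x assume "a \<le> x"
  then show "\<exists>y. DERIV (radial_profile n) x :> y \<and> y \<le> 0"
    using radial_profile_deriv[OF assms(1), of x] assms(2) by (intro exI conjI) auto
qed

lemma radial_profile_lipschitz:
  assumes "2 \<le> n" "0 < d" "d \<le> a" "d \<le> b"
  shows "\<bar>radial_profile n a - radial_profile n b\<bar> \<le> 1 / (real n * unit_ball_vol (real n) * d ^ (n - 1)) * \<bar>a - b\<bar>"
proof -
  have "norm (radial_profile n a - radial_profile n b) \<le> 1 / (real n * unit_ball_vol (real n) * d ^ (n - 1)) * norm (a - b)"
  proof (rule field_differentiable_bound[where S="{d..}"])
    fix z assume z: "z \<in> {d..}"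
    show "(radial_profile n has_field_derivative - (1 / (real n * unit_ball_vol (real n) * z ^ (n - 1)))) (at z within {d..})"
      by (rule has_field_derivative_at_within[OF radial_profile_deriv]) (use z assms in auto)
    have "d ^ (n - 1) \<le> z ^ (n - 1)" using z assms by (intro power_mono) auto
    moreover have C: "0 < real n * unit_ball_vol (real n)" using assms by simp
    ultimately have "1 / (real n * unit_ball_vol (real n) * z ^ (n - 1)) \<le> 1 / (real n * unit_ball_vol (real n) * d ^ (n - 1))"
      using z assms by (intro divide_left_mono mult_left_mono) (auto simp del: of_nat_mult)
    moreover have "0 \<le> 1 / (real n * unit_ball_vol (real n) * z ^ (n - 1))"
      using z assms C by (intro divide_nonneg_nonneg mult_nonneg_nonneg) auto
    ultimately show "norm (- (1 / (real n * unit_ball_vol (real n) * z ^ (n - 1)))) \<le> 1 / (real n * unit_ball_vol (real n) * d ^ (n - 1))"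
      unfolding real_norm_def abs_minus_cancel by (simp only: abs_of_nonneg)
  qed (use assms in auto)
  then show ?thesis by simp
qed

lemma radial_profile_at_top:
  assumes "2 \<le> n"
  shows "filterlim (radial_profile n) at_top (at_right 0)"
proof (cases "n = 2")
  case True
  then have "radial_profile n = (\<lambda>\<rho>. (1 / (2 * pi)) * (- ln \<rho>))"
    by (simp add: radial_profile_def fun_eq_iff)
  moreover have "filterlim (\<lambda>\<rho>. (1 / (2 * pi)) * (- ln \<rho>)) at_top (at_right (0::real))"
    by (intro filterlim_tendsto_pos_mult_at_top[OF tendsto_const])
      (auto simp: filterlim_uminus_at_top[symmetric] filterlim_uminus_at_top ln_at_0)
  ultimately show ?thesis by simp
next
  case False
  define k where "k = n - 3"
  have n: "n = k + 3" using False assms by (simp add: k_def)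
  define c where "c = (real k + 1) * (real n * unit_ball_vol (real n))"
  have c: "c > 0" using n by (auto simp: c_def)
  have eq: "radial_profile n = (\<lambda>\<rho>. inverse (c * \<rho> ^ (k + 1)))"
    using False by (auto simp: radial_profile_def fun_eq_iff n c_def field_simps)
  have "((\<lambda>\<rho>. c * \<rho> ^ (k + 1)) \<longlongrightarrow> c * 0 ^ (k + 1)) (at_right 0)"
    by (intro tendsto_intros)
  then have "((\<lambda>\<rho>. c * \<rho> ^ (k + 1)) \<longlongrightarrow> 0) (at_right 0)" by simp
  moreover have "eventually (\<lambda>\<rho>. 0 < c * \<rho> ^ (k + 1)) (at_right 0)"
    unfolding eventually_at_right_field using c by (auto intro!: exI[of _ 1] mult_pos_pos)
  ultimately have "filterlim (\<lambda>\<rho>. inverse (c * \<rho> ^ (k + 1))) at_top (at_right 0)"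
    by (rule filterlim_inverse_at_top)
  then show ?thesis by (simp only: eq)
qed

text \<open>Made for comparing the kernel at \<open>x\<close> with the kernel at a nearest point of
  a closed set, where distances at most double. The logarithm pays with an additive constant, the
  power with a factor.\<close>

lemma radial_profile_doubling:
  assumes "2 \<le> n"
  obtains A B where "1 \<le> A" "0 \<le> B" "\<And>\<rho>. 0 < \<rho> \<Longrightarrow> radial_profile n \<rho> \<le> A * radial_profile n (2 * \<rho>) + B"
proof (cases "n = 2")
  case True
  show ?thesis
  proof (rule that[of 1 "ln 2 / (2 * pi)"])
    fix \<rho> :: real assume "0 < \<rho>"
    then show "radial_profile n \<rho> \<le> 1 * radial_profile n (2 * \<rho>) + ln 2 / (2 * pi)"
      using True by (simp add: radial_profile_def ln_mult field_simps)
  qed auto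
next
  case False
  show ?thesis
  proof (rule that[of "2 ^ (n - 2)" 0])
    fix \<rho> :: real assume "0 < \<rho>"
    then show "radial_profile n \<rho> \<le> 2 ^ (n - 2) * radial_profile n (2 * \<rho>) + 0"
      using False assms by (simp add: radial_profile_def power_mult_distrib)
  qed auto
qed

text \<open>The gradient is \<open>a x *\<^sub>R (x - p)\<close>, and \<open>a\<close> itself has
  gradient \<open>b x *\<^sub>R (x - p)\<close>. So the Hessian is a multiple of the identity plus a
  rank one term, with trace \<open>real n * a x + b x * (norm (x - p))\<^sup>2 = 0\<close>.\<close>

lemma harmonic_on_radial_profile:
  fixes p :: "'a::euclidean_space"
  assumes "2 \<le> DIM('a)"
  shows "harmonic_on (- {p}) (\<lambda>x. radial_profile DIM('a) (norm (x - p)))"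
proof -
  define n where "n = DIM('a)"
  define c where "c = real n * unit_ball_vol (real n)"
  have n: "2 \<le> n" and c: "c > 0" using assms by (auto simp: c_def n_def)
  define a where "a x = - (1 / (c * norm (x - p) ^ n))" for x :: 'a
  define b where "b x = real n / (c * norm (x - p) ^ (n + 2))" for x :: 'a
  define L :: "'a \<Rightarrow>\<^sub>L ('a \<Rightarrow>\<^sub>L real)" where "L = Blinfun blinfun_inner_left"
  have L: "blinfun_apply L v = blinfun_inner_left v" for v
    unfolding L_def by (simp add: bounded_linear_Blinfun_apply bounded_linear_blinfun_inner_left)
  define D where "D x = a x *\<^sub>R blinfun_inner_left (x - p)" for x
  define D2 where "D2 x = a x *\<^sub>R L + b x *\<^sub>R (blinfun_scaleR_left (blinfun_inner_left (x - p)) o\<^sub>L blinfun_inner_left (x - p))" for x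
  have norm_deriv: "((\<lambda>x. norm (x - p)) has_derivative (\<lambda>v. (x - p) \<bullet> v / norm (x - p))) (at x)" if "x \<noteq> p" for x
  proof -
    have "(norm has_derivative (\<lambda>v. v \<bullet> sgn (x - p))) (at (x - p))"
      using that by (intro has_derivative_norm) auto
    moreover have "((\<lambda>x. x - p) has_derivative (\<lambda>v. v)) (at x)"
      by (auto intro!: derivative_eq_intros)
    ultimately have "((\<lambda>x. norm (x - p)) has_derivative (\<lambda>v. v \<bullet> sgn (x - p))) (at x)"
      by (rule has_derivative_compose[rotated])
    then show ?thesis
      by (simp add: sgn_div_norm inner_commute divide_inverse mult.commute)
  qed
  show ?thesis
    unfolding harmonic_on_def
  proof (intro exI[of _ D] exI[of _ D2] conjI ballI)
    fix x assume "x \<in> - {p}"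
    then have x: "x \<noteq> p" by simp
    then have N: "norm (x - p) > 0" by simp
    have npow: "norm (x - p) ^ n = norm (x - p) ^ (n - 1) * norm (x - p)"
      using n by (simp flip: power_Suc2)
    have "((\<lambda>x. radial_profile n (norm (x - p))) has_derivative
        (\<lambda>v. - (1 / (c * norm (x - p) ^ (n - 1))) * ((x - p) \<bullet> v / norm (x - p)))) (at x)"
      using has_derivative_compose[OF norm_deriv[OF x] radial_profile_deriv[OF n N, THEN has_field_derivative_imp_has_derivative]]
      by (simp add: c_def)
    then show "((\<lambda>x. radial_profile DIM('a) (norm (x - p))) has_derivative blinfun_apply (D x)) (at x)"
      unfolding n_def[symmetric]
      by (rule has_derivative_eq_rhs)
        (simp add: D_def a_def fun_eq_iff blinfun.minus_left blinfun.scaleR_left npow inner_commute)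
    have "((\<lambda>r. - (1 / (c * r ^ n))) has_real_derivative (real n / (c * norm (x - p) ^ (n + 1)))) (at (norm (x - p)))"
    proof (rule DERIV_cong)
      have "(\<lambda>r. - (1 / (c * r ^ n))) = (\<lambda>r. - (1 / c) * inverse (r ^ n))"
        by (simp add: fun_eq_iff divide_inverse)
      then show "((\<lambda>r. - (1 / (c * r ^ n))) has_real_derivative
          - (1 / c) * - (real n * inverse (norm (x - p) ^ (n + 1)))) (at (norm (x - p)))"
        using N by (simp only:) (intro DERIV_cmult DERIV_inverse_power, simp)
    qed (use N c in \<open>simp add: field_simps\<close>)
    from has_derivative_compose[OF norm_deriv[OF x] this[THEN has_field_derivative_imp_has_derivative]]
    have "(a has_derivative (\<lambda>v. real n / (c * norm (x - p) ^ (n + 1)) * ((x - p) \<bullet> v / norm (x - p)))) (at x)"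
      by (simp add: a_def[abs_def])
    then have da: "(a has_derivative (\<lambda>v. b x * ((x - p) \<bullet> v))) (at x)"
      by (rule has_derivative_eq_rhs) (simp add: b_def fun_eq_iff)
    have "((\<lambda>x. blinfun_inner_left (x - p)) has_derivative blinfun_inner_left) (at x)"
      by (rule bounded_linear.has_derivative[OF bounded_linear_blinfun_inner_left, THEN has_derivative_eq_rhs])
        (auto intro!: derivative_eq_intros)
    from has_derivative_scaleR[OF da this]
    show "(D has_derivative blinfun_apply (D2 x)) (at x)"
      unfolding D_def[abs_def]
      by (rule has_derivative_eq_rhs)
        (auto simp: D2_def fun_eq_iff blinfun.add_left blinfun.scaleR_left L inner_commute scaleR_scaleR)
    have "(\<Sum>e\<in>Basis. D2 x e e) = (\<Sum>e\<in>Basis. a x + b x * ((x - p) \<bullet> e)\<^sup>2)"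
      by (intro sum.cong refl)
        (simp add: D2_def blinfun.add_left blinfun.scaleR_left L inner_Basis inner_commute power2_eq_square)
    also have "\<dots> = real n * a x + b x * (norm (x - p))\<^sup>2"
    proof -
      have "(\<Sum>e\<in>Basis. ((x - p) \<bullet> e)\<^sup>2) = (norm (x - p))\<^sup>2"
        unfolding power2_norm_eq_inner euclidean_inner[of "x - p" "x - p"] by (simp add: power2_eq_square)
      then show ?thesis by (simp add: sum.distrib n_def sum_distrib_left[symmetric])
    qed
    also have "\<dots> = 0"
      using N c by (simp add: a_def b_def field_simps power_add power2_eq_square)
    finally show "(\<Sum>e\<in>Basis. D2 x e e) = 0" .
  next
    have "c * norm (x - p) ^ n \<noteq> 0" "c * norm (x - p) ^ (n + 2) \<noteq> 0" if "x \<in> - {p}" for x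
      using that c by auto
    then show "continuous_on (- {p}) D2"
      unfolding D2_def a_def b_def
      by (intro continuous_intros bounded_bilinear.continuous_on[OF bounded_bilinear_blinfun_compose]
          bounded_linear.continuous_on[OF bounded_linear_blinfun_scaleR_left]
          bounded_linear.continuous_on[OF bounded_linear_blinfun_inner_left]) auto
  qed
qed

section \<open>The Green function\<close>

lemma isCont_eventually_pos:
  fixes f :: "'a::t2_space \<Rightarrow> real"
  assumes "isCont f x" "0 < f x"
  shows "eventually (\<lambda>z. 0 < f z) (nhds x)"
proof -
  have "(f \<longlongrightarrow> f x) (nhds x)"
    using assms(1) by (simp only: isCont_def tendsto_at_iff_tendsto_nhds)
  then show ?thesis using assms(2) by (rule order_tendstoD(1))
qed

locale green_function =
  fixes \<Omega> :: "'a::euclidean_space set" and G :: "'a \<Rightarrow> 'a \<Rightarrow> ereal"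
  assumes dim: "2 \<le> DIM('a)" and open_dom: "open \<Omega>" and connected_dom: "connected \<Omega>"
    and green: "is_green_function \<Omega> G"
begin

text \<open>\<open>h y\<close> is the harmonic part of the Green function with pole \<open>y\<close>, and \<open>g\<close> is the Green function off the
  diagonal, where it is finite.\<close>

definition h :: "'a \<Rightarrow> 'a \<Rightarrow> real" where
  "h y = (SOME h. harmonic_on \<Omega> h \<and> (\<forall>x\<in>\<Omega>. G x y = fundamental_solution (x - y) + ereal (h x)))"

definition g :: "'a \<Rightarrow> 'a \<Rightarrow> real" where
  "g x y = radial_profile DIM('a) (norm (x - y)) + h y x"

lemma h_spec:
  assumes "y \<in> \<Omega>"
  shows "harmonic_on \<Omega> (h y)" "x \<in> \<Omega> \<Longrightarrow> G x y = fundamental_solution (x - y) + ereal (h y x)"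
proof -
  have "\<exists>h. harmonic_on \<Omega> h \<and> (\<forall>x\<in>\<Omega>. G x y = fundamental_solution (x - y) + ereal (h x))"
    using green assms by (auto simp: is_green_function_def)
  then have "harmonic_on \<Omega> (h y) \<and> (\<forall>x\<in>\<Omega>. G x y = fundamental_solution (x - y) + ereal (h y x))"
    unfolding h_def by (rule someI_ex)
  then show "harmonic_on \<Omega> (h y)" "x \<in> \<Omega> \<Longrightarrow> G x y = fundamental_solution (x - y) + ereal (h y x)"
    by blast+
qed

lemma G_eq: "x \<in> \<Omega> \<Longrightarrow> y \<in> \<Omega> \<Longrightarrow> x \<noteq> y \<Longrightarrow> G x y = ereal (g x y)"
  by (simp add: h_spec(2) fundamental_solution_eq g_def)

lemma G_diag: "y \<in> \<Omega> \<Longrightarrow> G y y = \<infinity>"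
  by (simp add: h_spec(2) fundamental_solution_def)

lemma g_nonneg: "x \<in> \<Omega> \<Longrightarrow> y \<in> \<Omega> \<Longrightarrow> x \<noteq> y \<Longrightarrow> 0 \<le> g x y"
proof -
  assume *: "x \<in> \<Omega>" "y \<in> \<Omega>" "x \<noteq> y"
  then have "0 \<le> G x y" using green unfolding is_green_function_def by blast
  then show "0 \<le> g x y" using G_eq[OF *] by simp
qed

lemma continuous_on_h: "y \<in> \<Omega> \<Longrightarrow> continuous_on \<Omega> (h y)"
  by (rule harmonic_on_continuous_on[OF h_spec(1)])

lemma isCont_h: "y \<in> \<Omega> \<Longrightarrow> x \<in> \<Omega> \<Longrightarrow> isCont (h y) x"
  using continuous_on_h open_dom continuous_on_eq_continuous_at by blast

lemma isCont_profile: "x \<noteq> y \<Longrightarrow> isCont (\<lambda>x. radial_profile DIM('a) (norm (x - y))) x" for x y :: 'a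
  by (rule continuous_on_eq_continuous_at[THEN iffD1, rule_format, OF open_Compl[OF closed_singleton[of y]]
        harmonic_on_continuous_on[OF harmonic_on_radial_profile[OF dim]]]) simp

lemma isCont_g: "x \<in> \<Omega> \<Longrightarrow> y \<in> \<Omega> \<Longrightarrow> x \<noteq> y \<Longrightarrow> isCont (\<lambda>x. g x y) x"
  unfolding g_def by (intro continuous_intros isCont_profile isCont_h)

lemma supermean_at_h:
  "y \<in> \<Omega> \<Longrightarrow> x \<in> \<Omega> \<Longrightarrow> supermean_at (h y) x"
  "y \<in> \<Omega> \<Longrightarrow> x \<in> \<Omega> \<Longrightarrow> supermean_at (\<lambda>x. - h y x) x"
  using supermean_at_harmonic[OF h_spec(1) open_dom] by auto

lemma supermean_at_profile:
  "x \<noteq> y \<Longrightarrow> supermean_at (\<lambda>x. radial_profile DIM('a) (norm (x - y))) x"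
  "x \<noteq> y \<Longrightarrow> supermean_at (\<lambda>x. - radial_profile DIM('a) (norm (x - y))) x" for x y :: 'a
  using supermean_at_harmonic[OF harmonic_on_radial_profile[OF dim, of y], of x] by auto

lemma supermean_at_g:
  "x \<in> \<Omega> \<Longrightarrow> y \<in> \<Omega> \<Longrightarrow> x \<noteq> y \<Longrightarrow> supermean_at (\<lambda>x. g x y) x"
  unfolding g_def by (intro supermean_at_add supermean_at_profile supermean_at_h)

text \<open>The fundamental solution cancels from the minimality condition except at the pole, where
  both sides are infinite and the condition says nothing. There the inequality follows from
  continuity of \<open>h y\<close> and \<open>w\<close>.\<close>

lemma h_minimal:
  assumes y: "y \<in> \<Omega>" and w: "continuous_on \<Omega> w" "\<And>x. x \<in> \<Omega> \<Longrightarrow> supermean_at w x"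
    and nonneg: "\<And>x. x \<in> \<Omega> \<Longrightarrow> x \<noteq> y \<Longrightarrow> 0 \<le> radial_profile DIM('a) (norm (x - y)) + w x"
    and x: "x \<in> \<Omega>"
  shows "h y x \<le> w x"
proof -
  have "superharmonic_on \<Omega> (\<lambda>x. ereal (w x))"
    using superharmonic_on_real[OF open_dom w] .
  moreover have "0 \<le> fundamental_solution (x - y) + ereal (w x)" if "x \<in> \<Omega>" for x
    using nonneg[OF that] fundamental_solution_eq[of "x - y"]
    by (cases "x = y") (auto simp: fundamental_solution_def)
  ultimately have le: "G x y \<le> fundamental_solution (x - y) + ereal (w x)" if "x \<in> \<Omega>" for x
    using green y that unfolding is_green_function_def by blast
  have off: "h y x \<le> w x" if "x \<in> \<Omega>" "x \<noteq> y" for x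
    using le[OF that(1)] h_spec(2)[OF y that(1)] fundamental_solution_eq[of "x - y"] that by simp
  show ?thesis
  proof (cases "x = y")
    case True
    have "((h y) \<longlongrightarrow> h y y) (at y)" "(w \<longlongrightarrow> w y) (at y)"
      using isCont_h[OF y y] w(1) y open_dom by (auto simp: isCont_def continuous_on_eq_continuous_at)
    moreover have "eventually (\<lambda>x. h y x \<le> w x) (at y)"
      using eventually_at_in_open'[OF open_dom y] off
      by (auto simp: eventually_at_filter elim!: eventually_mono)
    ultimately show ?thesis
      unfolding True by (intro tendsto_le[of "at y" w "w y" "h y" "h y y"]) auto
  qed (use off x in auto)
qed

text \<open>Points of the sphere of radius \<open>d\<close> about \<open>y0\<close> have distance at
  least \<open>d / 2\<close> from the pole, so nonnegativity of \<open>g\<close> bounds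
  \<open>h y\<close> there; the minimum principle carries the bound inside. The bound is the same
  for all poles near \<open>y0\<close>.\<close>

lemma h_lower_bound:
  assumes "cball y0 d \<subseteq> \<Omega>" "0 < d" "dist y0 y < d / 2" "x \<in> cball y0 d"
  shows "- radial_profile DIM('a) (d / 2) \<le> h y x"
proof (rule supermean_cball_min[OF assms(2) _ _ _ assms(4)])
  have "y \<in> cball y0 d" using assms(2,3) by simp
  then have y: "y \<in> \<Omega>" using assms(1) by blast
  show "continuous_on (cball y0 d) (h y)"
    using continuous_on_h[OF y] assms(1) by (rule continuous_on_subset)
  show "supermean_at (h y) x" if "x \<in> ball y0 d" for x
    using that assms(1) by (intro supermean_at_h y) auto
  fix x assume x: "dist y0 x = d"
  then have "x \<in> \<Omega>" using assms(1) by auto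
  have far: "d / 2 \<le> norm (x - y)"
    using x assms(3) dist_triangle[of y0 x y] by (simp add: dist_norm norm_minus_commute)
  then have "x \<noteq> y" using assms(2) by auto
  have "radial_profile DIM('a) (norm (x - y)) \<le> radial_profile DIM('a) (d / 2)"
    using far assms(2) by (intro radial_profile_antimono dim) auto
  then show "- radial_profile DIM('a) (d / 2) \<le> h y x"
    using g_nonneg[OF \<open>x \<in> \<Omega>\<close> y \<open>x \<noteq> y\<close>] by (simp add: g_def)
qed

section \<open>Dependence of the Green function on the pole\<close>

lemma h_le_h_plus:
  assumes "y \<in> \<Omega>" "y' \<in> \<Omega>" "\<And>x. x \<in> \<Omega> \<Longrightarrow> x \<noteq> y \<Longrightarrow> 0 \<le> radial_profile DIM('a) (norm (x - y)) + h y' x + c" "x \<in> \<Omega>"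
  shows "h y x \<le> h y' x + c"
proof (rule h_minimal[OF assms(1) _ _ _ assms(4)])
  show "continuous_on \<Omega> (\<lambda>x. h y' x + c)"
    by (intro continuous_intros continuous_on_h assms)
  show "supermean_at (\<lambda>x. h y' x + c) x" if "x \<in> \<Omega>" for x
    by (intro supermean_at_add supermean_at_h supermean_at_const assms that)
qed (use assms(3) in \<open>simp add: add.assoc\<close>)

text \<open>By minimality \<open>h y \<le> h y0 + e\<close> as soon as \<open>h y0 + e\<close> is a competitor for the pole \<open>y\<close>. Near the poles
  this follows from the lower bound on \<open>h\<close>, away from them from the Lipschitz bound on the profile.\<close>

lemma h_uniformly_continuous_pole:
  assumes y0: "y0 \<in> \<Omega>" and e: "0 < e"
  shows "eventually (\<lambda>y. \<forall>x\<in>\<Omega>. \<bar>h y x - h y0 x\<bar> \<le> e) (nhds y0)"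
proof -
  obtain d where d: "d > 0" "cball y0 d \<subseteq> \<Omega>"
    using y0 open_dom open_contains_cball by blast
  define L where "L = 1 / (real DIM('a) * unit_ball_vol (real DIM('a)) * (d / 8) ^ (DIM('a) - 1))"
  have L: "L > 0" using d by (simp add: L_def)
  show ?thesis
    unfolding eventually_nhds_metric
  proof (intro exI[of _ "min (d / 8) (e / L)"] conjI allI impI ballI)
    show "min (d / 8) (e / L) > 0" using d e L by simp
    fix y x assume "dist y y0 < min (d / 8) (e / L)" and x: "x \<in> \<Omega>"
    then have y: "dist y0 y < d / 8" and yL: "norm (y - y0) * L \<le> e"
      using L by (auto simp: dist_commute dist_norm field_simps norm_minus_commute)
    have "y \<in> cball y0 d" using y d by simp
    then have "y \<in> \<Omega>" using d by auto
    \<comment> \<open>Both orders of the two poles are covered because the comparison is needed in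
      both directions. Points within \<open>d / 4\<close> of \<open>y0\<close> are within
      \<open>d / 2\<close> of either pole; all others are at least \<open>d / 8\<close> away from
      both, where the profile has Lipschitz constant \<open>L\<close> and the radius
      \<open>e / L\<close> limits its change to \<open>e\<close>.\<close>
    have pos: "0 \<le> radial_profile DIM('a) (norm (z - y1)) + h y2 z + e"
      if "{y1, y2} \<subseteq> {y, y0}" "z \<in> \<Omega>" "z \<noteq> y1" for z y1 y2
    proof (cases "dist y0 z < d / 4")
      case True
      have "dist y0 y1 < d / 8" "dist y0 y2 < d / 8" using that y d by auto
      moreover have "dist z y1 \<le> dist y0 z + dist y0 y1"
        using dist_triangle[of z y1 y0] by (simp add: dist_commute)
      ultimately have "norm (z - y1) \<le> d / 2"
        using True d(1) unfolding dist_norm by linarith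
      then have "radial_profile DIM('a) (d / 2) \<le> radial_profile DIM('a) (norm (z - y1))"
        using that by (intro radial_profile_antimono dim) auto
      moreover have "- radial_profile DIM('a) (d / 2) \<le> h y2 z"
        using True \<open>dist y0 y2 < d / 8\<close> d by (intro h_lower_bound[of y0 d]) auto
      ultimately show ?thesis using e by simp
    next
      case False
      have "dist y0 z \<le> dist z y + dist y0 y"
        using dist_triangle[of y0 z y] by (simp add: dist_commute)
      then have far: "d / 8 \<le> norm (z - y)" "d / 8 \<le> norm (z - y0)"
        using False y d by (auto simp: dist_norm norm_minus_commute)
      then have "z \<noteq> y" "z \<noteq> y0" using d by auto
      have "\<bar>norm (z - y1) - norm (z - y2)\<bar> \<le> norm (y - y0)"
        using that norm_triangle_ineq3[of "z - y1" "z - y2"] by (auto simp: norm_minus_commute)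
      then have "L * \<bar>norm (z - y1) - norm (z - y2)\<bar> \<le> L * norm (y - y0)"
        using L by (intro mult_left_mono) auto
      moreover have "\<bar>radial_profile DIM('a) (norm (z - y1)) - radial_profile DIM('a) (norm (z - y2))\<bar> \<le> L * \<bar>norm (z - y1) - norm (z - y2)\<bar>"
        unfolding L_def using far d that by (intro radial_profile_lipschitz dim) auto
      ultimately have "\<bar>radial_profile DIM('a) (norm (z - y1)) - radial_profile DIM('a) (norm (z - y2))\<bar> \<le> e"
        using yL by (simp add: mult.commute)
      moreover have "0 \<le> radial_profile DIM('a) (norm (z - y2)) + h y2 z"
        using g_nonneg[of z y2] that \<open>y \<in> \<Omega>\<close> y0 \<open>z \<noteq> y\<close> \<open>z \<noteq> y0\<close> by (auto simp: g_def)
      ultimately show ?thesis by simp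
    qed
    have "h y x \<le> h y0 x + e" "h y0 x \<le> h y x + e"
      using \<open>y \<in> \<Omega>\<close> y0 x by (auto intro!: h_le_h_plus pos)
    then show "\<bar>h y x - h y0 x\<bar> \<le> e" by simp
  qed
qed

text \<open>Continuity in the point for a fixed pole combines with continuity in the pole that is
  uniform in the point.\<close>

lemma continuous_on_h_pair: "continuous_on (\<Omega> \<times> \<Omega>) (\<lambda>p. h (snd p) (fst p))"
proof (intro continuous_at_imp_continuous_on ballI)
  fix p assume "p \<in> \<Omega> \<times> \<Omega>"
  then obtain x0 y0 where p: "p = (x0, y0)" "x0 \<in> \<Omega>" "y0 \<in> \<Omega>" by auto
  have fst: "filterlim fst (nhds x0) (nhds p)" and snd: "filterlim snd (nhds y0) (nhds p)"
    unfolding p(1) using tendsto_fst[OF filterlim_ident, of "(x0, y0)"] tendsto_snd[OF filterlim_ident, of "(x0, y0)"]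
    by simp_all
  have "((\<lambda>p. h (snd p) (fst p)) \<longlongrightarrow> h y0 x0) (nhds p)"
  proof (rule tendstoI)
    fix e :: real assume e: "e > 0"
    have "eventually (\<lambda>x. dist (h y0 x) (h y0 x0) < e / 2) (nhds x0)"
      using isCont_h[OF p(3,2)] e by (intro tendstoD) (auto simp: isCont_def tendsto_at_iff_tendsto_nhds)
    then have f: "eventually (\<lambda>x. x \<in> \<Omega> \<and> dist (h y0 x) (h y0 x0) < e / 2) (nhds x0)"
      using eventually_nhds_in_open[OF open_dom p(2)] by eventually_elim auto
    have e2: "e / 2 > 0" using e by simp
    then have "eventually (\<lambda>y. \<forall>x\<in>\<Omega>. \<bar>h y x - h y0 x\<bar> \<le> e / 2) (nhds y0)"
      by (rule h_uniformly_continuous_pole[OF p(3)])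
    then have s: "eventually (\<lambda>q. \<forall>x\<in>\<Omega>. \<bar>h (snd q) x - h y0 x\<bar> \<le> e / 2) (nhds p)"
      by (rule eventually_compose_filterlim[OF _ snd])
    have "eventually (\<lambda>q. fst q \<in> \<Omega> \<and> dist (h y0 (fst q)) (h y0 x0) < e / 2) (nhds p)"
      by (rule eventually_compose_filterlim[OF f fst])
    with s
    show "eventually (\<lambda>p. dist (h (snd p) (fst p)) (h y0 x0) < e) (nhds p)"
    proof eventually_elim
      case (elim q)
      then have "\<bar>h (snd q) (fst q) - h y0 (fst q)\<bar> \<le> e / 2" "\<bar>h y0 (fst q) - h y0 x0\<bar> < e / 2"
        by (auto simp: dist_real_def)
      then show ?case unfolding dist_real_def by linarith
    qed
  qed
  then have "((\<lambda>p. h (snd p) (fst p)) \<longlongrightarrow> h (snd p) (fst p)) (at p)"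
    by (intro tendsto_mono[OF at_within_le_nhds]) (simp add: p(1))
  then show "isCont (\<lambda>p. h (snd p) (fst p)) p" unfolding isCont_def .
qed

lemma eventually_g_gt:
  assumes "y \<in> \<Omega>"
  shows "eventually (\<lambda>z. c < g z y) (at y)"
proof -
  have "filterlim (\<lambda>z. norm (z - y)) (at_right 0) (at y)"
    unfolding filterlim_at
    by (auto simp: eventually_at_filter intro!: tendsto_eq_intros)
  then have "filterlim (\<lambda>z. radial_profile DIM('a) (norm (z - y))) at_top (at y)"
    by (rule filterlim_compose[OF radial_profile_at_top[OF dim]])
  then have "eventually (\<lambda>z. c - h y y + 1 < radial_profile DIM('a) (norm (z - y))) (at y)"
    by (auto simp: filterlim_at_top_dense)
  moreover have "eventually (\<lambda>z. h y y - 1 < h y z) (at y)"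
    using isCont_h[OF assms assms] by (auto simp: isCont_def intro!: order_tendstoD(1))
  ultimately show ?thesis
    by eventually_elim (auto simp: g_def)
qed

text \<open>A zero off the pole would be an interior minimum on the punctured domain, which is
  connected because the dimension is at least 2. Then \<open>g\<close> would vanish there
  identically, against its blow-up at the pole.\<close>

lemma g_pos:
  assumes "x \<in> \<Omega>" "y \<in> \<Omega>" "x \<noteq> y"
  shows "0 < g x y"
proof (rule ccontr)
  assume "\<not> 0 < g x y"
  then have 0: "g x y = 0" using g_nonneg[OF assms] by simp
  have zero: "g z y = 0" if "z \<in> \<Omega>" "z \<noteq> y" for z
  proof -
    have "g z y = g x y"
    proof (rule supermean_min_principle[of "\<Omega> - {y}"])
      show "open (\<Omega> - {y})" "connected (\<Omega> - {y})"
        using open_dom connected_dom dim by (auto intro: connected_open_delete)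
      show "continuous_on (\<Omega> - {y}) (\<lambda>x. g x y)"
        using assms by (intro continuous_at_imp_continuous_on ballI isCont_g) auto
    qed (use that assms 0 supermean_at_g g_nonneg in auto)
    then show ?thesis using 0 by simp
  qed
  have "eventually (\<lambda>z. z \<in> \<Omega> - {y}) (at y)"
    using eventually_at_in_open'[OF open_dom assms(2)] by (auto simp: eventually_at_filter elim!: eventually_mono)
  with eventually_g_gt[OF assms(2), of 0] have "eventually (\<lambda>z. False) (at y)"
    by eventually_elim (use zero in auto)
  then show False by simp
qed

lemma continuous_on_g_pair:
  assumes "S \<subseteq> \<Omega> \<times> \<Omega>" "\<And>x y. (x, y) \<in> S \<Longrightarrow> x \<noteq> y"
  shows "continuous_on S (\<lambda>p. g (fst p) (snd p))"
proof -
  have "continuous_on {0<..} (radial_profile DIM('a))"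
    by (intro continuous_at_imp_continuous_on ballI DERIV_isCont[OF radial_profile_deriv[OF dim]]) auto
  then have "continuous_on S (\<lambda>p. radial_profile DIM('a) (norm (fst p - snd p)))"
    by (rule continuous_on_compose2) (use assms(2) in \<open>auto intro!: continuous_intros\<close>)
  then show ?thesis
    unfolding g_def using continuous_on_subset[OF continuous_on_h_pair assms(1)]
    by (rule continuous_on_add)
qed

text \<open>The competitor is \<open>h y\<close> on \<open>N\<close>, and off \<open>N\<close> its minimum with the function \<open>v\<close> that corresponds to the
  claimed bound; the constant is chosen such that \<open>v > h y\<close> near the frontier of \<open>N\<close>.\<close>

lemma g_le_cmult_off_compact:
  assumes K: "compact K" "K \<subseteq> interior N" and N: "compact N" "N \<subseteq> \<Omega>" and y0: "y0 \<in> interior N"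
  obtains C where "0 < C" "\<And>x y. x \<in> \<Omega> - N \<Longrightarrow> y \<in> K \<Longrightarrow> g x y \<le> C * g x y0"
proof -
  have intN: "interior N \<subseteq> N" by (rule interior_subset)
  have "frontier N = N - interior N"
    by (simp add: frontier_def closure_closed compact_imp_closed N(1))
  then have front: "frontier N \<subseteq> \<Omega>" "compact (frontier N)" "frontier N \<inter> interior N = {}"
    using N(2) compact_frontier[OF N(1)] by blast+
  have "y0 \<in> \<Omega>" using y0 N intN by auto
  have "K \<subseteq> \<Omega>" using K N intN by auto
  have "bounded ((\<lambda>p. g (fst p) (snd p)) ` (frontier N \<times> K))"
    using front K \<open>K \<subseteq> \<Omega>\<close>
    by (intro compact_imp_bounded compact_continuous_image continuous_on_g_pair compact_Times) auto
  then obtain M where M: "\<And>x y. x \<in> frontier N \<Longrightarrow> y \<in> K \<Longrightarrow> \<bar>g x y\<bar> \<le> M"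
    unfolding bounded_iff by fastforce
  obtain m where m: "m > 0" "\<And>x. x \<in> frontier N \<Longrightarrow> m \<le> g x y0"
  proof (cases "frontier N = {}")
    case False
    have "continuous_on (frontier N) (\<lambda>x. g x y0)"
      using front y0 \<open>y0 \<in> \<Omega>\<close> by (intro continuous_at_imp_continuous_on ballI isCont_g) auto
    from continuous_attains_inf[OF front(2) False this] obtain x1
      where x1: "x1 \<in> frontier N" "\<And>x. x \<in> frontier N \<Longrightarrow> g x1 y0 \<le> g x y0" by blast
    have "x1 \<noteq> y0" "x1 \<in> \<Omega>" using x1 y0 front by auto
    then show ?thesis using that[of "g x1 y0"] x1 g_pos \<open>y0 \<in> \<Omega>\<close> by auto
  qed (use that[of 1] in auto)
  define C where "C = (\<bar>M\<bar> + 1) / m"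
  have C: "C > 0" using m by (simp add: C_def)
  show ?thesis
  proof (rule that[OF C])
    fix x y assume x: "x \<in> \<Omega> - N" and y: "y \<in> K"
    then have "y \<in> \<Omega>" "y \<in> interior N" using \<open>K \<subseteq> \<Omega>\<close> K by auto
    define v where "v x = C * g x y0 - radial_profile DIM('a) (norm (x - y))" for x
    define w where "w x = (if x \<in> N then h y x else min (h y x) (v x))" for x
    have v_cont: "isCont v x" and v_super: "supermean_at v x" if "x \<in> \<Omega>" "x \<noteq> y" "x \<noteq> y0" for x
    proof -
      show "isCont v x"
        unfolding v_def by (intro continuous_intros isCont_g isCont_profile that \<open>y0 \<in> \<Omega>\<close>)
      have "supermean_at (\<lambda>x. C * g x y0 + (- radial_profile DIM('a) (norm (x - y)))) x"
        using C by (intro supermean_at_add supermean_at_cmult supermean_at_g supermean_at_profile that \<open>y0 \<in> \<Omega>\<close>) auto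
      then show "supermean_at v x" by (simp add: v_def[abs_def])
    qed
    \<comment> \<open>Continuity and the super-mean-value property are local, so it is enough to
      identify \<open>w\<close> near each point. At a frontier point the strict inequality
      \<open>h y x < v x\<close> persists nearby, so that the minimum is again \<open>h y\<close>
      and the two definitions of \<open>w\<close> agree.\<close>
    have cases: "eventually (\<lambda>z. w z = h y z) (nhds x)
      \<or> eventually (\<lambda>z. w z = min (h y z) (v z)) (nhds x) \<and> x \<noteq> y \<and> x \<noteq> y0" if x: "x \<in> \<Omega>" for x
    proof -
      consider "x \<in> interior N" | "x \<in> frontier N" | "x \<notin> N"
        using closure_subset by (auto simp: frontier_def)
      then show ?thesis
      proof cases
        case 1
        then have "eventually (\<lambda>z. z \<in> interior N) (nhds x)"
          by (intro eventually_nhds_in_open open_interior)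
        then have "eventually (\<lambda>z. w z = h y z) (nhds x)"
          by (rule eventually_mono) (use intN in \<open>auto simp: w_def\<close>)
        then show ?thesis ..
      next
        case 2
        then have ne: "x \<noteq> y" "x \<noteq> y0" using y K y0 front by auto
        have "1 \<le> g x y0 / m"
          using m(2)[OF 2] m(1) by (simp add: pos_le_divide_eq)
        then have "(\<bar>M\<bar> + 1) * 1 \<le> (\<bar>M\<bar> + 1) * (g x y0 / m)"
          by (intro mult_left_mono) auto
        then have "\<bar>M\<bar> + 1 \<le> C * g x y0" by (simp add: C_def)
        then have "h y x < v x"
          using M[OF 2 y] unfolding v_def g_def[of x y] by linarith
        moreover have "isCont (\<lambda>z. v z - h y z) x"
          by (intro continuous_intros v_cont isCont_h x ne \<open>y \<in> \<Omega>\<close>)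
        ultimately have "eventually (\<lambda>z. 0 < v z - h y z) (nhds x)"
          by (intro isCont_eventually_pos) auto
        then have "eventually (\<lambda>z. w z = h y z) (nhds x)"
          by (rule eventually_mono) (auto simp: w_def)
        then show ?thesis ..
      next
        case 3
        then have "eventually (\<lambda>z. z \<in> - N) (nhds x)"
          using compact_imp_closed[OF N(1)] by (intro eventually_nhds_in_open) auto
        then have "eventually (\<lambda>z. w z = min (h y z) (v z)) (nhds x)"
          by (rule eventually_mono) (auto simp: w_def)
        moreover have "x \<noteq> y" "x \<noteq> y0" using 3 y K y0 intN by auto
        ultimately show ?thesis by blast
      qed
    qed
    have "h y x \<le> w x"
    proof (rule h_minimal[OF \<open>y \<in> \<Omega>\<close>])
      show "continuous_on \<Omega> w"
      proof (intro continuous_at_imp_continuous_on ballI)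
        fix x assume x: "x \<in> \<Omega>"
        from cases[OF x] show "isCont w x"
        proof
          assume "eventually (\<lambda>z. w z = h y z) (nhds x)"
          then show ?thesis using isCont_cong isCont_h[OF \<open>y \<in> \<Omega>\<close> x] by blast
        next
          assume *: "eventually (\<lambda>z. w z = min (h y z) (v z)) (nhds x) \<and> x \<noteq> y \<and> x \<noteq> y0"
          then have "isCont (\<lambda>z. min (h y z) (v z)) x"
            using x by (intro continuous_min isCont_h \<open>y \<in> \<Omega>\<close> v_cont) auto
          then show ?thesis using isCont_cong[OF conjunct1[OF *]] by (rule iffD2[rotated])
        qed
      qed
      fix x assume x: "x \<in> \<Omega>"
      from cases[OF x] show "supermean_at w x"
      proof
        assume "eventually (\<lambda>z. w z = h y z) (nhds x)"
        then show ?thesis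
          by (intro supermean_at_cong[OF supermean_at_h(1)[OF \<open>y \<in> \<Omega>\<close> x]]) (auto elim: eventually_mono)
      next
        assume *: "eventually (\<lambda>z. w z = min (h y z) (v z)) (nhds x) \<and> x \<noteq> y \<and> x \<noteq> y0"
        then have "supermean_at (\<lambda>z. min (h y z) (v z)) x"
          using x by (intro supermean_at_min supermean_at_h \<open>y \<in> \<Omega>\<close> v_super) auto
        then show ?thesis
          by (rule supermean_at_cong) (use * in \<open>auto elim: eventually_mono\<close>)
      qed
      assume "x \<noteq> y"
      have "0 \<le> radial_profile DIM('a) (norm (x - y)) + h y x"
        using g_nonneg[OF x \<open>y \<in> \<Omega>\<close> \<open>x \<noteq> y\<close>] by (simp add: g_def)
      moreover have "0 \<le> radial_profile DIM('a) (norm (x - y)) + v x" if "x \<notin> N"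
      proof -
        have "x \<noteq> y0" using that y0 intN by auto
        then have "0 \<le> C * g x y0" using g_nonneg[OF x \<open>y0 \<in> \<Omega>\<close>] C by simp
        then show ?thesis by (simp add: v_def)
      qed
      ultimately show "0 \<le> radial_profile DIM('a) (norm (x - y)) + w x"
        by (auto simp: w_def min_def)
    qed (use x in auto)
    also have "\<dots> \<le> v x" using x by (simp add: w_def)
    finally show "g x y \<le> C * g x y0" by (simp add: v_def g_def)
  qed
qed

end

section \<open>Potentials and their continuity\<close>

lemma tendsto_ennreal_minus_const:
  fixes x c :: ennreal
  assumes "(f \<longlongrightarrow> x) F" "c < top"
  shows "((\<lambda>z. f z - c) \<longlongrightarrow> x - c) F"
proof (cases "x = top")
  case False
  then show ?thesis using assms by (intro tendsto_diff_ennreal tendsto_const) auto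
next
  case True
  have "((\<lambda>z. f z - c) \<longlongrightarrow> top) F"
  proof (rule order_tendstoI)
    fix a :: ennreal assume "a < top"
    then have "a + c < x" using assms(2) True by (simp add: less_top[symmetric])
    then have "eventually (\<lambda>z. a + c < f z) F"
      using assms(1) by (rule order_tendstoD(1)[rotated])
    then show "eventually (\<lambda>z. a < f z - c) F"
      using assms(2) by (auto elim!: eventually_mono simp: less_diff_eq_ennreal)
  qed auto
  then show ?thesis using True assms(2) by simp
qed

text \<open>The measure lives on all Borel sets of the space, which spares restricted
  \<sigma>-algebras. The kernel \<open>k\<close> is extended by 0, so mass outside \<Omega>
  contributes nothing.\<close>

locale green_potential = green_function \<Omega> G
  for \<Omega> :: "'a::euclidean_space set" and G +
  fixes M :: "'a measure"
  assumes sets_M [measurable_cong]: "sets M = sets borel"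
    and finite_on_compact: "\<And>K. compact K \<Longrightarrow> K \<subseteq> \<Omega> \<Longrightarrow> emeasure M K < \<infinity>"
begin

definition k :: "'a \<Rightarrow> 'a \<Rightarrow> ennreal" where
  "k x y = (if x \<in> \<Omega> \<and> y \<in> \<Omega> then (if x = y then top else ennreal (g x y)) else 0)"

definition P :: "'a set \<Rightarrow> 'a \<Rightarrow> ennreal" where
  "P E x = (\<integral>\<^sup>+ y\<in>E. k x y \<partial>M)"

text \<open>Subtraction of extended nonnegative numbers stops at 0, so the integrand is the positive
  part of \<open>k x y - j\<close>: what truncating the kernel at level \<open>j\<close> cuts
  off.\<close>

definition tail :: "real \<Rightarrow> 'a set \<Rightarrow> 'a \<Rightarrow> ennreal" where
  "tail j E x = (\<integral>\<^sup>+ y\<in>E. (k x y - ennreal j) \<partial>M)"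

text \<open>Locally uniform integrability of the kernel, with a radius chosen before the accuracy.
  On sets of finite measure it implies continuity of the potential, and unlike continuity it passes
  to subsets directly from its definition.\<close>

definition uniform_tails :: "'a set \<Rightarrow> bool" where
  "uniform_tails E \<longleftrightarrow> (\<forall>x0\<in>\<Omega>. \<exists>r>0. \<forall>e>0. \<exists>j\<ge>0. \<forall>x\<in>ball x0 r. tail j E x \<le> ennreal e)"

lemma measurable_open_dom [measurable]: "\<Omega> \<in> sets borel"
  using open_dom by simp

lemma emeasure_finite_subset_compact:
  assumes "compact L" "L \<subseteq> \<Omega>" "E \<subseteq> L"
  shows "emeasure M E < \<infinity>"
proof -
  have "L \<in> sets M" using assms(1) by (simp add: sets_M compact_imp_closed)
  then have "emeasure M E \<le> emeasure M L" using assms(3) by (rule emeasure_mono[rotated])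
  also have "\<dots> < \<infinity>" by (rule finite_on_compact[OF assms(1,2)])
  finally show ?thesis .
qed

lemma e2ennreal_G: "x \<in> \<Omega> \<Longrightarrow> y \<in> \<Omega> \<Longrightarrow> e2ennreal (G x y) = k x y"
  using G_eq[of x y] G_diag[of x] by (auto simp: k_def e2ennreal_ereal)

lemma measurable_k_pair: "(\<lambda>p. k (fst p) (snd p)) \<in> borel_measurable borel"
proof -
  define S where "S = (\<Omega> \<times> \<Omega>) \<inter> {p. fst p \<noteq> snd p}"
  have "open {p :: 'a \<times> 'a. fst p \<noteq> snd p}"
    by (intro open_Collect_neq continuous_intros)
  then have "open S"
    unfolding S_def by (intro open_Int open_Times open_dom)
  then have [measurable]: "S \<in> sets borel" "\<Omega> \<times> \<Omega> \<in> sets borel"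
    using open_dom by (auto intro!: borel_open open_Times)
  have "continuous_on S (\<lambda>p. g (fst p) (snd p))"
    by (rule continuous_on_g_pair) (auto simp: S_def)
  then have [measurable]: "(\<lambda>p. indicator S p *\<^sub>R g (fst p) (snd p)) \<in> borel_measurable borel"
    using \<open>open S\<close> by (intro borel_measurable_continuous_on_indicator) auto
  have "(\<lambda>p. k (fst p) (snd p)) = (\<lambda>p. if p \<in> S then ennreal (indicator S p *\<^sub>R g (fst p) (snd p))
      else if p \<in> \<Omega> \<times> \<Omega> then top else 0)"
    by (auto simp: k_def S_def fun_eq_iff)
  also have "\<dots> \<in> borel_measurable borel" by measurable
  finally show ?thesis .
qed

lemma measurable_k [measurable (raw)]:
  assumes [measurable]: "f \<in> N \<rightarrow>\<^sub>M borel" "f' \<in> N \<rightarrow>\<^sub>M borel"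
  shows "(\<lambda>w. k (f w) (f' w)) \<in> borel_measurable N"
proof -
  have "(\<lambda>w. (f w, f' w)) \<in> N \<rightarrow>\<^sub>M borel \<Otimes>\<^sub>M borel" by measurable
  then have "(\<lambda>w. (f w, f' w)) \<in> N \<rightarrow>\<^sub>M borel" by (simp add: borel_prod)
  from measurable_compose[OF this measurable_k_pair] show ?thesis by simp
qed

lemma tendsto_k:
  assumes "X \<longlonglongrightarrow> x" "x \<in> \<Omega>"
  shows "(\<lambda>n. k (X n) y) \<longlonglongrightarrow> k x y"
proof (cases "y \<in> \<Omega>")
  case False
  then show ?thesis by (simp add: k_def)
next
  case y: True
  have inO: "eventually (\<lambda>n. X n \<in> \<Omega>) sequentially"
    using topological_tendstoD[OF assms(1) open_dom assms(2)] .
  show ?thesis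
  proof (cases "x = y")
    case False
    have "(\<lambda>n. ennreal (g (X n) y)) \<longlonglongrightarrow> ennreal (g x y)"
      using isCont_tendsto_compose[OF isCont_g[OF assms(2) y False] assms(1)] by (rule tendsto_ennrealI)
    moreover have "eventually (\<lambda>n. X n \<noteq> y) sequentially"
      using tendsto_imp_eventually_ne[OF assms(1) False] .
    with inO have "eventually (\<lambda>n. ennreal (g (X n) y) = k (X n) y) sequentially"
      by eventually_elim (simp add: k_def y)
    ultimately have "(\<lambda>n. k (X n) y) \<longlonglongrightarrow> ennreal (g x y)"
      by (rule Lim_transform_eventually)
    then show ?thesis using False y assms(2) by (simp add: k_def)
  next
    case True
    have "(\<lambda>n. k (X n) y) \<longlonglongrightarrow> top"
    proof (rule order_tendstoI)
      fix a :: ennreal assume "a < top"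
      then obtain b where b: "a = ennreal b" "b \<ge> 0" by (cases a) auto
      have "eventually (\<lambda>z. b < g z y) (at y)"
        by (rule eventually_g_gt[OF y])
      then have "eventually (\<lambda>z. z \<noteq> y \<longrightarrow> b < g z y) (nhds y)"
        by (simp add: eventually_at_filter)
      then have "eventually (\<lambda>n. X n \<noteq> y \<longrightarrow> b < g (X n) y) sequentially"
        using assms(1) unfolding True by (rule eventually_compose_filterlim)
      then show "eventually (\<lambda>n. a < k (X n) y) sequentially"
        using inO by eventually_elim (use b y in \<open>auto simp: k_def ennreal_less_iff\<close>)
    qed auto
    then show ?thesis using True y by (simp add: k_def)
  qed
qed

section \<open>Tails of the kernel and continuity of potentials\<close>

lemma tail_liminf:
  assumes "X \<longlonglongrightarrow> x" "x \<in> \<Omega>" and [measurable]: "E \<in> sets borel"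
  shows "tail j E x \<le> liminf (\<lambda>n. tail j E (X n))"
proof -
  have "tail j E x = (\<integral>\<^sup>+ y. liminf (\<lambda>n. (k (X n) y - ennreal j) * indicator E y) \<partial>M)"
    unfolding tail_def
  proof (intro nn_integral_cong)
    fix y
    have "(\<lambda>n. k (X n) y - ennreal j) \<longlonglongrightarrow> k x y - ennreal j"
      by (intro tendsto_ennreal_minus_const tendsto_k assms) auto
    then have "(\<lambda>n. (k (X n) y - ennreal j) * indicator E y) \<longlonglongrightarrow> (k x y - ennreal j) * indicator E y"
      by (cases "y \<in> E") auto
    then show "(k x y - ennreal j) * indicator E y = liminf (\<lambda>n. (k (X n) y - ennreal j) * indicator E y)"
      by (simp add: lim_imp_Liminf)
  qed
  also have "\<dots> \<le> liminf (\<lambda>n. tail j E (X n))"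
    unfolding tail_def by (intro nn_integral_liminf) measurable
  finally show ?thesis .
qed

lemma P_mono: "E \<subseteq> F \<Longrightarrow> P E x \<le> P F x"
  unfolding P_def by (intro nn_integral_mono) (auto simp: indicator_def)

lemma tail_mono: "E \<subseteq> F \<Longrightarrow> tail j E x \<le> tail j F x"
  unfolding tail_def by (intro nn_integral_mono) (auto simp: indicator_def)

lemma tail_antimono: "i \<le> j \<Longrightarrow> tail j E x \<le> tail i E x"
  unfolding tail_def by (intro nn_integral_mono mult_right_mono ennreal_minus_mono ennreal_leI) auto

lemma P_eq_trunc_plus_tail:
  assumes [measurable]: "E \<in> sets borel"
  shows "P E x = (\<integral>\<^sup>+ y\<in>E. min (k x y) (ennreal j) \<partial>M) + tail j E x"
proof -
  have "min a b + (a - b) = a" if "b < top" for a b :: ennreal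
    using that by (cases "a \<le> b") (auto simp: min_def diff_eq_0_iff_ennreal ennreal_minus_eq_0 not_le less_imp_le)
  then have "P E x = (\<integral>\<^sup>+ y. min (k x y) (ennreal j) * indicator E y + (k x y - ennreal j) * indicator E y \<partial>M)"
    unfolding P_def by (intro nn_integral_cong) (auto simp: indicator_def)
  also have "\<dots> = (\<integral>\<^sup>+ y\<in>E. min (k x y) (ennreal j) \<partial>M) + tail j E x"
    unfolding tail_def by (intro nn_integral_add) measurable
  finally show ?thesis .
qed

lemma uniform_tails_subset: "uniform_tails F \<Longrightarrow> E \<subseteq> F \<Longrightarrow> uniform_tails E"
  unfolding uniform_tails_def by (meson order_trans tail_mono)

lemma uniform_tails_Un:
  assumes "uniform_tails E" "uniform_tails F" and [measurable]: "E \<in> sets borel" "F \<in> sets borel"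
  shows "uniform_tails (E \<union> F)"
  unfolding uniform_tails_def
proof
  fix x0 assume x0: "x0 \<in> \<Omega>"
  obtain r1 r2 where r: "r1 > 0" "r2 > 0"
    and 1: "\<And>e. e > 0 \<Longrightarrow> \<exists>j\<ge>0. \<forall>x\<in>ball x0 r1. tail j E x \<le> ennreal e"
    and 2: "\<And>e. e > 0 \<Longrightarrow> \<exists>j\<ge>0. \<forall>x\<in>ball x0 r2. tail j F x \<le> ennreal e"
    using assms(1,2) x0 unfolding uniform_tails_def by blast
  have "\<exists>j\<ge>0. \<forall>x\<in>ball x0 (min r1 r2). tail j (E \<union> F) x \<le> ennreal e" if "e > 0" for e
  proof -
    obtain j1 j2 where j: "j1 \<ge> 0" "j2 \<ge> 0" "\<And>x. x\<in>ball x0 r1 \<Longrightarrow> tail j1 E x \<le> ennreal (e / 2)"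
      "\<And>x. x\<in>ball x0 r2 \<Longrightarrow> tail j2 F x \<le> ennreal (e / 2)"
      using 1[of "e / 2"] 2[of "e / 2"] \<open>e > 0\<close> by auto
    have "tail (max j1 j2) (E \<union> F) x \<le> ennreal e" if "x \<in> ball x0 (min r1 r2)" for x
    proof -
      have "tail (max j1 j2) (E \<union> F) x \<le>
          (\<integral>\<^sup>+ y. (k x y - ennreal (max j1 j2)) * indicator E y + (k x y - ennreal (max j1 j2)) * indicator F y \<partial>M)"
        unfolding tail_def by (intro nn_integral_mono) (auto simp: indicator_def)
      also have "\<dots> = tail (max j1 j2) E x + tail (max j1 j2) F x"
        unfolding tail_def by (intro nn_integral_add) measurable
      also have "\<dots> \<le> tail j1 E x + tail j2 F x"
        by (intro add_mono tail_antimono) auto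
      also have "\<dots> \<le> ennreal (e / 2) + ennreal (e / 2)"
        using that by (intro add_mono j) auto
      also have "\<dots> = ennreal e"
        using \<open>e > 0\<close> by (simp flip: ennreal_plus)
      finally show ?thesis .
    qed
    then show ?thesis using j by (intro exI[of _ "max j1 j2"]) auto
  qed
  then show "\<exists>r>0. \<forall>e>0. \<exists>j\<ge>0. \<forall>x\<in>ball x0 r. tail j (E \<union> F) x \<le> ennreal e"
    using r by (intro exI[of _ "min r1 r2"]) auto
qed

lemma P_finite:
  assumes "uniform_tails E" "x \<in> \<Omega>" and [measurable]: "E \<in> sets borel" and "emeasure M E < \<infinity>"
  shows "P E x < \<infinity>"
proof -
  obtain r j where "0 < r" "\<forall>x\<in>ball x r. tail j E x \<le> ennreal 1" "0 \<le> j"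
    using assms(1,2) unfolding uniform_tails_def by (metis zero_less_one)
  then have "tail j E x \<le> 1" by simp
  then have "tail j E x < \<infinity>" by (simp add: less_top[symmetric]) (metis ennreal_one_less_top leD)
  moreover have "(\<integral>\<^sup>+ y\<in>E. min (k x y) (ennreal j) \<partial>M) \<le> (\<integral>\<^sup>+ y\<in>E. ennreal j \<partial>M)"
    by (intro nn_integral_mono mult_right_mono) auto
  moreover have "(\<integral>\<^sup>+ y\<in>E. ennreal j \<partial>M) < \<infinity>"
    using assms(4) by (simp add: nn_integral_cmult ennreal_mult_less_top)
  ultimately show ?thesis
    unfolding P_eq_trunc_plus_tail[OF assms(3), of x j] by (simp add: less_top[symmetric]) (metis leD less_top)
qed

lemma trunc_tendsto:
  assumes "X \<longlonglongrightarrow> x" "x \<in> \<Omega>" and [measurable]: "E \<in> sets borel" and "emeasure M E < \<infinity>"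
  shows "(\<lambda>n. \<integral>\<^sup>+ y\<in>E. min (k (X n) y) (ennreal j) \<partial>M) \<longlonglongrightarrow> (\<integral>\<^sup>+ y\<in>E. min (k x y) (ennreal j) \<partial>M)"
proof (rule nn_integral_dominated_convergence[where w="\<lambda>y. ennreal j * indicator E y"])
  show "(\<integral>\<^sup>+ y. ennreal j * indicator E y \<partial>M) < \<infinity>"
    using assms(4) by (simp add: nn_integral_cmult ennreal_mult_less_top)
  show "AE y in M. (\<lambda>n. min (k (X n) y) (ennreal j) * indicator E y) \<longlonglongrightarrow> min (k x y) (ennreal j) * indicator E y"
  proof (intro AE_I2)
    fix y
    have "(\<lambda>n. min (k (X n) y) (ennreal j)) \<longlonglongrightarrow> min (k x y) (ennreal j)"
      by (intro tendsto_min tendsto_k assms tendsto_const)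
    then show "(\<lambda>n. min (k (X n) y) (ennreal j) * indicator E y) \<longlonglongrightarrow> min (k x y) (ennreal j) * indicator E y"
      by (cases "y \<in> E") auto
  qed
  show "AE y in M. min (k (X n) y) (ennreal j) * indicator E y \<le> ennreal j * indicator E y" for n
    by (intro AE_I2 mult_right_mono) auto
qed measurable

text \<open>The truncated part is continuous by dominated convergence, and the rest is uniformly
  small near \<open>x\<close>: the potential is a locally uniform limit of continuous
  functions.\<close>

lemma isCont_P:
  assumes ut: "uniform_tails E" and x: "x \<in> \<Omega>" and [measurable]: "E \<in> sets borel" and fin: "emeasure M E < \<infinity>"
  shows "isCont (\<lambda>x. enn2real (P E x)) x"
  unfolding continuous_at_sequentially comp_def
proof (intro allI impI)
  fix X :: "nat \<Rightarrow> 'a" assume X: "X \<longlonglongrightarrow> x"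
  obtain r where r: "r > 0" and tails: "\<And>e. e > 0 \<Longrightarrow> \<exists>j\<ge>0. \<forall>z\<in>ball x r. tail j E z \<le> ennreal e"
    using ut x unfolding uniform_tails_def by blast
  show "(\<lambda>n. enn2real (P E (X n))) \<longlonglongrightarrow> enn2real (P E x)"
  proof (rule tendstoI)
    fix e :: real assume e: "e > 0"
    then have "0 < e / 3" by simp
    from tails[OF this] obtain j where j: "\<And>z. z \<in> ball x r \<Longrightarrow> tail j E z \<le> ennreal (e / 3)" by blast
    define T where "T z = (\<integral>\<^sup>+ y\<in>E. min (k z y) (ennreal j) \<partial>M)" for z
    have Tfin: "T z < top" for z
    proof -
      have "T z \<le> (\<integral>\<^sup>+ y\<in>E. ennreal j \<partial>M)"
        unfolding T_def by (intro nn_integral_mono mult_right_mono) auto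
      also have "\<dots> < top"
        using fin by (simp add: nn_integral_cmult ennreal_mult_less_top)
      finally show ?thesis .
    qed
    have split: "enn2real (P E z) = enn2real (T z) + enn2real (tail j E z)"
      "enn2real (tail j E z) \<le> e / 3" if "z \<in> ball x r" for z
    proof -
      have "tail j E z < top" using j[OF that] by (rule le_less_trans) simp
      then show "enn2real (P E z) = enn2real (T z) + enn2real (tail j E z)"
        using Tfin[of z] P_eq_trunc_plus_tail[of E z j] by (simp add: T_def enn2real_plus)
      show "enn2real (tail j E z) \<le> e / 3"
        using enn2real_mono[OF j[OF that]] e by simp
    qed
    have "(\<lambda>n. T (X n)) \<longlonglongrightarrow> T x"
      unfolding T_def using X x fin by (intro trunc_tendsto) auto
    then have "(\<lambda>n. enn2real (T (X n))) \<longlonglongrightarrow> enn2real (T x)"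
      using Tfin[of x] by (intro tendsto_enn2real) auto
    then have "eventually (\<lambda>n. dist (enn2real (T (X n))) (enn2real (T x)) < e / 3) sequentially"
      using \<open>0 < e / 3\<close> by (rule tendstoD)
    moreover have "eventually (\<lambda>n. X n \<in> ball x r) sequentially"
      using X r by (intro topological_tendstoD) auto
    ultimately show "eventually (\<lambda>n. dist (enn2real (P E (X n))) (enn2real (P E x)) < e) sequentially"
    proof eventually_elim
      case (elim n)
      have "x \<in> ball x r" using r by simp
      have "0 \<le> enn2real (tail j E (X n))" "0 \<le> enn2real (tail j E x)" by simp_all
      then show ?case
        using elim(1) split[OF elim(2)] split[OF \<open>x \<in> ball x r\<close>] unfolding dist_real_def by linarith
    qed
  qed
qed

text \<open>For \<open>x\<close> near a closed set \<open>E\<close> carrying the measure and \<open>x'\<close> a point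
  of \<open>E\<close> nearest to \<open>x\<close>, every \<open>y \<in> E\<close> satisfies \<open>norm (x' - y) \<le> 2 * norm (x - y)\<close>.\<close>

lemma uniform_tails_from_closed:
  assumes L: "compact L" "L \<subseteq> \<Omega>" and E: "closed E" "E \<subseteq> L" "D \<subseteq> E"
    and [measurable]: "D \<in> sets borel"
    and tails: "\<And>e. e > 0 \<Longrightarrow> \<exists>j\<ge>0. \<forall>x\<in>E. tail j D x \<le> ennreal e"
  shows "uniform_tails D"
  unfolding uniform_tails_def
proof
  fix x0 assume x0: "x0 \<in> \<Omega>"
  obtain r where r: "r > 0" "cball x0 r \<subseteq> \<Omega>"
    using open_dom x0 open_contains_cball by blast
  obtain A B where AB: "1 \<le> A" "0 \<le> B"
    "\<And>\<rho>. 0 < \<rho> \<Longrightarrow> radial_profile DIM('a) \<rho> \<le> A * radial_profile DIM('a) (2 * \<rho>) + B"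
    using radial_profile_doubling[OF dim] by blast
  have "bounded ((\<lambda>p. h (snd p) (fst p)) ` ((cball x0 r \<union> L) \<times> L))"
    using r L by (intro compact_imp_bounded compact_continuous_image compact_Times compact_Un compact_cball
        continuous_on_subset[OF continuous_on_h_pair]) auto
  then obtain H where H: "\<And>x y. x \<in> cball x0 r \<union> L \<Longrightarrow> y \<in> L \<Longrightarrow> \<bar>h y x\<bar> \<le> H"
    unfolding bounded_iff by fastforce
  \<comment> \<open>\<open>B\<close> is the additive error of doubling, one
    \<open>\<bar>H\<bar>\<close> bounds \<open>h y x\<close>, and \<open>A * \<bar>H\<bar>\<close>
    compensates for \<open>A * h y x'\<close>.\<close>
  define C where "C = B + \<bar>H\<bar> + A * \<bar>H\<bar>"
  have C: "C \<ge> 0" using AB by (simp add: C_def)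
  have kk: "k x y \<le> ennreal A * k x' y + ennreal C"
    if x: "x \<in> ball x0 r" and y: "y \<in> E" and x': "x' \<in> E" "dist x x' \<le> dist x y" for x y x'
  proof (cases "x' = y")
    case True
    have "y \<in> \<Omega>" using y E L by auto
    then have "ennreal A * k x' y = top"
      using True AB by (simp add: k_def ennreal_mult_top)
    then show ?thesis by simp
  next
    case False
    then have "x \<noteq> y" using x' by auto
    have O: "x \<in> \<Omega>" "y \<in> \<Omega>" "x' \<in> \<Omega>" using x y x' E L r by auto
    have "dist x' y \<le> dist x x' + dist x y" by (metis dist_commute dist_triangle)
    then have d: "norm (x' - y) \<le> 2 * norm (x - y)" using x'(2) by (simp add: dist_norm)
    have "radial_profile DIM('a) (norm (x - y)) \<le> A * radial_profile DIM('a) (2 * norm (x - y)) + B"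
      using \<open>x \<noteq> y\<close> by (intro AB) simp
    also have "\<dots> \<le> A * radial_profile DIM('a) (norm (x' - y)) + B"
      using AB d False by (intro add_right_mono mult_left_mono radial_profile_antimono dim) auto
    finally have 1: "radial_profile DIM('a) (norm (x - y)) \<le> A * radial_profile DIM('a) (norm (x' - y)) + B" .
    have "\<bar>h y x\<bar> \<le> \<bar>H\<bar>" "\<bar>h y x'\<bar> \<le> \<bar>H\<bar>"
      using H[of x y] H[of x' y] x y x' E(2) by fastforce+
    moreover have "A * (- h y x') \<le> A * \<bar>H\<bar>"
      using AB(1) \<open>\<bar>h y x'\<bar> \<le> \<bar>H\<bar>\<close> by (intro mult_left_mono) auto
    ultimately have "g x y \<le> A * g x' y + C"
      using 1 unfolding g_def C_def by (simp add: algebra_simps)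
    then have "ennreal (g x y) \<le> ennreal (A * g x' y + C)" by (rule ennreal_leI)
    also have "\<dots> = ennreal A * ennreal (g x' y) + ennreal C"
      using AB C g_nonneg[OF O(3,2) False] by (simp add: ennreal_plus ennreal_mult)
    finally show ?thesis using O False \<open>x \<noteq> y\<close> by (simp add: k_def)
  qed
  have "\<exists>j\<ge>0. \<forall>x\<in>ball x0 r. tail j D x \<le> ennreal e" if e: "e > 0" for e
  proof -
    have "e / A > 0" using e AB by simp
    from tails[OF this] obtain j where j: "j \<ge> 0" "\<And>x. x \<in> E \<Longrightarrow> tail j D x \<le> ennreal (e / A)" by blast
    \<comment> \<open>This level turns the kernel comparison into
      \<open>k x y - (A * j + C) \<le> A * (k x' y - j)\<close>. The tail thus grows by the factor
      \<open>A\<close>, which is why accuracy \<open>e / A\<close> was requested on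
      \<open>E\<close>.\<close>
    have "tail (A * j + C) D x \<le> ennreal e" if x: "x \<in> ball x0 r" for x
    proof (cases "E = {}")
      case True
      then have "D = {}" using E by simp
      then show ?thesis by (simp add: tail_def)
    next
      case False
      obtain x' where x': "x' \<in> E" "\<And>y. y \<in> E \<Longrightarrow> dist x x' \<le> dist x y"
        using distance_attains_inf[OF E(1) False, of x] by blast
      have "tail (A * j + C) D x \<le> (\<integral>\<^sup>+ y. ennreal A * ((k x' y - ennreal j) * indicator D y) \<partial>M)"
        unfolding tail_def
      proof (intro nn_integral_mono)
        fix y
        show "(k x y - ennreal (A * j + C)) * indicator D y \<le> ennreal A * ((k x' y - ennreal j) * indicator D y)"
        proof (cases "y \<in> D")
          case True
          then have "y \<in> E" using E by auto
          have "k x' y \<le> (k x' y - ennreal j) + ennreal j"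
            using ennreal_minus_le_iff[of "k x' y" "ennreal j" "k x' y - ennreal j"] by (simp add: add.commute)
          then have "ennreal A * k x' y \<le> ennreal A * ((k x' y - ennreal j) + ennreal j)"
            by (rule mult_left_mono) simp
          then have "k x y \<le> ennreal A * ((k x' y - ennreal j) + ennreal j) + ennreal C"
            using kk[OF x \<open>y \<in> E\<close> x'(1) x'(2)[OF \<open>y \<in> E\<close>]] by (meson add_right_mono order_trans)
          also have "\<dots> = ennreal (A * j + C) + ennreal A * (k x' y - ennreal j)"
            using AB C j(1) by (simp add: distrib_left ennreal_plus ennreal_mult add_ac)
          finally show ?thesis using True by (simp add: ennreal_minus_le_iff)
        qed simp
      qed
      also have "\<dots> = ennreal A * tail j D x'"
        unfolding tail_def by (intro nn_integral_cmult) measurable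
      also have "\<dots> \<le> ennreal A * ennreal (e / A)"
        by (intro mult_left_mono j x') simp
      also have "\<dots> = ennreal e"
        using AB e by (simp add: ennreal_mult[symmetric])
      finally show ?thesis .
    qed
    then show ?thesis using AB C j by (intro exI[of _ "A * j + C"]) auto
  qed
  then show "\<exists>r>0. \<forall>e>0. \<exists>j\<ge>0. \<forall>x\<in>ball x0 r. tail j D x \<le> ennreal e"
    using r by blast
qed

lemma closed_tail_le:
  assumes L: "compact L" "L \<subseteq> \<Omega>" and [measurable]: "D \<in> sets borel"
  shows "closed {x \<in> L. tail j D x \<le> c}"
  unfolding closed_sequential_limits
proof (intro allI impI, elim conjE)
  fix X l assume X: "\<forall>n. X n \<in> {x \<in> L. tail j D x \<le> c}" and lim: "X \<longlonglongrightarrow> l"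
  then have "l \<in> L"
    using compact_imp_closed[OF L(1)] unfolding closed_sequential_limits by auto
  then have "tail j D l \<le> liminf (\<lambda>n. tail j D (X n))"
    using lim L by (intro tail_liminf) auto
  also have "\<dots> \<le> liminf (\<lambda>n. c)"
    using X by (intro Liminf_mono) auto
  also have "\<dots> = c" by (simp add: Liminf_const)
  finally show "l \<in> {x \<in> L. tail j D x \<le> c}" using \<open>l \<in> L\<close> by simp
qed

lemma tail_tendsto_0:
  assumes fin: "P D x < \<infinity>" and [measurable]: "D \<in> sets borel"
  shows "(\<lambda>n. tail (real n) D x) \<longlonglongrightarrow> 0"
proof -
  have ae: "AE y in M. k x y * indicator D y \<noteq> \<infinity>"
    using fin unfolding P_def by (intro nn_integral_PInf_AE) auto
  have "(\<lambda>n. \<integral>\<^sup>+ y\<in>D. (k x y - ennreal (real n)) \<partial>M) \<longlonglongrightarrow> (\<integral>\<^sup>+ y. 0 \<partial>M)"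
  proof (rule nn_integral_dominated_convergence[where w="\<lambda>y. k x y * indicator D y"])
    show "AE y in M. (\<lambda>n. (k x y - ennreal (real n)) * indicator D y) \<longlonglongrightarrow> 0"
      using ae
    proof eventually_elim
      case (elim y)
      show ?case
      proof (cases "y \<in> D")
        case True
        then obtain b where b: "b \<ge> 0" "k x y = ennreal b" using elim by (cases "k x y") auto
        have "eventually (\<lambda>n. (k x y - ennreal (real n)) * indicator D y = 0) sequentially"
          using eventually_ge_at_top[of "nat \<lceil>b\<rceil>"]
        proof eventually_elim
          case (elim n)
          then have "b \<le> real n" by linarith
          then show ?case using b by (simp add: ennreal_minus ennreal_neg)
        qed
        then show ?thesis by (rule tendsto_eventually)
      qed simp
    qed
    show "AE y in M. (k x y - ennreal (real n)) * indicator D y \<le> k x y * indicator D y" for n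
      by (intro AE_I2 mult_right_mono diff_le_self_ennreal) auto
  qed (use fin in \<open>auto simp: P_def\<close>)
  then show ?thesis by (simp add: tail_def)
qed

text \<open>Egorov's theorem for the tails, whose sublevel sets are closed by Fatou's lemma.\<close>

lemma large_subset_uniform_tails:
  assumes L: "compact L" "L \<subseteq> \<Omega>" and D[measurable]: "D \<in> sets borel" and "D \<subseteq> L"
    and fin: "\<And>x. x \<in> D \<Longrightarrow> P D x < \<infinity>" and e: "e > 0"
  obtains E where "E \<in> sets borel" "E \<subseteq> D" "uniform_tails E" "emeasure M (D - E) \<le> ennreal e"
proof -
  have [measurable]: "L \<in> sets borel" using L by (simp add: compact_imp_closed)
  have MD: "emeasure M D < \<infinity>" by (rule emeasure_finite_subset_compact[OF L \<open>D \<subseteq> L\<close>])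
  \<comment> \<open>The points where truncation at level \<open>j\<close> reaches accuracy
    \<open>1 / (i + 1)\<close>. For fixed \<open>i\<close> these sets increase with \<open>j\<close>
    and exhaust \<open>D\<close>, so some level leaves out only little mass.\<close>
  define B where "B i j = {x \<in> L. tail (real j) D x \<le> ennreal (1 / (real i + 1))}" for i j :: nat
  have closedB: "closed (B i j)" for i j
    unfolding B_def by (rule closed_tail_le[OF L D])
  then have [measurable]: "B i j \<in> sets borel" for i j by simp
  have "\<exists>j. emeasure M (D - B i j) \<le> ennreal (e * (1 / 2) ^ Suc i)" for i
  proof -
    have "(\<lambda>j. emeasure M (D - B i j)) \<longlonglongrightarrow> emeasure M (\<Inter>j. D - B i j)"
    proof (rule Lim_emeasure_decseq)
      show "decseq (\<lambda>j. D - B i j)"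
      proof (rule decseq_SucI)
        fix j
        have "tail (real (Suc j)) D x \<le> tail (real j) D x" for x
          by (rule tail_antimono) simp
        then show "D - B i (Suc j) \<le> D - B i j"
          by (auto simp: B_def dest: order_trans)
      qed
      fix j
      have "emeasure M (D - B i j) \<le> emeasure M D" by (intro emeasure_mono) auto
      then show "emeasure M (D - B i j) \<noteq> \<infinity>" using MD by (auto simp: less_top[symmetric] top_unique)
    qed auto
    moreover have "(\<Inter>j. D - B i j) = {}"
    proof -
      have "\<exists>j. x \<in> B i j" if "x \<in> D" for x
      proof -
        have "eventually (\<lambda>n. tail (real n) D x < ennreal (1 / (real i + 1))) sequentially"
          using tail_tendsto_0[OF fin[OF that] D] by (rule order_tendstoD(2)) simp
        then obtain n where "tail (real n) D x < ennreal (1 / (real i + 1))"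
          by (auto simp: eventually_sequentially)
        then show ?thesis using that \<open>D \<subseteq> L\<close> by (auto simp: B_def intro!: exI[of _ n])
      qed
      then show ?thesis by blast
    qed
    ultimately have "(\<lambda>j. emeasure M (D - B i j)) \<longlonglongrightarrow> 0" by (simp only: emeasure_empty)
    then have "eventually (\<lambda>j. emeasure M (D - B i j) < ennreal (e * (1 / 2) ^ Suc i)) sequentially"
      using e by (intro order_tendstoD(2)) auto
    then show ?thesis by (auto simp: eventually_sequentially intro: less_imp_le)
  qed
  then obtain J where J: "\<And>i. emeasure M (D - B i (J i)) \<le> ennreal (e * (1 / 2) ^ Suc i)" by metis
  \<comment> \<open>\<open>K\<close> is closed even if \<open>D\<close> is not. The tails of
    \<open>D\<close> are uniformly small on \<open>K\<close>, so the nearest point comparison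
    applies with \<open>K\<close> as the closed set carrying \<open>D \<inter> K\<close>.\<close>
  define K where "K = (\<Inter>i. B i (J i))"
  have K: "closed K" "K \<subseteq> L" unfolding K_def using closedB by (auto simp: B_def)
  then have [measurable]: "K \<in> sets borel" by simp
  show ?thesis
  proof (rule that)
    show "D \<inter> K \<in> sets borel" "D \<inter> K \<subseteq> D" by auto
    show "uniform_tails (D \<inter> K)"
    proof (rule uniform_tails_from_closed[OF L K])
      fix e' :: real assume "e' > 0"
      then obtain i where i: "1 / (real i + 1) < e'"
        using nat_approx_posE by (metis of_nat_Suc add.commute)
      have "tail (real (J i)) (D \<inter> K) x \<le> ennreal e'" if "x \<in> K" for x
      proof -
        have "tail (real (J i)) (D \<inter> K) x \<le> tail (real (J i)) D x" by (rule tail_mono) auto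
        also have "\<dots> \<le> ennreal (1 / (real i + 1))" using that by (auto simp: K_def B_def)
        also have "\<dots> \<le> ennreal e'" using i by (intro ennreal_leI) simp
        finally show ?thesis .
      qed
      then show "\<exists>j\<ge>0. \<forall>x\<in>K. tail j (D \<inter> K) x \<le> ennreal e'"
        by (intro exI[of _ "real (J i)"]) auto
    qed auto
    have "D - D \<inter> K = (\<Union>i. D - B i (J i))" by (auto simp: K_def)
    then have "emeasure M (D - D \<inter> K) \<le> (\<Sum>i. emeasure M (D - B i (J i)))"
      by (simp only:) (intro emeasure_subadditive_countably, auto)
    also have "\<dots> \<le> (\<Sum>i. ennreal (e * (1 / 2) ^ Suc i))"
      by (intro suminf_le J) auto
    also have "\<dots> = ennreal (e * 1)"
      using e by (intro suminf_ennreal_eq sums_mult power_half_series) auto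
    finally show "emeasure M (D - D \<inter> K) \<le> ennreal e" by simp
  qed
qed

section \<open>The maximum principle\<close>

lemma g_mean_value:
  assumes "cball z r \<subseteq> \<Omega> - {y}" "0 < r" "y \<in> \<Omega>"
  shows "(LINT x:ball z r|lborel. g x y) = measure lborel (ball z r) * g z y"
proof -
  have z: "cball z r \<subseteq> \<Omega>" "cball z r \<subseteq> - {y}" using assms(1) by auto
  have 1: "set_integrable lborel (ball z r) (h y)"
    by (rule set_integrable_ball_continuous[OF continuous_on_subset[OF continuous_on_h[OF assms(3)] z(1)]])
  have 2: "set_integrable lborel (ball z r) (\<lambda>x. radial_profile DIM('a) (norm (x - y)))"
    by (rule set_integrable_ball_continuous[OF continuous_on_subset[OF harmonic_on_continuous_on[OF
            harmonic_on_radial_profile[OF dim]] z(2)]])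
  show ?thesis
    unfolding g_def
    by (subst set_integral_add(2)[OF 2 1])
      (simp only: harmonic_on_mean_value[OF h_spec(1)[OF assms(3)] z(1) assms(2)]
        harmonic_on_mean_value[OF harmonic_on_radial_profile[OF dim] z(2) assms(2)] distrib_left)
qed

lemma k_mean_value:
  assumes "cball z r \<subseteq> \<Omega> - {y}" "0 < r" "y \<in> \<Omega>"
  shows "(\<integral>\<^sup>+ x\<in>ball z r. k x y \<partial>lborel) = emeasure lborel (ball z r) * k z y"
proof -
  have inb: "x \<in> \<Omega>" "x \<noteq> y" if "x \<in> ball z r" for x
  proof -
    have "x \<in> cball z r" using that by simp
    then show "x \<in> \<Omega>" "x \<noteq> y" using assms(1) by auto
  qed
  have z: "z \<in> ball z r" using assms(2) by simp
  have "continuous_on (cball z r) (\<lambda>x. g x y)"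
    using assms by (intro continuous_at_imp_continuous_on ballI isCont_g) auto
  then have int: "set_integrable lborel (ball z r) (\<lambda>x. g x y)"
    by (rule set_integrable_ball_continuous)
  have "(\<integral>\<^sup>+ x\<in>ball z r. k x y \<partial>lborel) = (\<integral>\<^sup>+ x. ennreal (indicator (ball z r) x *\<^sub>R g x y) \<partial>lborel)"
    using inb assms(3) by (intro nn_integral_cong) (auto simp: k_def indicator_def simp del: mem_ball)
  also have "\<dots> = ennreal (\<integral>x. indicator (ball z r) x *\<^sub>R g x y \<partial>lborel)"
    using int inb g_nonneg assms(3) unfolding set_integrable_def
    by (intro nn_integral_eq_integral AE_I2) (auto simp: indicator_def simp del: mem_ball)
  also have "(\<integral>x. indicator (ball z r) x *\<^sub>R g x y \<partial>lborel) = measure lborel (ball z r) * g z y"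
    using g_mean_value[OF assms] by (simp add: set_lebesgue_integral_def)
  also have "ennreal \<dots> = emeasure lborel (ball z r) * k z y"
    using inb[OF z] assms(3) g_nonneg[of z y] emeasure_lborel_ball_finite[of z r]
    by (simp add: k_def ennreal_mult emeasure_eq_ennreal_measure less_top)
  finally show ?thesis .
qed

lemma P_mean_value:
  assumes E[measurable]: "E \<in> sets borel" "emeasure M E < \<infinity>" "E \<subseteq> A" and A: "A \<subseteq> \<Omega>"
    and z: "cball z r \<subseteq> \<Omega> - A" "0 < r"
  shows "(\<integral>\<^sup>+ x\<in>ball z r. P E x \<partial>lborel) = emeasure lborel (ball z r) * P E z"
proof -
  \<comment> \<open>Nothing bounds \<open>M\<close> outside \<Omega>, so Fubini is applied to its
    restriction to \<open>E\<close>, a finite measure.\<close>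
  define N where "N = density M (indicator E)"
  have sets_N [measurable_cong]: "sets N = sets borel" by (simp add: N_def sets_M)
  have "emeasure N (space N) = emeasure M E"
    by (simp add: N_def emeasure_density space_density nn_integral_indicator flip: sets_eq_imp_space_eq[OF sets_M])
  then interpret N: finite_measure N
    using E(2) by (intro finite_measureI) (auto simp: less_top)
  interpret pair_sigma_finite lborel N ..
  have nn: "(\<integral>\<^sup>+ y. f y \<partial>N) = (\<integral>\<^sup>+ y\<in>E. f y \<partial>M)" if "f \<in> borel_measurable borel" for f
    unfolding N_def using that by (subst nn_integral_density) (auto simp: mult.commute)
  have [measurable]: "ball z r \<in> sets borel" by simp
  have "(\<integral>\<^sup>+ x\<in>ball z r. P E x \<partial>lborel) = (\<integral>\<^sup>+ x. (\<integral>\<^sup>+ y. k x y * indicator (ball z r) x \<partial>N) \<partial>lborel)"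
  proof (intro nn_integral_cong)
    fix x
    show "P E x * indicator (ball z r) x = (\<integral>\<^sup>+ y. k x y * indicator (ball z r) x \<partial>N)"
      unfolding P_def by (cases "x \<in> ball z r") (simp_all add: nn del: mem_ball)
  qed
  also have "\<dots> = (\<integral>\<^sup>+ y. (\<integral>\<^sup>+ x. k x y * indicator (ball z r) x \<partial>lborel) \<partial>N)"
    by (rule Fubini'[symmetric]) measurable
  also have "\<dots> = (\<integral>\<^sup>+ y\<in>E. (\<integral>\<^sup>+ x. k x y * indicator (ball z r) x \<partial>lborel) \<partial>M)"
    by (rule nn) measurable
  also have "\<dots> = (\<integral>\<^sup>+ y. emeasure lborel (ball z r) * (k z y * indicator E y) \<partial>M)"
  proof (intro nn_integral_cong)
    fix y
    show "(\<integral>\<^sup>+ x. k x y * indicator (ball z r) x \<partial>lborel) * indicator E y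
        = emeasure lborel (ball z r) * (k z y * indicator E y)"
    proof (cases "y \<in> E")
      case True
      then have "y \<in> A" "y \<in> \<Omega>" using E(3) A by auto
      then show ?thesis using k_mean_value[of z r y] z True by auto
    qed simp
  qed
  also have "\<dots> = emeasure lborel (ball z r) * P E z"
    unfolding P_def by (intro nn_integral_cmult) measurable
  finally show ?thesis .
qed

text \<open>Off a closed set carrying the measure, the potential inherits the mean value equality of
  the kernel. Hence its negative, which enters the competitor of the maximum principle, has the
  super-mean-value property.\<close>

lemma supermean_at_uminus_P:
  assumes ut: "uniform_tails E" and E[measurable]: "E \<in> sets borel" "emeasure M E < \<infinity>" "E \<subseteq> A"
    and A: "A \<subseteq> \<Omega>" "closed A" and z: "z \<in> \<Omega> - A"
  shows "supermean_at (\<lambda>x. - enn2real (P E x)) z"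
  unfolding supermean_at_def
proof -
  have op: "open (\<Omega> - A)" using open_dom A by auto
  show "\<forall>\<^sub>F r in at_right 0. set_integrable lborel (ball z r) (\<lambda>y. - enn2real (P E y)) \<and>
      (LINT y:ball z r|lborel. - enn2real (P E y)) \<le> measure lborel (ball z r) * (- enn2real (P E z))"
    using eventually_cball_subset[OF op z]
  proof eventually_elim
    case (elim r)
    then have r: "0 < r" "cball z r \<subseteq> \<Omega> - A" "cball z r \<subseteq> \<Omega>" by auto
    have fin: "P E x < \<infinity>" if "x \<in> ball z r" for x
    proof -
      have "x \<in> cball z r" using that by simp
      then show ?thesis using r by (intro P_finite[OF ut _ E(1,2)]) auto
    qed
    have c: "continuous_on (cball z r) (\<lambda>y. enn2real (P E y))"
      using r by (intro continuous_at_imp_continuous_on ballI isCont_P ut E) auto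
    have i: "set_integrable lborel (ball z r) (\<lambda>y. enn2real (P E y))"
      by (rule set_integrable_ball_continuous[OF c])
    have "ennreal (LINT y:ball z r|lborel. enn2real (P E y)) = (\<integral>\<^sup>+ y. ennreal (indicator (ball z r) y *\<^sub>R enn2real (P E y)) \<partial>lborel)"
      unfolding set_lebesgue_integral_def
      using i unfolding set_integrable_def by (intro nn_integral_eq_integral[symmetric]) auto
    also have "\<dots> = (\<integral>\<^sup>+ y\<in>ball z r. P E y \<partial>lborel)"
      using fin by (intro nn_integral_cong) (auto simp: indicator_def simp del: mem_ball)
    also have "\<dots> = emeasure lborel (ball z r) * P E z"
      by (rule P_mean_value[OF E A(1) r(2,1)])
    also have "\<dots> = ennreal (measure lborel (ball z r) * enn2real (P E z))"
      using fin[of z] r(1) emeasure_lborel_ball_finite[of z r]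
      by (simp add: ennreal_mult emeasure_eq_ennreal_measure less_top)
    finally have "(LINT y:ball z r|lborel. enn2real (P E y)) = measure lborel (ball z r) * enn2real (P E z)"
      by (subst (asm) ennreal_inj) (auto simp: set_lebesgue_integral_def intro!: Bochner_Integration.integral_nonneg)
    moreover have "(LINT y:ball z r|lborel. - enn2real (P E y)) = - (LINT y:ball z r|lborel. enn2real (P E y))"
      by (rule set_integral_uminus[OF i])
    moreover have "set_integrable lborel (ball z r) (\<lambda>y. - enn2real (P E y))"
      using c by (intro set_integrable_ball_continuous continuous_intros)
    ultimately show ?case by simp
  qed
qed

lemma g_lower_bound_compact:
  assumes "compact N" "N \<subseteq> \<Omega>" "y0 \<in> \<Omega>"
  obtains c where "c > 0" "\<And>x. x \<in> N \<Longrightarrow> x \<noteq> y0 \<Longrightarrow> c \<le> g x y0"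
proof -
  obtain d where d: "d > 0" "\<And>x. dist x y0 < d \<Longrightarrow> x \<noteq> y0 \<Longrightarrow> 1 < g x y0"
    using eventually_g_gt[OF assms(3), of 1] unfolding eventually_at by blast
  have cpt: "compact (N - ball y0 d)" using assms(1) by (intro compact_diff) auto
  have cont: "continuous_on (N - ball y0 d) (\<lambda>x. g x y0)"
    using assms d by (intro continuous_at_imp_continuous_on ballI isCont_g) auto
  obtain c where c: "c > 0" "\<And>x. x \<in> N - ball y0 d \<Longrightarrow> c \<le> g x y0"
  proof (cases "N - ball y0 d = {}")
    case True
    show ?thesis by (rule that[of 1]) (use True in auto)
  next
    case False
    obtain x1 where x1: "x1 \<in> N - ball y0 d" "\<And>x. x \<in> N - ball y0 d \<Longrightarrow> g x1 y0 \<le> g x y0"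
      using continuous_attains_inf[OF cpt False cont] by blast
    have "0 < g x1 y0" using x1(1) assms d by (intro g_pos) auto
    then show ?thesis using that x1 by blast
  qed
  show ?thesis
  proof (rule that[of "min 1 c"])
    fix x assume x: "x \<in> N" "x \<noteq> y0"
    show "min 1 c \<le> g x y0"
    proof (cases "dist x y0 < d")
      case True
      then show ?thesis using d(2)[OF True x(2)] by simp
    next
      case False
      then show ?thesis using c(2)[of x] x by (simp add: dist_commute min_le_iff_disj)
    qed
  qed (use c in auto)
qed

text \<open>\<open>w = max (P E - t) 0\<close> is subharmonic on \<open>\<Omega>\<close> and bounded by a multiple
  of \<open>g \<cdot> y0\<close>, so subtracting that multiple of \<open>w\<close> from \<open>h y0\<close> gives a competitor in the
  minimality of the Green function.\<close>

lemma P_le_if_P_le_on_carrier: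
  assumes ut: "uniform_tails E" and E[measurable]: "E \<in> sets borel" "E \<subseteq> A"
    and A: "compact A" "A \<subseteq> \<Omega>" and le: "\<And>x. x \<in> A \<Longrightarrow> P E x \<le> ennreal t" and t: "0 \<le> t"
    and x: "x \<in> \<Omega>"
  shows "P E x \<le> ennreal t"
proof (cases "A = {}")
  case True
  then have "E = {}" using E by auto
  then show ?thesis by (simp add: P_def)
next
  case False
  then obtain y0 where y0: "y0 \<in> A" by auto
  then have "y0 \<in> \<Omega>" using A by auto
  have clA: "closed A" by (rule compact_imp_closed[OF A(1)])
  then have [measurable]: "A \<in> sets borel" by simp
  have ME: "emeasure M E < \<infinity>" by (rule emeasure_finite_subset_compact[OF A E(2)])
  define p where "p z = enn2real (P E z)" for z
  have Pp: "P E z = ennreal (p z)" if "z \<in> \<Omega>" for z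
    using P_finite[OF ut that E(1) ME] by (simp add: p_def less_top)
  have p_cont: "isCont p z" if "z \<in> \<Omega>" for z
    unfolding p_def[abs_def] by (rule isCont_P[OF ut that E(1) ME])
  have p_A: "p z \<le> t" if "z \<in> A" for z
    using le[OF that] Pp[of z] that A(2) t by auto
  have p0: "0 \<le> p z" for z by (simp add: p_def)
  \<comment> \<open>The sign is reversed here: this is minus the excess
    \<open>max (p z - t) 0\<close>, so that it is superharmonic, as minimality requires of a
    competitor.\<close>
  define w where "w z = min (t - p z) 0" for z
  have w_cont: "continuous_on \<Omega> w"
    unfolding w_def by (intro continuous_at_imp_continuous_on ballI continuous_min continuous_intros p_cont)
  have w_super: "supermean_at w z" if z: "z \<in> \<Omega>" for z
  proof (cases "z \<in> A")
    case True
    then have "w z = 0" using p_A by (simp add: w_def)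
    then show ?thesis
      by (intro supermean_at_local_max[OF open_dom z w_cont]) (simp add: w_def)
  next
    case False
    then have "supermean_at (\<lambda>x. - p x) z"
      unfolding p_def using z by (intro supermean_at_uminus_P[OF ut E(1) ME E(2) A(2) clA]) auto
    then have "supermean_at (\<lambda>x. min (t + - p x) 0) z"
      by (intro supermean_at_min supermean_at_add supermean_at_const)
    then show ?thesis by (simp add: w_def[abs_def])
  qed
  obtain N where N: "compact N" "N \<subseteq> \<Omega>" "A \<subseteq> interior N"
  proof -
    obtain C :: "nat \<Rightarrow> 'a set" where C: "\<And>n. compact (C n)" "\<And>n. C n \<subseteq> \<Omega>" "\<And>n. C n \<subseteq> interior (C (Suc n))"
      "\<And>K. compact K \<Longrightarrow> K \<subseteq> \<Omega> \<Longrightarrow> \<exists>N. \<forall>n\<ge>N. K \<subseteq> C n"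
      using open_Union_compact_subsets[OF open_dom] by metis
    obtain n where "A \<subseteq> C n" using C(4)[OF A] by blast
    then show ?thesis using that[of "C (Suc n)"] C by blast
  qed
  obtain C where C: "0 < C" "\<And>x y. x \<in> \<Omega> - N \<Longrightarrow> y \<in> A \<Longrightarrow> g x y \<le> C * g x y0"
    using g_le_cmult_off_compact[OF A(1) N(3,1,2)] N(3) y0 by blast
  define m where "m = measure M E"
  have p_off: "p z \<le> C * m * g z y0" if z: "z \<in> \<Omega> - N" for z
  proof -
    have zy: "z \<noteq> y" if "y \<in> A" for y using N interior_subset z that by blast
    have g0: "0 \<le> g z y0" using z zy[OF y0] \<open>y0 \<in> \<Omega>\<close> by (intro g_nonneg) auto
    have "P E z \<le> (\<integral>\<^sup>+ y\<in>E. ennreal (C * g z y0) \<partial>M)"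
      unfolding P_def
    proof (intro nn_integral_mono)
      fix y
      show "k z y * indicator E y \<le> ennreal (C * g z y0) * indicator E y"
      proof (cases "y \<in> E")
        case True
        then have "y \<in> A" using E by auto
        then have "k z y \<le> ennreal (C * g z y0)"
          using C(2)[OF z] zy z A by (auto simp: k_def intro: ennreal_leI)
        then show ?thesis by (rule mult_right_mono) simp
      qed simp
    qed
    also have "\<dots> = ennreal (C * g z y0) * emeasure M E"
      by (simp add: nn_integral_cmult)
    also have "\<dots> = ennreal (C * m * g z y0)"
      using ME g0 C(1) by (simp add: m_def emeasure_eq_ennreal_measure less_top ennreal_mult[symmetric] mult_ac)
    finally show ?thesis
      using Pp[of z] z g0 C(1) by (auto simp: m_def)
  qed
  have "bounded (p ` N)"
    using N by (intro compact_imp_bounded compact_continuous_image continuous_at_imp_continuous_on ballI p_cont) auto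
  then obtain W where W: "\<And>z. z \<in> N \<Longrightarrow> p z \<le> W"
    by (metis (no_types, lifting) abs_le_D1 bounded_iff imageI real_norm_def)
  obtain c0 where c0: "c0 > 0" "\<And>x. x \<in> N \<Longrightarrow> x \<noteq> y0 \<Longrightarrow> c0 \<le> g x y0"
    using g_lower_bound_compact[OF N(1,2) \<open>y0 \<in> \<Omega>\<close>] by blast
  \<comment> \<open>\<open>C * m\<close> serves the points outside \<open>N\<close>, the quotient
    serves those in \<open>N\<close>, and the summand 1 makes \<open>c\<close> positive.\<close>
  define c where "c = C * m + \<bar>W\<bar> / c0 + 1"
  have c: "c > 0" using C c0 by (simp add: c_def m_def add_nonneg_pos)
  have dom: "- w z \<le> c * g z y0" if z: "z \<in> \<Omega>" "z \<noteq> y0" for z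
  proof -
    have g0: "0 \<le> g z y0" using z \<open>y0 \<in> \<Omega>\<close> by (intro g_nonneg)
    have Cm: "0 \<le> C * m" using C by (simp add: m_def)
    have "- w z \<le> p z" using t p0[of z] by (auto simp: w_def)
    also have "p z \<le> c * g z y0"
    proof (cases "z \<in> N")
      case True
      have "p z \<le> \<bar>W\<bar> / c0 * c0" using W[OF True] c0 by simp
      also have "\<dots> \<le> \<bar>W\<bar> / c0 * g z y0"
        using c0 True z by (intro mult_left_mono) auto
      also have "\<dots> \<le> c * g z y0"
        using Cm g0 by (intro mult_right_mono) (auto simp: c_def)
      finally show ?thesis .
    next
      case False
      then have "p z \<le> C * m * g z y0" using z by (intro p_off) auto
      also have "\<dots> \<le> c * g z y0"
        using c0 g0 by (intro mult_right_mono) (auto simp: c_def)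
      finally show ?thesis .
    qed
    finally show ?thesis .
  qed
  \<comment> \<open>The competitor for the pole \<open>y0\<close> is never above
    \<open>h y0\<close>, so minimality forces the nonpositive function \<open>w\<close> to vanish:
    there is no excess.\<close>
  have "h y0 x \<le> h y0 x + 1 / c * w x"
  proof (rule h_minimal[OF \<open>y0 \<in> \<Omega>\<close> _ _ _ x])
    show "continuous_on \<Omega> (\<lambda>x. h y0 x + 1 / c * w x)"
      by (intro continuous_intros continuous_on_h \<open>y0 \<in> \<Omega>\<close> w_cont)
    show "supermean_at (\<lambda>x. h y0 x + 1 / c * w x) z" if "z \<in> \<Omega>" for z
      using c that by (intro supermean_at_add supermean_at_cmult supermean_at_h \<open>y0 \<in> \<Omega>\<close> w_super) auto
    show "0 \<le> radial_profile DIM('a) (norm (z - y0)) + (h y0 z + 1 / c * w z)" if "z \<in> \<Omega>" "z \<noteq> y0" for z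
    proof -
      have "- w z / c \<le> g z y0" using dom[OF that] c by (simp only: pos_divide_le_eq mult.commute)
      then show ?thesis by (simp add: g_def)
    qed
  qed
  then have "0 \<le> w x" using c by (simp add: zero_le_divide_iff)
  then have "p x \<le> t" by (simp add: w_def)
  then show ?thesis using Pp[OF x] by (simp add: ennreal_leI)
qed

end

section \<open>The self-improving estimate\<close>

text \<open>Derivatives are asked for in the open interval because the weight
  \<open>t powr (s - 2)\<close> is singular at 0 when \<open>s < 2\<close>.\<close>

lemma nn_integral_FTC_interior:
  fixes F f :: "real \<Rightarrow> real"
  assumes "0 \<le> c" "continuous_on {0..c} F"
    and deriv: "\<And>t. 0 < t \<Longrightarrow> t < c \<Longrightarrow> (F has_real_derivative f t) (at t)"
    and nonneg: "\<And>t. 0 \<le> t \<Longrightarrow> t \<le> c \<Longrightarrow> 0 \<le> f t"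
    and [measurable]: "f \<in> borel_measurable borel"
  shows "(\<integral>\<^sup>+ t. ennreal (f t) * indicator {0..c} t \<partial>lborel) = ennreal (F c - F 0)"
proof -
  have "(f has_integral F c - F 0) {0..c}"
    using assms(1,2) deriv
    by (intro fundamental_theorem_of_calculus_interior) (auto simp: has_real_derivative_iff_has_vector_derivative[symmetric])
  then have "((\<lambda>t. if t \<in> {0..c} then f t else 0) has_integral F c - F 0) UNIV"
    by (simp only: has_integral_restrict_UNIV)
  moreover have "(\<lambda>t. if t \<in> {0..c} then f t else 0) = (\<lambda>t. f t * indicator {0..c} t)"
    by (auto simp: indicator_def)
  ultimately have "((\<lambda>t. f t * indicator {0..c} t) has_integral F c - F 0) UNIV" by simp
  then have "(\<integral>\<^sup>+ t. ennreal (f t * indicator {0..c} t) \<partial>lborel) = ennreal (F c - F 0)"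
    by (intro nn_integral_has_integral_lborel) (auto simp: indicator_def nonneg)
  moreover have "ennreal (f t * indicator {0..c} t) = ennreal (f t) * indicator {0..c} t" for t
    by (simp add: indicator_def)
  ultimately show ?thesis by simp
qed

lemma has_real_derivative_powr_pos:
  "0 < t \<Longrightarrow> ((\<lambda>t. t powr r) has_real_derivative r * t powr (r - 1)) (at t)"
  for t r :: real
  by (auto intro!: derivative_eq_intros)

lemma nn_integral_powr_layer:
  fixes s c :: real
  assumes "1 < s" "0 \<le> c"
  shows "(\<integral>\<^sup>+ t. ennreal ((s - 1) * t powr (s - 2)) * indicator {0..c} t \<partial>lborel) = ennreal (c powr (s - 1))"
proof -
  have "(\<integral>\<^sup>+ t. ennreal ((s - 1) * t powr (s - 2)) * indicator {0..c} t \<partial>lborel)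
      = ennreal (c powr (s - 1) - 0 powr (s - 1))"
  proof (rule nn_integral_FTC_interior)
    show "continuous_on {0..c} (\<lambda>t. t powr (s - 1))"
      using assms by (intro continuous_on_powr' continuous_intros) auto
    show "((\<lambda>t. t powr (s - 1)) has_real_derivative (s - 1) * t powr (s - 2)) (at t)" if "0 < t" "t < c" for t
      using has_real_derivative_powr_pos[OF that(1), of "s - 1"] by (simp add: algebra_simps)
  qed (use assms in auto)
  then show ?thesis by simp
qed

text \<open>The weight is the derivative of \<open>t powr (s - 1)\<close>. The value
  \<open>a powr s / s\<close> is the source of the factor \<open>s\<close> in the layer cake
  inequality.\<close>

lemma nn_integral_powr_layer_weighted:
  fixes s a :: real
  assumes "1 < s" "0 \<le> a"
  shows "(\<integral>\<^sup>+ t. ennreal ((s - 1) * t powr (s - 2) * (a - t)) * indicator {0..a} t \<partial>lborel) = ennreal (a powr s / s)"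
proof -
  define F where "F t = a * t powr (s - 1) - (s - 1) / s * t powr s" for t
  have "(\<integral>\<^sup>+ t. ennreal ((s - 1) * t powr (s - 2) * (a - t)) * indicator {0..a} t \<partial>lborel) = ennreal (F a - F 0)"
  proof (rule nn_integral_FTC_interior)
    show "continuous_on {0..a} F"
      unfolding F_def using assms by (intro continuous_intros continuous_on_powr') auto
    show "(F has_real_derivative (s - 1) * t powr (s - 2) * (a - t)) (at t)" if "0 < t" "t < a" for t
    proof -
      have d: "(F has_real_derivative a * ((s - 1) * t powr (s - 1 - 1)) - (s - 1) / s * (s * t powr (s - 1))) (at t)"
        unfolding F_def by (intro DERIV_diff DERIV_cmult has_real_derivative_powr_pos that)
      have "t powr (s - 1) = t powr (s - 2) * t"
        using that powr_add[of t "s - 2" 1] by simp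
      moreover have "(s - 1) / s * (s * X) = (s - 1) * X" for X using assms by simp
      ultimately have "a * ((s - 1) * t powr (s - 1 - 1)) - (s - 1) / s * (s * t powr (s - 1))
          = a * ((s - 1) * t powr (s - 2)) - (s - 1) * (t powr (s - 2) * t)"
        by (simp only: diff_diff_eq one_add_one)
      also have "\<dots> = (s - 1) * t powr (s - 2) * (a - t)" by (simp add: algebra_simps)
      finally show ?thesis using d by (simp only:)
    qed
  qed (use assms in auto)
  moreover have "F a - F 0 = a powr s / s"
  proof (cases "a = 0")
    case False
    then have "a powr s = a * a powr (s - 1)"
      using assms powr_add[of a 1 "s - 1"] by simp
    then show ?thesis using assms by (simp add: F_def field_simps)
  qed (simp add: F_def)
  ultimately show ?thesis by simp
qed

text \<open>With total mass \<open>a\<close>, the set \<open>{p \<ge> t}\<close> has mass at least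
  \<open>a - t\<close>. Multiply by the weight \<open>(s - 1) * t powr (s - 2)\<close>, integrate
  over \<open>t\<close> in \<open>{0..a}\<close> and exchange the integrals. In the application the
  total mass is the value of a potential at a point.\<close>

lemma (in finite_measure) powr_measure_le_nn_integral_powr:
  fixes p :: "'a \<Rightarrow> real"
  assumes [measurable]: "p \<in> borel_measurable M" and p0: "\<And>y. 0 \<le> p y"
    and sub: "\<And>t. 0 \<le> t \<Longrightarrow> emeasure M {y \<in> space M. p y \<le> t} \<le> ennreal t" and s: "1 < s"
  shows "ennreal (measure M (space M) powr s) \<le> ennreal s * (\<integral>\<^sup>+ y. ennreal (p y powr (s - 1)) \<partial>M)"
proof -
  define a where "a = measure M (space M)"
  have a0: "0 \<le> a" by (simp add: a_def)
  interpret pair_sigma_finite M lborel ..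
  define c where "c t = (s - 1) * t powr (s - 2)" for t
  have c0: "0 \<le> c t" for t using s by (simp add: c_def)
  have [measurable]: "c \<in> borel_measurable borel" unfolding c_def by measurable
  have "ennreal (a powr s / s) = (\<integral>\<^sup>+ t. ennreal (c t * (a - t)) * indicator {0..a} t \<partial>lborel)"
    using nn_integral_powr_layer_weighted[OF s a0] by (simp add: c_def)
  also have "\<dots> \<le> (\<integral>\<^sup>+ t. (\<integral>\<^sup>+ y. ennreal (c t) * indicator {0..p y} t \<partial>M) \<partial>lborel)"
  proof (intro nn_integral_mono)
    fix t
    show "ennreal (c t * (a - t)) * indicator {0..a} t \<le> (\<integral>\<^sup>+ y. ennreal (c t) * indicator {0..p y} t \<partial>M)"
    proof (cases "t \<in> {0..a}")
      case True
      have "ennreal a = emeasure M (space M)" by (simp add: a_def emeasure_eq_measure)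
      also have "space M = {y \<in> space M. p y \<le> t} \<union> {y \<in> space M. t \<le> p y}" by auto
      also have "emeasure M \<dots> \<le> emeasure M {y \<in> space M. p y \<le> t} + emeasure M {y \<in> space M. t \<le> p y}"
        by (intro emeasure_subadditive) measurable
      also have "\<dots> \<le> ennreal t + emeasure M {y \<in> space M. t \<le> p y}"
        using True by (intro add_right_mono sub) auto
      finally have "ennreal (a - t) \<le> emeasure M {y \<in> space M. t \<le> p y}"
        using True by (simp add: ennreal_minus_le_iff flip: ennreal_minus)
      then have "ennreal (c t) * ennreal (a - t) \<le> ennreal (c t) * emeasure M {y \<in> space M. t \<le> p y}"
        by (rule mult_left_mono) simp
      also have "\<dots> = (\<integral>\<^sup>+ y. ennreal (c t) * indicator {y \<in> space M. t \<le> p y} y \<partial>M)"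
        by (intro nn_integral_cmult_indicator[symmetric]) measurable
      also have "\<dots> = (\<integral>\<^sup>+ y. ennreal (c t) * indicator {0..p y} t \<partial>M)"
        using True by (intro nn_integral_cong) (auto simp: indicator_def)
      finally show ?thesis using True c0 by (simp add: ennreal_mult')
    qed simp
  qed
  also have "\<dots> = (\<integral>\<^sup>+ y. (\<integral>\<^sup>+ t. ennreal (c t) * indicator {0..p y} t \<partial>lborel) \<partial>M)"
    by (rule Fubini') (simp add: indicator_def)
  also have "\<dots> = (\<integral>\<^sup>+ y. ennreal (p y powr (s - 1)) \<partial>M)"
    unfolding c_def by (intro nn_integral_cong nn_integral_powr_layer s p0)
  finally have "ennreal s * ennreal (a powr s / s) \<le> ennreal s * (\<integral>\<^sup>+ y. ennreal (p y powr (s - 1)) \<partial>M)"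
    by (rule mult_left_mono) simp
  moreover have "ennreal s * ennreal (a powr s / s) = ennreal (a powr s)"
    using s by (simp add: ennreal_mult[symmetric])
  ultimately show ?thesis by (simp add: a_def)
qed

section \<open>The layer cake inequality for potentials and its iteration\<close>

context green_potential
begin

text \<open>Finite unions of the sets supplied by the Egorov argument form an increasing sequence
  that exhausts \<open>D\<close> up to a null set and still has uniform tails. Monotone convergence
  then carries the common bound \<open>b\<close> over to \<open>D\<close>.\<close>

lemma P_le_from_uniform_tails:
  assumes L: "compact L" "L \<subseteq> \<Omega>" and D[measurable]: "D \<in> sets borel" and "D \<subseteq> L"
    and fin: "\<And>x. x \<in> D \<Longrightarrow> P D x < \<infinity>"
    and bound: "\<And>E. E \<in> sets borel \<Longrightarrow> E \<subseteq> D \<Longrightarrow> uniform_tails E \<Longrightarrow> P E x \<le> b"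
  shows "P D x \<le> b"
proof -
  have "\<exists>E. E \<in> sets borel \<and> E \<subseteq> D \<and> uniform_tails E \<and> emeasure M (D - E) \<le> ennreal (inverse (real (Suc n)))" for n
    using large_subset_uniform_tails[OF L D \<open>D \<subseteq> L\<close> fin, of "inverse (real (Suc n))"]
    by (metis inverse_positive_iff_positive of_nat_0_less_iff zero_less_Suc)
  then obtain E where E[measurable]: "\<And>n. E n \<in> sets borel" and E': "\<And>n. E n \<subseteq> D" "\<And>n. uniform_tails (E n)"
    "\<And>n. emeasure M (D - E n) \<le> ennreal (inverse (real (Suc n)))" by metis
  define F where "F n = (\<Union>i\<le>n. E i)" for n
  have [measurable]: "F n \<in> sets borel" for n unfolding F_def by measurable
  have FD: "F n \<subseteq> D" for n using E' by (auto simp: F_def)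
  have "uniform_tails (F n)" for n
  proof (induction n)
    case (Suc n)
    have "F (Suc n) = F n \<union> E (Suc n)" by (auto simp: F_def atMost_Suc)
    then show ?case using Suc E' by (simp add: uniform_tails_Un)
  qed (simp add: F_def E')
  then have PF: "P (F n) x \<le> b" for n by (intro bound FD) auto
  define V where "V = (\<Union>n. F n)"
  have [measurable]: "V \<in> sets borel" unfolding V_def by measurable
  have "emeasure M (D - V) \<le> ennreal (inverse (real (Suc n)))" for n
  proof -
    have "emeasure M (D - V) \<le> emeasure M (D - E n)"
      by (intro emeasure_mono) (auto simp: V_def F_def)
    then show ?thesis using E'(3)[of n] by (rule order_trans)
  qed
  moreover have "(\<lambda>n. ennreal (inverse (real (Suc n)))) \<longlonglongrightarrow> ennreal 0"
    by (intro tendsto_ennrealI LIMSEQ_inverse_real_of_nat)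
  ultimately have "emeasure M (D - V) \<le> ennreal 0"
    by (intro tendsto_lowerbound[of _ _ sequentially]) auto
  then have "D - V \<in> null_sets M" by (auto simp: null_sets_def)
  then have "AE y in M. y \<notin> D - V" by (rule AE_not_in)
  then have "AE y in M. k x y * indicator D y = k x y * indicator V y"
    by (rule AE_mp) (use FD in \<open>auto simp: V_def indicator_def\<close>)
  then have "P D x = P V x"
    unfolding P_def by (rule nn_integral_cong_AE)
  also have "P V x = (\<integral>\<^sup>+ y. (SUP n. k x y * indicator (F n) y) \<partial>M)"
    unfolding P_def
  proof (intro nn_integral_cong)
    fix y
    show "k x y * indicator V y = (SUP n. k x y * indicator (F n) y)"
    proof (cases "y \<in> V")
      case True
      then obtain n where n: "y \<in> F n" by (auto simp: V_def)
      have "(SUP n. k x y * indicator (F n) y) = k x y"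
      proof (rule antisym)
        show "(SUP n. k x y * indicator (F n) y) \<le> k x y"
          by (intro SUP_least) (auto simp: indicator_def)
        show "k x y \<le> (SUP n. k x y * indicator (F n) y)"
          using n by (intro SUP_upper2[of n]) auto
      qed
      then show ?thesis using True by simp
    qed (auto simp: V_def)
  qed
  also have "\<dots> = (SUP n. P (F n) x)"
    unfolding P_def
  proof (rule nn_integral_monotone_convergence_SUP)
    show "incseq (\<lambda>n y. k x y * indicator (F n) y)"
      by (intro incseq_SucI le_funI mult_left_mono) (auto simp: F_def indicator_def)
  qed measurable
  also have "\<dots> \<le> b" by (intro SUP_least PF)
  finally show ?thesis .
qed

lemma measurable_enn2real_P:
  assumes "uniform_tails E" "E \<in> sets borel" "emeasure M E < \<infinity>"
  shows "(\<lambda>x. enn2real (P E x)) \<in> borel_measurable borel"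
proof -
  have "continuous_on \<Omega> (\<lambda>x. enn2real (P E x))"
    by (intro continuous_at_imp_continuous_on ballI isCont_P assms)
  then have "(\<lambda>x. indicator \<Omega> x *\<^sub>R enn2real (P E x)) \<in> borel_measurable borel"
    by (intro borel_measurable_continuous_on_indicator) auto
  moreover have "(\<lambda>x. indicator \<Omega> x *\<^sub>R enn2real (P E x)) = (\<lambda>x. enn2real (P E x))"
    by (auto simp: P_def k_def indicator_def fun_eq_iff)
  ultimately show ?thesis by simp
qed

text \<open>The finite measure lemma is applied to \<open>N\<close>, the restriction of
  \<open>M\<close> to \<open>E\<close> weighted by the kernel from \<open>x\<close>. Its mass on
  \<open>{p \<le> t}\<close> is the value at \<open>x\<close> of the potential of
  \<open>E \<inter> {y. p y \<le> t}\<close>, which the maximum principle bounds by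
  \<open>t\<close>.\<close>

lemma powr_P_le:
  assumes ut: "uniform_tails E" and E[measurable]: "E \<in> sets borel" "E \<subseteq> L"
    and L: "compact L" "L \<subseteq> \<Omega>" and x: "x \<in> \<Omega>" and s: "1 < s"
  shows "ennreal (enn2real (P E x) powr s)
    \<le> ennreal s * (\<integral>\<^sup>+ y\<in>E. k x y * ennreal (enn2real (P E y) powr (s - 1)) \<partial>M)"
proof -
  have [measurable]: "L \<in> sets borel" using L by (simp add: compact_imp_closed)
  have ME: "emeasure M E < \<infinity>" by (rule emeasure_finite_subset_compact[OF L E(2)])
  define p where "p z = enn2real (P E z)" for z
  have pc: "continuous_on \<Omega> p"
    unfolding p_def by (intro continuous_at_imp_continuous_on ballI isCont_P ut E ME)
  have [measurable]: "p \<in> borel_measurable borel"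
    unfolding p_def by (rule measurable_enn2real_P[OF ut E(1) ME])
  define N where "N = density M (\<lambda>y. k x y * indicator E y)"
  have sN [measurable_cong]: "sets N = sets borel" by (simp add: N_def sets_M)
  have spN: "space N = UNIV" using sets_eq_imp_space_eq[OF sN] by simp
  have emN: "emeasure N S = P (E \<inter> S) x" if [measurable]: "S \<in> sets borel" for S
    unfolding N_def P_def by (subst emeasure_density) (auto intro!: nn_integral_cong simp: indicator_def)
  have total: "emeasure N (space N) = P E x" by (simp add: spN emN)
  have PEfin: "P E x < \<infinity>" by (rule P_finite[OF ut x E(1) ME])
  interpret N: finite_measure N
    using PEfin by (intro finite_measureI) (simp add: total less_top)
  have "ennreal (measure N (space N) powr s) \<le> ennreal s * (\<integral>\<^sup>+ y. ennreal (p y powr (s - 1)) \<partial>N)"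
  proof (rule N.powr_measure_le_nn_integral_powr[OF _ _ _ s])
    fix t :: real assume t: "0 \<le> t"
    \<comment> \<open>Continuity of \<open>p\<close> makes this a compact carrier, on which the
      potential of the smaller set is at most \<open>p\<close> and hence at most
      \<open>t\<close>.\<close>
    define A where "A = {z \<in> L. p z \<le> t}"
    have "continuous_on L p" using pc L(2) by (rule continuous_on_subset)
    then have "closedin (top_of_set L) (L \<inter> p -` {..t})"
      by (intro continuous_closedin_preimage) auto
    then have "compact (L \<inter> p -` {..t})"
      using L(1) closedin_compact by blast
    then have A: "compact A" by (simp add: A_def vimage_def Int_def)
    have [measurable]: "{y. p y \<le> t} \<in> sets borel" by measurable
    have "P (E \<inter> {y. p y \<le> t}) x \<le> ennreal t"
    proof (rule P_le_if_P_le_on_carrier[OF _ _ _ A _ _ t x])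
      show "uniform_tails (E \<inter> {y. p y \<le> t})" by (rule uniform_tails_subset[OF ut]) auto
      show "A \<subseteq> \<Omega>" "E \<inter> {y. p y \<le> t} \<subseteq> A" using L E by (auto simp: A_def)
      fix z assume z: "z \<in> A"
      have "P (E \<inter> {y. p y \<le> t}) z \<le> P E z" by (rule P_mono) auto
      also have "\<dots> = ennreal (p z)"
        using P_finite[OF ut _ E(1) ME, of z] z L(2) by (auto simp: A_def p_def less_top)
      also have "\<dots> \<le> ennreal t" using z by (intro ennreal_leI) (simp add: A_def)
      finally show "P (E \<inter> {y. p y \<le> t}) z \<le> ennreal t" .
    qed measurable
    then show "emeasure N {y \<in> space N. p y \<le> t} \<le> ennreal t"
      by (simp add: spN emN)
  next
    show "p \<in> borel_measurable N" by measurable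
    show "0 \<le> p y" for y by (simp add: p_def)
  qed
  also have "(\<integral>\<^sup>+ y. ennreal (p y powr (s - 1)) \<partial>N) = (\<integral>\<^sup>+ y\<in>E. k x y * ennreal (p y powr (s - 1)) \<partial>M)"
    unfolding N_def by (subst nn_integral_density) (auto intro!: nn_integral_cong simp: indicator_def)
  finally show ?thesis by (simp add: measure_def total p_def)
qed

lemma powr_P_le_potential_on:
  assumes q: "0 < q" "q < 1" and [measurable]: "u \<in> borel_measurable borel"
    and u_pos: "\<And>y. y \<in> \<Omega> \<Longrightarrow> 0 < u y" and u_le: "\<And>y. y \<in> \<Omega> \<Longrightarrow> u y \<le> B"
    and super: "\<And>y. y \<in> \<Omega> \<Longrightarrow> (\<integral>\<^sup>+ z. k y z * ennreal (u z powr q) \<partial>M) \<le> ennreal (u y)"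
    and ut: "uniform_tails E" and E[measurable]: "E \<in> sets borel" "E \<subseteq> L" and L: "compact L" "L \<subseteq> \<Omega>"
    and a: "0 < a" "\<And>y. y \<in> E \<Longrightarrow> a \<le> u y" and x: "x \<in> \<Omega>"
  shows "ennreal ((1 - q) powr (1 / (1 - q)) * enn2real (P E x) powr (1 / (1 - q)))
    \<le> (\<integral>\<^sup>+ y. k x y * ennreal (u y powr q) \<partial>M)"
proof -
  have [measurable]: "L \<in> sets borel" using L by (simp add: compact_imp_closed)
  have ME: "emeasure M E < \<infinity>" by (rule emeasure_finite_subset_compact[OF L E(2)])
  define s where "s = 1 / (1 - q)"
  have s: "1 < s" "s * q = s - 1" "1 / s = 1 - q" "s > 0"
    using q by (auto simp: s_def field_simps)
  define p where "p z = enn2real (P E z)" for z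
  define U where "U x = (\<integral>\<^sup>+ y. k x y * ennreal (u y powr q) \<partial>M)" for x
  have Pp: "P E z = ennreal (p z)" if "z \<in> \<Omega>" for z
    using P_finite[OF ut that E(1) ME] by (simp add: p_def less_top)
  have p0: "0 \<le> p z" for z by (simp add: p_def)
  have U_ge: "ennreal c * (\<integral>\<^sup>+ y\<in>E. k x y * ennreal (v y) \<partial>M) \<le> U x"
    if "\<And>y. y \<in> E \<Longrightarrow> c * v y \<le> u y powr q" "0 \<le> c" and [measurable]: "(\<lambda>y. ennreal (v y) * indicator E y) \<in> borel_measurable borel" for c v x
  proof -
    have "ennreal c * (\<integral>\<^sup>+ y\<in>E. k x y * ennreal (v y) \<partial>M) = (\<integral>\<^sup>+ y. ennreal c * (k x y * (ennreal (v y) * indicator E y)) \<partial>M)"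
      by (subst nn_integral_cmult) (auto simp: mult.assoc)
    also have "\<dots> \<le> U x"
      unfolding U_def
    proof (intro nn_integral_mono)
      fix y
      show "ennreal c * (k x y * (ennreal (v y) * indicator E y)) \<le> k x y * ennreal (u y powr q)"
      proof (cases "y \<in> E")
        case True
        have "k x y * (ennreal c * ennreal (v y)) \<le> k x y * ennreal (u y powr q)"
          using that(1)[OF True] that(2) by (intro mult_left_mono) (auto simp: ennreal_mult'[symmetric] intro: ennreal_leI)
        then show ?thesis using True by (simp add: mult_ac)
      qed simp
    qed
    finally show ?thesis .
  qed
  have [measurable]: "p \<in> borel_measurable borel"
    unfolding p_def by (rule measurable_enn2real_P[OF ut E(1) ME])
  \<comment> \<open>The induction runs on lower bounds for \<open>U\<close>, since
    \<open>super\<close> turns each of them into one for \<open>u\<close>. That \<open>U\<close>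
    stays below \<open>u\<close> is all that is required of the solution here.\<close>
  have step: "ennreal ((c powr q * (1 - q)) * p x powr s) \<le> U x"
    if c: "0 < c" "\<And>x. x \<in> \<Omega> \<Longrightarrow> ennreal (c * p x powr s) \<le> U x" and x: "x \<in> \<Omega>" for c x
  proof -
    have le: "c powr q * p y powr (s - 1) \<le> u y powr q" if "y \<in> E" for y
    proof -
      have y: "y \<in> \<Omega>" using that E L by auto
      have "ennreal (c * p y powr s) \<le> ennreal (u y)"
        using c(2)[OF y] super[OF y] unfolding U_def by (rule order_trans)
      then have "c * p y powr s \<le> u y" using u_pos[OF y] by simp
      then have "(c * p y powr s) powr q \<le> u y powr q"
        using c q by (intro powr_mono2) auto
      moreover have "(c * p y powr s) powr q = c powr q * p y powr (s - 1)"
        using c by (simp add: powr_mult powr_powr s(2))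
      ultimately show ?thesis by simp
    qed
    have "ennreal ((c powr q * (1 - q)) * p x powr s) = ennreal (c powr q) * (ennreal (1 - q) * ennreal (p x powr s))"
      using q by (simp add: ennreal_mult mult.assoc)
    also have "\<dots> \<le> ennreal (c powr q) * (ennreal (1 - q) * (ennreal s * (\<integral>\<^sup>+ y\<in>E. k x y * ennreal (p y powr (s - 1)) \<partial>M)))"
      unfolding p_def using s(1) by (intro mult_left_mono powr_P_le[OF ut E L x]) auto
    also have "\<dots> = ennreal (c powr q) * ((ennreal (1 - q) * ennreal s) * (\<integral>\<^sup>+ y\<in>E. k x y * ennreal (p y powr (s - 1)) \<partial>M))"
      by (simp add: mult.assoc)
    also have "ennreal (1 - q) * ennreal s = 1"
      using q s(3,4) by (simp add: ennreal_mult[symmetric] field_simps)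
    also have "ennreal (c powr q) * (1 * (\<integral>\<^sup>+ y\<in>E. k x y * ennreal (p y powr (s - 1)) \<partial>M)) \<le> U x"
      by (simp only: mult_1_left) (rule U_ge, use le in auto)
    finally show ?thesis .
  qed
  \<comment> \<open>A bound for \<open>p\<close>, because
    \<open>a powr q * p y \<le> U y \<le> u y \<le> B\<close>. The maximum with 1 keeps it
    positive.\<close>
  define b where "b = max 1 (B / a powr q)"
  have b: "b > 0" by (simp add: b_def)
  have aP: "ennreal (a powr q * p y) \<le> U y" if y: "y \<in> \<Omega>" for y
  proof -
    have "ennreal (a powr q * p y) = ennreal (a powr q) * (\<integral>\<^sup>+ z\<in>E. k y z * ennreal 1 \<partial>M)"
      using p0[of y] Pp[OF y] by (simp add: ennreal_mult P_def)
    also have "\<dots> \<le> U y"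
      using a q by (intro U_ge) (auto intro!: powr_mono2)
    finally show ?thesis .
  qed
  have p_le: "p y \<le> b" if y: "y \<in> \<Omega>" for y
  proof -
    have "ennreal (a powr q * p y) \<le> ennreal (u y)"
      using aP[OF y] super[OF y] unfolding U_def by (rule order_trans)
    then have "a powr q * p y \<le> B" using u_pos[OF y] u_le[OF y] by simp
    then have "p y \<le> B / a powr q" using a(1) by (simp add: pos_le_divide_eq mult.commute)
    then show ?thesis by (simp add: b_def)
  qed
  define c1 where "c1 = (1 - q) powr s"
  \<comment> \<open>Since \<open>p \<le> b\<close> and \<open>p powr s = p * p powr (s - 1)\<close>,
    this choice gives \<open>c0 * p powr s \<le> a powr q * p\<close>, which is at most
    \<open>U\<close>.\<close>
  define c0 where "c0 = a powr q / b powr (s - 1)"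
  have c: "c0 > 0" "c1 > 0" using a b q by (auto simp: c0_def c1_def)
  \<comment> \<open>the solution of \<open>c (Suc n) = c n powr q * (1 - q)\<close> with \<open>c 0 = c0\<close>\<close>
  define c where "c n = c1 * (c0 / c1) powr (q ^ n)" for n :: nat
  have c_pos: "c n > 0" for n using c by (simp add: c_def)
  have "\<forall>x\<in>\<Omega>. ennreal (c n * p x powr s) \<le> U x" for n
  proof (induction n)
    case 0
    show ?case
    proof
      fix x assume x: "x \<in> \<Omega>"
      have "p x powr s = p x * p x powr (s - 1)"
        using p0[of x] powr_add[of "p x" 1 "s - 1"] by (cases "p x = 0") auto
      also have "\<dots> \<le> p x * b powr (s - 1)"
        using p0[of x] p_le[OF x] s by (intro mult_left_mono powr_mono2) auto
      finally have "c0 * p x powr s \<le> c0 * (p x * b powr (s - 1))"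
        using c by (intro mult_left_mono) auto
      also have "\<dots> = a powr q * p x" using b by (simp add: c0_def)
      finally have "c 0 * p x powr s \<le> a powr q * p x" using c by (simp add: c_def)
      then show "ennreal (c 0 * p x powr s) \<le> U x"
        using aP[OF x] ennreal_leI order_trans by blast
    qed
  next
    case (Suc n)
    have "c n powr q = c1 powr q * (c0 / c1) powr (q ^ Suc n)"
      using c by (simp add: c_def powr_mult powr_powr mult.commute)
    moreover have "c1 powr q * (1 - q) = c1"
    proof -
      have "c1 powr q * (1 - q) = (1 - q) powr (s - 1) * (1 - q) powr 1"
        using q by (simp add: c1_def powr_powr s(2))
      also have "\<dots> = c1" by (simp only: c1_def powr_add[symmetric] diff_add_cancel)
      finally show ?thesis .
    qed
    ultimately have "c n powr q * (1 - q) = c (Suc n)"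
      by (simp add: c_def mult_ac)
    then show ?case using step[OF c_pos, of n] Suc by auto
  qed
  then have "ennreal (c n * p x powr s) \<le> U x" for n using x by blast
  \<comment> \<open>As \<open>q ^ n\<close> tends to 0, the trace
    \<open>(c0 / c1) powr (q ^ n)\<close> of the starting constant tends to 1.\<close>
  moreover have "(\<lambda>n. ennreal (c n * p x powr s)) \<longlonglongrightarrow> ennreal (c1 * (c0 / c1) powr 0 * p x powr s)"
    unfolding c_def using c q by (intro tendsto_intros LIMSEQ_power_zero) auto
  ultimately have "ennreal (c1 * (c0 / c1) powr 0 * p x powr s) \<le> U x"
    by (intro tendsto_upperbound[of _ _ sequentially]) auto
  then show ?thesis using c by (simp add: U_def c1_def p_def s_def)
qed

lemma powr_potential_le_potential:
  assumes q: "0 < q" "q < 1" and [measurable]: "u \<in> borel_measurable borel"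
    and u_pos: "\<And>y. y \<in> \<Omega> \<Longrightarrow> 0 < u y" and u_le: "\<And>y. y \<in> \<Omega> \<Longrightarrow> u y \<le> B"
    and super: "\<And>y. y \<in> \<Omega> \<Longrightarrow> (\<integral>\<^sup>+ z. k y z * ennreal (u z powr q) \<partial>M) \<le> ennreal (u y)"
    and x: "x \<in> \<Omega>"
  shows "(\<integral>\<^sup>+ y. k x y \<partial>M) < \<infinity>"
    and "(1 - q) powr (1 / (1 - q)) * enn2real (\<integral>\<^sup>+ y. k x y \<partial>M) powr (1 / (1 - q))
      \<le> enn2real (\<integral>\<^sup>+ y. k x y * ennreal (u y powr q) \<partial>M)"
proof -
  define s where "s = 1 / (1 - q)"
  define c1 where "c1 = (1 - q) powr s"
  define U where "U x = (\<integral>\<^sup>+ y. k x y * ennreal (u y powr q) \<partial>M)" for x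
  have s: "s > 0" using q by (simp add: s_def)
  have c1: "c1 > 0" using q by (simp add: c1_def)
  have Ufin: "U y < \<infinity>" if "y \<in> \<Omega>" for y
    using super[OF that] by (auto simp: U_def intro: le_less_trans)
  \<comment> \<open>The solution of \<open>c1 * r powr s = U x\<close>. Read as an upper bound for
    the potential, the estimate passes to the supremum over the exhausting sets and yields
    finiteness at the same time.\<close>
  define r where "r = (enn2real (U x) / c1) powr (1 / s)"
  have r: "r \<ge> 0" by (simp add: r_def)
  obtain C :: "nat \<Rightarrow> 'a set" where C: "\<And>n. compact (C n)" "\<And>n. C n \<subseteq> \<Omega>" "\<And>n. C n \<subseteq> interior (C (Suc n))"
    "(\<Union>n. C n) = \<Omega>"
    using open_Union_compact_subsets[OF open_dom] by metis
  have C_Suc: "C n \<subseteq> C (Suc n)" for n using C(3) interior_subset by blast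
  have [measurable]: "C n \<in> sets borel" for n using C(1) by (simp add: compact_imp_closed)
  \<comment> \<open>Compactness supplies finite measure, and the lower bound on \<open>u\<close>
    supplies both a starting constant for the iteration and finiteness of the potential of
    \<open>D n\<close>.\<close>
  define D where "D n = C n \<inter> {y. inverse (real (Suc n)) \<le> u y}" for n
  have [measurable]: "D n \<in> sets borel" for n unfolding D_def by measurable
  have D_Suc: "D n \<subseteq> D (Suc n)" for n
  proof -
    have "inverse (real (Suc (Suc n))) \<le> inverse (real (Suc n))" by (intro le_imp_inverse_le) auto
    then show ?thesis using C_Suc[of n] order_trans unfolding D_def by blast
  qed
  have D_UN: "(\<Union>n. D n) = \<Omega>"
  proof
    show "(\<Union>n. D n) \<subseteq> \<Omega>" using C by (auto simp: D_def)
    show "\<Omega> \<subseteq> (\<Union>n. D n)"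
    proof
      fix y assume y: "y \<in> \<Omega>"
      obtain m where m: "y \<in> C m" using y C(4) by blast
      obtain n where n: "inverse (real (Suc n)) < u y"
        using reals_Archimedean[OF u_pos[OF y]] by auto
      have "C m \<subseteq> C (max m n)" by (rule lift_Suc_mono_le[of C, OF C_Suc]) simp
      moreover have "inverse (real (Suc (max m n))) \<le> inverse (real (Suc n))"
        by (intro le_imp_inverse_le) auto
      then have "inverse (real (Suc (max m n))) \<le> u y" using n by linarith
      ultimately have "y \<in> D (max m n)" using m unfolding D_def by blast
      then show "y \<in> (\<Union>n. D n)" by blast
    qed
  qed
  have PD: "P (D n) x \<le> ennreal r" for n
  proof (rule P_le_from_uniform_tails[OF C(1)[of n] C(2)])
    define a where "a = inverse (real (Suc n))"
    have a: "a > 0" by (simp add: a_def)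
    show "D n \<subseteq> C n" by (auto simp: D_def)
    show "P (D n) y < \<infinity>" if "y \<in> D n" for y
    proof -
      have y: "y \<in> \<Omega>" using that C by (auto simp: D_def)
      have "ennreal (a powr q) * P (D n) y = (\<integral>\<^sup>+ z. ennreal (a powr q) * (k y z * indicator (D n) z) \<partial>M)"
        unfolding P_def by (rule nn_integral_cmult[symmetric]) measurable
      also have "\<dots> \<le> U y"
        unfolding U_def
      proof (intro nn_integral_mono)
        fix z
        show "ennreal (a powr q) * (k y z * indicator (D n) z) \<le> k y z * ennreal (u z powr q)"
        proof (cases "z \<in> D n")
          case True
          then have "a powr q \<le> u z powr q" using a q by (intro powr_mono2) (auto simp: D_def a_def)
          then have "k y z * ennreal (a powr q) \<le> k y z * ennreal (u z powr q)"
            by (intro mult_left_mono ennreal_leI) auto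
          then show ?thesis using True by (simp add: mult.commute)
        qed simp
      qed
      also have "\<dots> < \<infinity>" by (rule Ufin[OF y])
      finally show ?thesis using a by (auto simp: ennreal_mult_less_top)
    qed
    fix E assume E: "E \<in> sets borel" "E \<subseteq> D n" "uniform_tails E"
    have EC: "E \<subseteq> C n" using E by (auto simp: D_def)
    have "ennreal (c1 * enn2real (P E x) powr s) \<le> U x"
      unfolding c1_def s_def U_def
    proof (rule powr_P_le_potential_on[OF q _ u_pos u_le super E(3,1) EC C(1) C(2) a _ x])
      show "a \<le> u y" if "y \<in> E" for y using E(2) that by (auto simp: D_def a_def)
    qed auto
    then have "c1 * enn2real (P E x) powr s \<le> enn2real (U x)"
      using enn2real_mono[of _ "U x"] Ufin[OF x] c1 by fastforce
    then have "enn2real (P E x) powr s \<le> enn2real (U x) / c1"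
      using c1 by (simp add: pos_le_divide_eq mult.commute)
    then have "(enn2real (P E x) powr s) powr (1 / s) \<le> r"
      unfolding r_def using s by (intro powr_mono2) auto
    then have "enn2real (P E x) \<le> r" using s by (simp add: powr_powr)
    moreover have "emeasure M E < \<infinity>" by (rule emeasure_finite_subset_compact[OF C(1,2) EC])
    ultimately show "P E x \<le> ennreal r"
      using P_finite[OF E(3) x E(1)] by (metis ennreal_enn2real ennreal_leI infinity_ennreal_def)
  qed measurable
  have "(\<integral>\<^sup>+ y. k x y \<partial>M) = (\<integral>\<^sup>+ y. (SUP n. k x y * indicator (D n) y) \<partial>M)"
  proof (intro nn_integral_cong)
    fix y
    show "k x y = (SUP n. k x y * indicator (D n) y)"
    proof (cases "y \<in> \<Omega>")
      case True
      then obtain n where n: "y \<in> D n" using D_UN by blast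
      show ?thesis
      proof (rule antisym)
        show "(SUP n. k x y * indicator (D n) y) \<le> k x y"
          by (intro SUP_least) (auto simp: indicator_def)
        show "k x y \<le> (SUP n. k x y * indicator (D n) y)"
          using n by (intro SUP_upper2[of n]) auto
      qed
    qed (simp add: k_def)
  qed
  also have "\<dots> = (SUP n. P (D n) x)"
    unfolding P_def
  proof (rule nn_integral_monotone_convergence_SUP)
    show "incseq (\<lambda>n y. k x y * indicator (D n) y)"
      using D_Suc by (intro incseq_SucI le_funI mult_left_mono) (auto simp: indicator_def)
  qed measurable
  also have "\<dots> \<le> ennreal r" by (intro SUP_least PD)
  finally have le: "(\<integral>\<^sup>+ y. k x y \<partial>M) \<le> ennreal r" .
  then show "(\<integral>\<^sup>+ y. k x y \<partial>M) < \<infinity>" by (auto intro: le_less_trans)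
  have "enn2real (\<integral>\<^sup>+ y. k x y \<partial>M) \<le> r" using enn2real_mono[OF le] r by simp
  then have "enn2real (\<integral>\<^sup>+ y. k x y \<partial>M) powr s \<le> r powr s"
    using s by (intro powr_mono2) auto
  also have "r powr s = enn2real (U x) / c1"
    using s c1 by (simp add: r_def powr_powr)
  finally show "(1 - q) powr (1 / (1 - q)) * enn2real (\<integral>\<^sup>+ y. k x y \<partial>M) powr (1 / (1 - q))
      \<le> enn2real (\<integral>\<^sup>+ y. k x y * ennreal (u y powr q) \<partial>M)"
    unfolding s_def[symmetric] c1_def[symmetric] U_def[symmetric]
    using c1 by (simp add: pos_le_divide_eq mult.commute)
qed

end

section \<open>Boundary data\<close>

lemma perron_const_in_upper_class:
  assumes "open \<Omega>" "\<And>\<zeta>. \<zeta> \<in> boundary_inf \<Omega> \<Longrightarrow> f \<zeta> \<le> c"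
  shows "(\<lambda>_. ereal c) \<in> perron_upper_class \<Omega> f"
  using assms by (auto simp: perron_upper_class_def intro!: superharmonic_on_real[of \<Omega> "\<lambda>_. c"]
      supermean_at_const Liminf_bounded)

text \<open>The lower bound compares with the lower Perron solution, so no minimum principle is needed.\<close>

lemma pwb_solution_bounds:
  assumes "open \<Omega>" "regular_domain \<Omega>" "boundary_inf \<Omega> \<noteq> {}" "continuous_boundary_inf \<Omega> f"
    and f: "\<And>\<zeta>. \<zeta> \<in> boundary_inf \<Omega> \<Longrightarrow> 0 \<le> f \<zeta>" "\<And>\<zeta>. \<zeta> \<in> boundary_inf \<Omega> \<Longrightarrow> f \<zeta> \<le> c"
    and x: "x \<in> \<Omega>"
  shows "0 \<le> pwb_solution \<Omega> f x" "pwb_solution \<Omega> f x \<le> c"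
proof -
  have "resolutive \<Omega> f"
    using assms(2-4) by (auto simp: regular_domain_def regular_boundary_point_def)
  then have eq: "perron_upper \<Omega> f x = perron_lower \<Omega> f x" and fin: "\<bar>perron_upper \<Omega> f x\<bar> \<noteq> \<infinity>"
    using x by (auto simp: resolutive_def)
  have "perron_upper \<Omega> (\<lambda>\<zeta>. - f \<zeta>) x \<le> ereal 0"
    unfolding perron_upper_def using f(1)
    by (intro INF_lower2[OF perron_const_in_upper_class[OF assms(1)]]) auto
  then have ge: "0 \<le> perron_upper \<Omega> f x"
    unfolding eq perron_lower_def by (cases "perron_upper \<Omega> (\<lambda>\<zeta>. - f \<zeta>) x") auto
  have le: "perron_upper \<Omega> f x \<le> ereal c"
    unfolding perron_upper_def using f(2)
    by (intro INF_lower2[OF perron_const_in_upper_class[OF assms(1)]]) auto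
  show "0 \<le> pwb_solution \<Omega> f x" "pwb_solution \<Omega> f x \<le> c"
    using ge le fin unfolding pwb_solution_def by (cases "perron_upper \<Omega> f x"; simp)+
qed

text \<open>With an empty boundary, \<open>sup_norm (boundary_inf \<Omega>)\<close> would be \<open>- \<infinity>\<close>, and regularity would be vacuous.\<close>

lemma boundary_inf_nonempty:
  fixes \<Omega> :: "'a::euclidean_space set"
  assumes "open \<Omega>" "\<Omega> \<noteq> {}"
  shows "boundary_inf \<Omega> \<noteq> {}"
proof
  assume "boundary_inf \<Omega> = {}"
  then have "closedin (Alexandroff_compactification euclidean) (Some ` \<Omega>)"
    unfolding boundary_inf_def by (subst (asm) frontier_of_eq_empty) auto
  then obtain K where K: "compact K" "Some ` \<Omega> = Some ` K"
    by (auto simp: closedin_Alexandroff_compactification)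
  then have "compact \<Omega>" by (metis inj_Some inj_image_eq_iff)
  then have "\<Omega> = {} \<or> \<Omega> = UNIV"
    using assms(1) by (metis clopen compact_imp_closed)
  then show False using assms(2) \<open>compact \<Omega>\<close> not_compact_UNIV[where 'a='a] by simp
qed

lemma bounded_boundary_data:
  assumes "continuous_boundary_inf \<Omega> f"
  shows "bounded (f ` boundary_inf \<Omega>)"
proof -
  have "closedin (Alexandroff_compactification euclidean) (boundary_inf \<Omega>)"
    unfolding boundary_inf_def by (rule closedin_frontier_of)
  then have "compactin (Alexandroff_compactification euclidean) (boundary_inf \<Omega>)"
    by (intro closedin_compact_space compact_space_Alexandroff_compactification)
  then have "compactin (subtopology (Alexandroff_compactification euclidean) (boundary_inf \<Omega>)) (boundary_inf \<Omega>)"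
    by (simp add: compactin_subtopology)
  then have "compactin euclideanreal (f ` boundary_inf \<Omega>)"
    using assms unfolding continuous_boundary_inf_def by (rule image_compactin)
  then show ?thesis by (simp add: compact_imp_bounded)
qed

lemma sup_norm_real:
  assumes "A \<noteq> {}" "\<And>x. x \<in> A \<Longrightarrow> g x = ereal (r x)" "\<And>x. x \<in> A \<Longrightarrow> \<bar>r x\<bar> \<le> b"
  shows "\<exists>m\<ge>0. sup_norm A g = ereal m \<and> (\<forall>x\<in>A. \<bar>r x\<bar> \<le> m) \<and> (\<forall>c. (\<forall>x\<in>A. \<bar>r x\<bar> \<le> c) \<longrightarrow> m \<le> c)"
proof -
  have upper: "sup_norm A g \<le> ereal c" if "\<And>x. x \<in> A \<Longrightarrow> \<bar>r x\<bar> \<le> c" for c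
    unfolding sup_norm_def using assms(2) that by (intro SUP_least) auto
  have lower: "ereal \<bar>r x\<bar> \<le> sup_norm A g" if "x \<in> A" for x
    unfolding sup_norm_def using assms(2)[OF that] that by (intro SUP_upper2[of x]) auto
  obtain x0 where x0: "x0 \<in> A" using assms(1) by blast
  obtain m where m: "sup_norm A g = ereal m"
    using upper[OF assms(3)] lower[OF x0] by (cases "sup_norm A g") auto
  have "0 \<le> m" using lower[OF x0] m by simp
  then show ?thesis
    using m upper lower by (intro exI[of _ m]) auto
qed

section \<open>The estimates\<close>

lemma measurable_ident_radon:
  assumes "radon_measure_on \<Omega> \<mu>"
  shows "(\<lambda>x. x) \<in> \<mu> \<rightarrow>\<^sub>M borel" "space \<mu> = \<Omega>"
proof -
  have s: "sets \<mu> = sets (restrict_space borel \<Omega>)" using assms by (simp add: radon_measure_on_def)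
  then show "space \<mu> = \<Omega>" by (simp add: sets_eq_imp_space_eq[OF s] space_restrict_space)
  show "(\<lambda>x. x) \<in> \<mu> \<rightarrow>\<^sub>M borel"
    unfolding measurable_cong_sets[OF s refl] by (intro measurable_restrict_space1) simp
qed

text \<open>Pushing \<mu> forward along the inclusion extends it by 0 to a measure on the Borel sets
  of the whole space.\<close>

lemma green_potential_distr:
  assumes "green_function \<Omega> G" and \<mu>: "radon_measure_on \<Omega> \<mu>"
  shows "green_potential \<Omega> G (distr \<mu> borel (\<lambda>x. x))"
proof -
  interpret green_function \<Omega> G by fact
  show ?thesis
  proof unfold_locales
    fix K assume K: "compact K" "K \<subseteq> \<Omega>"
    then have "emeasure (distr \<mu> borel (\<lambda>x. x)) K = emeasure \<mu> K"
      using measurable_ident_radon[OF \<mu>] by (subst emeasure_distr) (auto simp: compact_imp_closed Int_absorb2)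
    also have "\<dots> < \<infinity>" using \<mu> K by (simp add: radon_measure_on_def)
    finally show "emeasure (distr \<mu> borel (\<lambda>x. x)) K < \<infinity>" .
  qed simp
qed

lemma (in green_function) potential_distr:
  assumes \<mu>: "radon_measure_on \<Omega> \<mu>" and \<psi>: "\<psi> \<in> borel_measurable borel" and x: "x \<in> \<Omega>"
    and cong: "\<And>y. y \<in> \<Omega> \<Longrightarrow> \<psi>' y = \<psi> y"
  shows "potential G \<mu> \<psi>' x
    = enn2ereal (\<integral>\<^sup>+ y. green_potential.k \<Omega> G x y * ennreal (\<psi> y) \<partial>distr \<mu> borel (\<lambda>x. x))"
proof -
  interpret green_potential \<Omega> G "distr \<mu> borel (\<lambda>x. x)"
    by (rule green_potential_distr[OF _ \<mu>]) unfold_locales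
  have "(\<integral>\<^sup>+ y. k x y * ennreal (\<psi> y) \<partial>distr \<mu> borel (\<lambda>x. x)) = (\<integral>\<^sup>+ y. k x y * ennreal (\<psi> y) \<partial>\<mu>)"
    using measurable_ident_radon(1)[OF \<mu>] \<psi> by (subst nn_integral_distr) auto
  also have "\<dots> = (\<integral>\<^sup>+ y. e2ennreal (G x y) * ennreal (\<psi>' y) \<partial>\<mu>)"
    by (intro nn_integral_cong) (simp add: measurable_ident_radon(2)[OF \<mu>] e2ennreal_G[OF x] cong)
  finally show ?thesis by (simp add: potential_def)
qed

theorem theorem1p3:
  fixes \<Omega> :: "'a::euclidean_space set"
    and G :: "'a \<Rightarrow> 'a \<Rightarrow> ereal"
    and q :: real
    and f :: "'a option \<Rightarrow> real"
    and \<mu> \<nu> :: "'a measure"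
    and u :: "'a \<Rightarrow> real"
    and c1 :: real
    and c2 :: ereal
  assumes "DIM('a) \<ge> 2"
    and "open \<Omega>" "connected \<Omega>" "\<Omega> \<noteq> {}"
    and "is_green_function \<Omega> G"
    and "regular_domain \<Omega>"
    and "0 < q" "q < 1"
    and "continuous_boundary_inf \<Omega> f" "\<forall>\<zeta>\<in>boundary_inf \<Omega>. 0 \<le> f \<zeta>"
    and "radon_measure_on \<Omega> \<mu>" "radon_measure_on \<Omega> \<nu>"
    and "is_solution \<Omega> G q \<mu> \<nu> f u"
    and "bounded (u ` \<Omega>)"
  defines "c1 \<equiv> (1 - q) powr (1 / (1 - q))"
    and "c2 \<equiv> max 1 (epowr (sup_norm \<Omega> (potential G \<mu> (\<lambda>_. 1)) + sup_norm \<Omega> (potential G \<nu> (\<lambda>_. 1))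
                              + sup_norm (boundary_inf \<Omega>) (\<lambda>\<zeta>. ereal (f \<zeta>))) (1 / (1 - q)))"
  shows "c2 < \<infinity> \<and>
    (\<forall>x\<in>\<Omega>. ereal (u x) \<ge> ereal c1 * epowr (potential G \<mu> (\<lambda>_. 1) x) (1 / (1 - q))
                             + potential G \<nu> (\<lambda>_. 1) x + ereal (pwb_solution \<Omega> f x)) \<and>
    (\<forall>x\<in>\<Omega>. ereal (u x) \<le> epowr c2 q * potential G \<mu> (\<lambda>_. 1) x
                             + potential G \<nu> (\<lambda>_. 1) x + ereal (pwb_solution \<Omega> f x)) \<and>
    sup_norm \<Omega> (\<lambda>x. ereal (u x)) \<le> c2"
proof -
  interpret green_function \<Omega> G
    using assms(1-5) by unfold_locales
  define s where "s = 1 / (1 - q)"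
  define M where "M = distr \<mu> borel (\<lambda>x. x)"
  interpret green_potential \<Omega> G M
    unfolding M_def by (rule green_potential_distr[OF _ assms(11)]) unfold_locales
  have q: "0 < q" "q < 1" by fact+
  have s: "s > 0" "(1 - q) * s = 1" using q by (auto simp: s_def)
  have sol: "u \<in> borel_measurable (restrict_space borel \<Omega>)" "\<And>x. x \<in> \<Omega> \<Longrightarrow> 0 < u x"
    "\<And>x. x \<in> \<Omega> \<Longrightarrow> ereal (u x) = potential G \<mu> (\<lambda>y. u y powr q) x + potential G \<nu> (\<lambda>_. 1) x + ereal (pwb_solution \<Omega> f x)"
    using assms(13) by (auto simp: is_solution_def)
  \<comment> \<open>Extended by 0, the solution becomes Borel measurable on the whole space; only
    its values on \<Omega> enter the integrals.\<close>
  define v where "v y = indicator \<Omega> y *\<^sub>R u y" for y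
  have v_meas [measurable]: "v \<in> borel_measurable borel"
    using sol(1) open_dom unfolding v_def[abs_def] by (subst (asm) borel_measurable_restrict_space_iff) auto
  have v_eq: "v y = u y" if "y \<in> \<Omega>" for y using that by (simp add: v_def)
  obtain B where B: "\<And>x. x \<in> \<Omega> \<Longrightarrow> \<bar>u x\<bar> \<le> B"
    using assms(14) unfolding bounded_iff by fastforce
  have bd: "boundary_inf \<Omega> \<noteq> {}" by (rule boundary_inf_nonempty) fact+
  obtain Bf where Bf: "\<And>\<zeta>. \<zeta> \<in> boundary_inf \<Omega> \<Longrightarrow> \<bar>f \<zeta>\<bar> \<le> Bf"
    using bounded_boundary_data[OF assms(9)] unfolding bounded_iff by fastforce
  obtain F where F: "sup_norm (boundary_inf \<Omega>) (\<lambda>\<zeta>. ereal (f \<zeta>)) = ereal F" "0 \<le> F"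
    "\<And>\<zeta>. \<zeta> \<in> boundary_inf \<Omega> \<Longrightarrow> \<bar>f \<zeta>\<bar> \<le> F"
    using sup_norm_real[of "boundary_inf \<Omega>" "\<lambda>\<zeta>. ereal (f \<zeta>)" f Bf, OF bd refl Bf] by auto
  define H where "H = pwb_solution \<Omega> f"
  have H: "0 \<le> H x" "H x \<le> F" if "x \<in> \<Omega>" for x
    unfolding H_def using pwb_solution_bounds[OF open_dom assms(6) bd assms(9) _ _ that, of F] assms(10) F(3)
    by (auto simp: abs_le_iff)
  define Up where "Up x = (\<integral>\<^sup>+ y. k x y * ennreal (v y powr q) \<partial>M)" for x
  define Pn where "Pn x = (\<integral>\<^sup>+ y. k x y \<partial>M)" for x
  have pot_u: "potential G \<mu> (\<lambda>y. u y powr q) x = enn2ereal (Up x)" if "x \<in> \<Omega>" for x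
    unfolding Up_def M_def by (rule potential_distr[OF assms(11) _ that]) (auto simp: v_eq)
  have pot_1: "potential G \<mu> (\<lambda>_. 1) x = enn2ereal (Pn x)" if "x \<in> \<Omega>" for x
    using potential_distr[OF assms(11) _ that, of "\<lambda>_. 1" "\<lambda>_. 1"] by (simp add: Pn_def M_def)
  define a where "a x = enn2real (Pn x)" for x
  define b where "b x = real_of_ereal (potential G \<nu> (\<lambda>_. 1) x)" for x
  define w where "w x = enn2real (Up x)" for x
  have nonneg: "0 \<le> potential G \<nu> (\<lambda>_. 1) x" "0 \<le> a x" "0 \<le> w x" "0 \<le> b x" for x
    by (simp_all add: potential_def a_def w_def b_def real_of_ereal_pos)
  \<comment> \<open>The left side of the integral equation is real and both potentials are
    nonnegative, so neither is infinite and the equation becomes one between reals.\<close>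
  have Up_fin: "Up x < top" and pot_\<nu>: "potential G \<nu> (\<lambda>_. 1) x = ereal (b x)"
    and u_eq: "u x = w x + b x + H x" if x: "x \<in> \<Omega>" for x
  proof -
    have e: "ereal (u x) = enn2ereal (Up x) + potential G \<nu> (\<lambda>_. 1) x + ereal (H x)"
      using sol(3)[OF x] pot_u[OF x] by (simp add: H_def)
    have "Up x \<noteq> top" using e nonneg(1)[of x] by (auto simp: top_ereal_def)
    then show "Up x < top" by (simp add: less_top)
    then have w: "enn2ereal (Up x) = ereal (w x)" by (cases "Up x") (auto simp: w_def)
    show \<nu>: "potential G \<nu> (\<lambda>_. 1) x = ereal (b x)"
      using e w nonneg(1)[of x] unfolding b_def by (cases "potential G \<nu> (\<lambda>_. 1) x") auto
    show "u x = w x + b x + H x" using e unfolding w \<nu> by simp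
  qed
  have w_Up: "ennreal (w x) = Up x" if "x \<in> \<Omega>" for x using Up_fin[OF that] by (simp add: w_def)
  have super: "Up x \<le> ennreal (v x)" if "x \<in> \<Omega>" for x
    unfolding w_Up[OF that, symmetric] v_eq[OF that]
    using u_eq[OF that] nonneg H[OF that] by (intro ennreal_leI) simp
  have v_pos: "0 < v y" and v_le: "v y \<le> B" if "y \<in> \<Omega>" for y
    using sol(2)[OF that] B[OF that] v_eq[OF that] by auto
  have Pn_fin: "Pn x < top" and lower: "c1 * a x powr s \<le> w x" if "x \<in> \<Omega>" for x
    using powr_potential_le_potential[OF q v_meas v_pos v_le super[unfolded Up_def] that]
    by (simp_all add: Pn_def Up_def c1_def s_def a_def w_def)
  have a_Pn: "Pn x = ennreal (a x)" if "x \<in> \<Omega>" for x using Pn_fin[OF that] by (simp add: a_def)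
  have pot_\<mu>: "potential G \<mu> (\<lambda>_. 1) x = ereal (a x)" if "x \<in> \<Omega>" for x
    using pot_1[OF that] a_Pn[OF that] nonneg(2)[of x] by simp
  have c1: "c1 > 0" using q by (simp add: c1_def)
  \<comment> \<open>Applied twice: with the supremum \<open>m\<close> of \<open>u\<close> to prove
    the uniform estimate, and then with \<open>C2\<close> to obtain the upper estimate.\<close>
  have upper: "w x \<le> c powr q * a x" if x: "x \<in> \<Omega>" and c: "\<And>y. y \<in> \<Omega> \<Longrightarrow> u y \<le> c" for x c
  proof -
    have "Up x \<le> (\<integral>\<^sup>+ y. ennreal (c powr q) * k x y \<partial>M)"
      unfolding Up_def
    proof (intro nn_integral_mono)
      fix y
      show "k x y * ennreal (v y powr q) \<le> ennreal (c powr q) * k x y"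
      proof (cases "y \<in> \<Omega>")
        case True
        then have "v y powr q \<le> c powr q"
          using c[OF True] sol(2)[OF True] q by (intro powr_mono2) (auto simp: v_eq)
        then show ?thesis by (subst mult.commute) (intro mult_right_mono ennreal_leI, auto)
      qed (simp add: k_def)
    qed
    also have "\<dots> = ennreal (c powr q) * Pn x"
      unfolding Pn_def by (intro nn_integral_cmult) measurable
    also have "\<dots> = ennreal (c powr q * a x)"
      using nonneg(2)[of x] by (simp add: a_Pn[OF x] ennreal_mult)
    finally have "ennreal (w x) \<le> ennreal (c powr q * a x)" by (simp add: w_Up[OF x])
    then show ?thesis using nonneg(2)[of x] by simp
  qed
  have a_le: "\<bar>a x\<bar> \<le> (B / c1) powr (1 / s)" if x: "x \<in> \<Omega>" for x
  proof -
    have "c1 * a x powr s \<le> B" using lower[OF x] u_eq[OF x] nonneg(4)[of x] H[OF x] B[OF x] by linarith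
    then have "a x powr s \<le> B / c1" using c1 by (simp add: pos_le_divide_eq mult.commute)
    then have "(a x powr s) powr (1 / s) \<le> (B / c1) powr (1 / s)" using s by (intro powr_mono2) auto
    then show ?thesis using s nonneg(2)[of x] by (simp add: powr_powr)
  qed
  have b_le: "\<bar>b x\<bar> \<le> B" if x: "x \<in> \<Omega>" for x
    using u_eq[OF x] nonneg(3,4)[of x] H[OF x] B[OF x] by linarith
  obtain A1 where A1: "sup_norm \<Omega> (potential G \<mu> (\<lambda>_. 1)) = ereal A1" "0 \<le> A1" "\<And>x. x \<in> \<Omega> \<Longrightarrow> \<bar>a x\<bar> \<le> A1"
    using sup_norm_real[of \<Omega> "potential G \<mu> (\<lambda>_. 1)" a "(B / c1) powr (1 / s)", OF assms(4) pot_\<mu> a_le] by auto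
  obtain A2 where A2: "sup_norm \<Omega> (potential G \<nu> (\<lambda>_. 1)) = ereal A2" "0 \<le> A2" "\<And>x. x \<in> \<Omega> \<Longrightarrow> \<bar>b x\<bar> \<le> A2"
    using sup_norm_real[of \<Omega> "potential G \<nu> (\<lambda>_. 1)" b B, OF assms(4) pot_\<nu> b_le] by auto
  obtain m where m: "sup_norm \<Omega> (\<lambda>x. ereal (u x)) = ereal m" "0 \<le> m" "\<And>x. x \<in> \<Omega> \<Longrightarrow> \<bar>u x\<bar> \<le> m"
    "\<And>c. \<forall>x\<in>\<Omega>. \<bar>u x\<bar> \<le> c \<Longrightarrow> m \<le> c"
    using sup_norm_real[of \<Omega> "\<lambda>x. ereal (u x)" u B, OF assms(4) refl B] by auto
  define S where "S = A1 + A2 + F"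
  define C2 where "C2 = max 1 (S powr s)"
  have S: "0 \<le> S" using A1 A2 F by (simp add: S_def)
  have c2: "c2 = ereal C2"
    by (simp add: c2_def A1(1) A2(1) F(1) epowr_def S_def C2_def s_def one_ereal_def)
  \<comment> \<open>If \<open>m > 1\<close>, then \<open>m powr q \<ge> 1\<close> absorbs the terms
    that lack this factor, so that \<open>m \<le> m powr q * S\<close>. Dividing gives
    \<open>m powr (1 - q) \<le> S\<close>. The case \<open>m \<le> 1\<close> accounts for the
    maximum with 1.\<close>
  have "m \<le> C2"
  proof (cases "m \<le> 1")
    case False
    then have m1: "1 \<le> m powr q" "m > 0" using q by (auto intro: ge_one_powr_ge_zero)
    have "m \<le> m powr q * S"
    proof (rule m(4), rule ballI)
      fix x assume x: "x \<in> \<Omega>"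
      have "u y \<le> m" if "y \<in> \<Omega>" for y using m(3)[OF that] by simp
      then have "w x \<le> m powr q * a x" by (rule upper[OF x])
      also have "\<dots> \<le> m powr q * A1" using A1(3)[OF x] by (intro mult_left_mono) auto
      finally have "w x \<le> m powr q * A1" .
      moreover have "b x + H x \<le> 1 * (A2 + F)" using A2(3)[OF x] H[OF x] by simp
      moreover have "1 * (A2 + F) \<le> m powr q * (A2 + F)"
        using m1 A2 F by (intro mult_right_mono) auto
      ultimately have "u x \<le> m powr q * S"
        unfolding u_eq[OF x] S_def distrib_left by linarith
      then show "\<bar>u x\<bar> \<le> m powr q * S" using sol(2)[OF x] by simp
    qed
    moreover have "m = m powr q * m powr (1 - q)" using m1 by (simp flip: powr_add)
    ultimately have "m powr q * m powr (1 - q) \<le> m powr q * S" by simp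
    then have "m powr (1 - q) \<le> S" using m1 by simp
    then have "(m powr (1 - q)) powr s \<le> S powr s" using s by (intro powr_mono2) auto
    then show ?thesis using m1 s by (simp add: powr_powr C2_def)
  qed (simp add: C2_def)
  then have u_le: "u y \<le> C2" if "y \<in> \<Omega>" for y using m(3)[OF that] by simp
  show ?thesis
  proof (intro conjI ballI)
    show "c2 < \<infinity>" by (simp add: c2)
    show "sup_norm \<Omega> (\<lambda>x. ereal (u x)) \<le> c2" using \<open>m \<le> C2\<close> by (simp add: m c2)
    fix x assume x: "x \<in> \<Omega>"
    show "ereal c1 * epowr (potential G \<mu> (\<lambda>_. 1) x) (1 / (1 - q)) + potential G \<nu> (\<lambda>_. 1) x
        + ereal (pwb_solution \<Omega> f x) \<le> ereal (u x)"
      using lower[OF x] u_eq[OF x]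
      by (simp add: pot_\<mu>[OF x] pot_\<nu>[OF x] epowr_def s_def[symmetric] H_def[symmetric])
    show "ereal (u x) \<le> epowr c2 q * potential G \<mu> (\<lambda>_. 1) x + potential G \<nu> (\<lambda>_. 1) x
        + ereal (pwb_solution \<Omega> f x)"
      using upper[OF x u_le] u_eq[OF x]
      by (simp add: pot_\<mu>[OF x] pot_\<nu>[OF x] epowr_def c2 H_def[symmetric])
  qed
qed

end
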